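(* Let $\mathbb{X}$ be a Banach space with a basis. If $\ell_p$ is isomorphic to a complemented subspace of $\mathbb{X}$ for some $1<p<\infty$, then for any $0<a<1$ the space $\mathbb{X}$ has a quasi-greedy basis $\mathcal{B}$ with $L_m[\mathcal{B}]\gtrsim(\log m)^a$ for $m\in\mathbb{N}$.
   Context: Banach spaces are real or complex and bases are Schauder bases. Let $\mathcal{B}=(\mathbf{x}_n)_{n=1}^\infty$ be a basis of $\mathbb{X}$ with coordinate functionals $(\mathbf{x}_n^* )_{n=1}^\infty$. For $A\subseteq\mathbb{N}$, the coordinate projection is $S_A[\mathcal{B}](f)=\sum_{n\in A}\mathbf{x}_n^*(f)\,\mathbf{x}_n$ (when well defined), and $\operatorname{supp}(f)=\{n:\mathbf{x}_n^*(f)\neq0\}$. The basis is quasi-greedy if $0<\inf_j\|\mathbf{x}_j\|\le\sup_j\|\mathbf{x}_j\|<\infty$ and there is a constant $C$ such that $\|f-S_A[\mathcal{B}](f)\|\le C\|f\|$ whenever $f\in\mathbb{X}$ and $A\subseteq\mathbb{N}$ satisfy $|\mathbf{x}_j^*(f)|\le|\mathbf{x}_k^*(f)|$ for all $j\in\mathbb{N}\setminus A$ and $k\in A$. The w-conditionality constants are $$L_m[\mathcal{B}]=\sup\left\{\frac{\|S_A[\mathcal{B}](f)\|}{\|f\|}: f\ne0,\ \max(\operatorname{supp}(f))\le m,\ A\subseteq\mathbb{N}\right\}.$$ For families of nonnegative reals, $\beta_i\gtrsim\alpha_i$ means there is a constant $C$ with $\alpha_i\le C\beta_i$ for all $i$.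 *)

theory Defs
  imports "HOL-Analysis.Analysis"
begin

text \<open>
  Normed spaces over the real or complex scalars. The norm and the real structure of the space
  come from its type class; \<open>smul\<close> is the multiplication by scalars of the field \<open>'k\<close>.
  By the Gelfand--Mazur theorem the fields of sort \<open>real_normed_field\<close> are, up to isometric
  isomorphism, exactly the types \<^typ>\<open>real\<close> and \<^typ>\<open>complex\<close>.
\<close>

locale normed_space_over = vector_space smul
  for smul :: "'k::real_normed_field \<Rightarrow> 'a::real_normed_vector \<Rightarrow> 'a" +
  assumes norm_scale: "norm (smul c f) = norm c * norm f"
    and scale_of_real: "smul (of_real r) f = r *\<^sub>R f"

lemma normed_space_over_scaleR:
  "normed_space_over (scaleR :: real \<Rightarrow> 'a::real_normed_vector \<Rightarrow> 'a)"
  by unfold_locales (simp_all add: algebra_simps)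

text \<open>
  Sequences are indexed from 0, so that \<open>x n\<close> is the basis vector $\mathbf{x}_{n+1}$.
\<close>

definition schauder_basis ::
    "('k::real_normed_field \<Rightarrow> 'a::real_normed_vector \<Rightarrow> 'a) \<Rightarrow> (nat \<Rightarrow> 'a) \<Rightarrow> bool" where
  "schauder_basis smul x \<longleftrightarrow>
     (\<forall>f. \<exists>!c :: nat \<Rightarrow> 'k. (\<lambda>n. smul (c n) (x n)) sums f)"

definition coord ::
    "('k::real_normed_field \<Rightarrow> 'a::real_normed_vector \<Rightarrow> 'a) \<Rightarrow> (nat \<Rightarrow> 'a) \<Rightarrow> nat \<Rightarrow> 'a \<Rightarrow> 'k" where
  "coord smul x n f = (THE c. (\<lambda>n. smul (c n) (x n)) sums f) n"

definition supp ::
    "('k::real_normed_field \<Rightarrow> 'a::real_normed_vector \<Rightarrow> 'a) \<Rightarrow> (nat \<Rightarrow> 'a) \<Rightarrow> 'a \<Rightarrow> nat set" where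
  "supp smul x f = {n. coord smul x n f \<noteq> 0}"

text \<open>
  The series below converges wherever it is used: in \<open>w_cond_const\<close> the support of \<open>f\<close> is finite,
  and in \<open>quasi_greedy_basis\<close> the coordinates of \<open>f\<close> tend to 0 because the basis is bounded away
  from 0, so that \<open>A\<close> either is finite or contains the support of \<open>f\<close>.
\<close>

definition coord_proj ::
    "('k::real_normed_field \<Rightarrow> 'a::real_normed_vector \<Rightarrow> 'a) \<Rightarrow> (nat \<Rightarrow> 'a) \<Rightarrow> nat set \<Rightarrow> 'a \<Rightarrow> 'a" where
  "coord_proj smul x A f = (\<Sum>n. if n \<in> A then smul (coord smul x n f) (x n) else 0)"

definition quasi_greedy_basis ::
    "('k::real_normed_field \<Rightarrow> 'a::real_normed_vector \<Rightarrow> 'a) \<Rightarrow> (nat \<Rightarrow> 'a) \<Rightarrow> bool" where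
  "quasi_greedy_basis smul x \<longleftrightarrow>
     schauder_basis smul x \<and>
     0 < (INF j. norm (x j)) \<and> bdd_above (range (\<lambda>j. norm (x j))) \<and>
     (\<exists>C. \<forall>f A. (\<forall>j k. j \<notin> A \<longrightarrow> k \<in> A \<longrightarrow>
                     norm (coord smul x j f) \<le> norm (coord smul x k f)) \<longrightarrow>
               norm (f - coord_proj smul x A f) \<le> C * norm f)"

text \<open>
  With indices starting at 0, $\max(\operatorname{supp}(f))\le m$ reads \<open>supp smul x f \<subseteq> {..<m}\<close>.
\<close>

definition w_cond_const ::
    "('k::real_normed_field \<Rightarrow> 'a::real_normed_vector \<Rightarrow> 'a) \<Rightarrow> (nat \<Rightarrow> 'a) \<Rightarrow> nat \<Rightarrow> ennreal" where
  "w_cond_const smul x m =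
     Sup {ennreal (norm (coord_proj smul x A f) / norm f) | f A.
            f \<noteq> 0 \<and> supp smul x f \<subseteq> {..<m}}"

definition lp_space :: "real \<Rightarrow> (nat \<Rightarrow> 'k::real_normed_field) set" where
  "lp_space p = {u. summable (\<lambda>n. norm (u n) powr p)}"

definition lp_norm :: "real \<Rightarrow> (nat \<Rightarrow> 'k::real_normed_field) \<Rightarrow> real" where
  "lp_norm p u = (\<Sum>n. norm (u n) powr p) powr (1 / p)"

definition lp_isomorphic_to ::
    "real \<Rightarrow> ('k::real_normed_field \<Rightarrow> 'a::real_normed_vector \<Rightarrow> 'a) \<Rightarrow> 'a set \<Rightarrow> bool" where
  "lp_isomorphic_to p smul Y \<longleftrightarrow>
     (\<exists>T :: (nat \<Rightarrow> 'k) \<Rightarrow> 'a.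
        bij_betw T (lp_space p) Y \<and>
        (\<forall>u\<in>lp_space p. \<forall>v\<in>lp_space p. T (\<lambda>n. u n + v n) = T u + T v) \<and>
        (\<forall>c. \<forall>u\<in>lp_space p. T (\<lambda>n. c * u n) = smul c (T u)) \<and>
        (\<exists>C. \<forall>u\<in>lp_space p. norm (T u) \<le> C * lp_norm p u) \<and>
        (\<exists>C. \<forall>u\<in>lp_space p. lp_norm p u \<le> C * norm (T u)))"

definition complemented_subspace ::
    "('k::real_normed_field \<Rightarrow> 'a::real_normed_vector \<Rightarrow> 'a) \<Rightarrow> 'a set \<Rightarrow> bool" where
  "complemented_subspace smul Y \<longleftrightarrow>
     (\<exists>P. bounded_linear P \<and> Vector_Spaces.linear smul smul P \<and> P \<circ> P = P \<and> range P = Y)"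

end

theory Submission
  imports Defs "HOL-Library.Discrete_Functions"
begin

text \<open>
  Since $\ell_p \cong \ell_p \oplus \ell_p$, a space $X$ with a complemented copy of $\ell_p$ satisfies
  $X \cong X \oplus \ell_p$, and this is used twice.

  First, $\ell_p$ has Schauder bases whose norm, in terms of the coefficients $c$, is the weighted
  $\ell_p$-norm of the Haar coefficients of $c$. By Hardy's inequality along the dyadic path to the
  cut-off point the partial sums are bounded, and $\|\sum_{n<N} e_n\|$ can be given the order of any
  power $N^\theta$, $0 < \theta < 1$. Combining two such bases, with $\theta$ close to 1 and close to 0,
  and the given basis of $X$ yields a basis $(y_n)$ of $X$ whose w-conditionality constants are at
  least of order $m^a$.

  Then, following Dilworth, Kalton and Kutzarova, the coordinates are split into consecutive blocks
  of length $2^n$, and $f$ is given the norm $\|\sum_n \theta_n(f) y_n\| + \|f - Qf\|_p$, where $Q$ takes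
  averages over the blocks and $\theta_n(f)$ is the suitably normalised sum of $f$ over the $n$-th block.
  This is a norm of $X \oplus \ell_p$ in which the unit vectors form a quasi-greedy basis because the
  lengths of the blocks grow geometrically. As the normalised block averages span a copy of $(y_n)$
  and the first $n$ blocks have fewer than $2^n$ coordinates, the order $m^a$ becomes $(\log m)^a$.
\<close>

section \<open>Schauder bases and basic sequences\<close>

text \<open>All norms matter only up to equivalence, so constants are never optimised:
  \<open>lpn\<close> is handled with a quasi-triangle inequality of constant 2, and the sum of X and
  ell_p is not formed as a space but is spread out inside X by \<open>lp_splitting\<close>. Bases
  are therefore sequences of vectors of X whose finite combinations have a computable norm;
  \<open>basic_seq\<close> and \<open>fundamental\<close> then yield the Schauder property. With
  weight 2^(-\<tau> l) at level l, the first N unit vectors have a sum of order N^(1-\<tau>), and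
  both Hardy inequalities rest on 0 < \<tau> < 1. Two such exponents can differ by any a < 1, which
  is where the range of a comes from. In the second construction 1 < p makes 2^(n/p) grow and
  2^(-(1-1/p) n) decay geometrically, so sums over the blocks before and after a critical block are
  dominated by a single term. A further obstacle is that oscillations have vanishing block sums and
  so are not free coordinates; they need a parametrisation by ell_p that is bounded in both
  directions, uniformly in the block.\<close>

lemma Baire_ball:
  fixes V :: "nat \<Rightarrow> 'a::banach set"
  assumes "\<Union>(range V) = UNIV"
  shows "\<exists>k f r. r > 0 \<and> ball f r \<subseteq> closure (V k)"
proof (rule ccontr)
  assume neg: "\<not> ?thesis"
  have "Met_TC.mtopology interior_of \<Union>(range (\<lambda>k. closure (V k))) = ({} :: 'a set)"
  proof (rule Met_TC.metric_Baire_category_alt)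
    show "Metric_space.mcomplete (UNIV :: 'a set) dist"
      by (simp add: complete_UNIV)
    show "countable (range (\<lambda>k. closure (V k)))" by simp
    fix T assume "T \<in> range (\<lambda>k. closure (V k))"
    then obtain k where T: "T = closure (V k)" by auto
    have "interior T = {}"
      using neg unfolding T mem_interior[symmetric] by (auto simp: interior_def) 
    then show "closedin Met_TC.mtopology T \<and> Met_TC.mtopology interior_of T = {}"
      using T by simp
  qed
  moreover have "\<Union>(range (\<lambda>k. closure (V k))) = UNIV" 
    using assms closure_subset by blast
  ultimately show False by simp
qed

text \<open>Completeness of the scalar field is part of the locale because coefficients are obtained
  as limits of scalar sequences and as sums of scalar series.\<close>

locale banach_space_over = normed_space_over smul
  for smul :: "'k::{real_normed_field, banach} \<Rightarrow> 'a::banach \<Rightarrow> 'a"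
begin

definition lincomb :: "(nat \<Rightarrow> 'k) \<Rightarrow> (nat \<Rightarrow> 'a) \<Rightarrow> nat \<Rightarrow> 'a" where
  "lincomb c x n = (\<Sum>k<n. smul (c k) (x k))"

text \<open>\<open>K\<close> bounds the basis constant. The condition speaks of finite sums with
  arbitrary coefficients, so it can be checked before any coordinate functional exists; zero vectors
  are not excluded by it.\<close>

definition basic_seq :: "real \<Rightarrow> (nat \<Rightarrow> 'a) \<Rightarrow> bool" where
  "basic_seq K x \<longleftrightarrow> (\<forall>c m n. m \<le> n \<longrightarrow> norm (lincomb c x m) \<le> K * norm (lincomb c x n))"

definition fundamental :: "(nat \<Rightarrow> 'a) \<Rightarrow> bool" where
  "fundamental x \<longleftrightarrow> (\<forall>f. \<forall>e>0. \<exists>c n. norm (f - lincomb c x n) < e)"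

lemma bounded_bilinear_smul: "bounded_bilinear smul"
proof
  fix r a b
  have "smul (r *\<^sub>R a) b = smul (of_real r) (smul a b)"
    by (metis scaleR_conv_of_real scale_scale)
  then show "smul (r *\<^sub>R a) b = r *\<^sub>R smul a b"
    by (simp only: scale_of_real)
  have "smul a (r *\<^sub>R b) = smul a (smul (of_real r) b)"
    by (simp add: scale_of_real)
  also have "\<dots> = smul (of_real r) (smul a b)"
    by (rule scale_left_commute)
  finally show "smul a (r *\<^sub>R b) = r *\<^sub>R smul a b"
    by (simp only: scale_of_real)
next
  show "\<exists>K. \<forall>a b. norm (smul a b) \<le> norm a * norm b * K"
    by (rule exI[of _ 1]) (simp add: norm_scale)
qed (simp_all add: scale_left_distrib scale_right_distrib)

lemma lincomb_add: "lincomb (\<lambda>k. c k + d k) x n = lincomb c x n + lincomb d x n"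
  by (simp add: lincomb_def scale_left_distrib sum.distrib)

lemma lincomb_diff: "lincomb (\<lambda>k. c k - d k) x n = lincomb c x n - lincomb d x n"
  by (simp add: lincomb_def scale_left_diff_distrib sum_subtractf)

lemma lincomb_scale: "lincomb (\<lambda>k. a * c k) x n = smul a (lincomb c x n)"
  by (simp add: lincomb_def scale_sum_right)

lemma lincomb_cong: "(\<And>k. k < n \<Longrightarrow> c k = d k) \<Longrightarrow> lincomb c x n = lincomb d x n"
  by (simp add: lincomb_def)

lemma lincomb_truncate:
  assumes "m \<le> n"
  shows "lincomb (\<lambda>k. if k < m then c k else 0) x n = lincomb c x m"
proof -
  have "lincomb (\<lambda>k. if k < m then c k else 0) x n = (\<Sum>k<n. if k < m then smul (c k) (x k) else 0)"
    unfolding lincomb_def by (intro sum.cong) auto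
  also have "\<dots> = (\<Sum>k\<in>{..<n} \<inter> {k. k < m}. smul (c k) (x k))"
    by (subst sum.If_cases) auto
  also have "{..<n} \<inter> {k. k < m} = {..<m}" using assms by auto
  finally show ?thesis by (simp add: lincomb_def)
qed

lemma sums_unique_coeffs:
  assumes "schauder_basis smul x" "(\<lambda>n. smul (c n) (x n)) sums f"
  shows "coord smul x n f = c n"
proof -
  have "\<exists>!c :: nat \<Rightarrow> 'k. (\<lambda>n. smul (c n) (x n)) sums f"
    using assms(1) by (simp add: schauder_basis_def)
  then have "(THE c. (\<lambda>n. smul (c n) (x n)) sums f) = c"
    using assms(2) by (rule the1_equality[of "\<lambda>c. (\<lambda>n. smul (c n) (x n)) sums f"])
  then show ?thesis by (simp add: coord_def)
qed

lemma sums_coord: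
  assumes "schauder_basis smul x"
  shows "(\<lambda>n. smul (coord smul x n f) (x n)) sums f"
proof -
  have "\<exists>!c :: nat \<Rightarrow> 'k. (\<lambda>n. smul (c n) (x n)) sums f"
    using assms by (simp add: schauder_basis_def)
  then show ?thesis unfolding coord_def by (rule theI')
qed

lemma coord_scale:
  assumes "schauder_basis smul x"
  shows "coord smul x n (smul a f) = a * coord smul x n f"
  using bounded_linear.sums[OF bounded_bilinear.bounded_linear_right[OF bounded_bilinear_smul]
    sums_coord[OF assms, of f], of a]
  by (intro sums_unique_coeffs[OF assms]) simp

lemma coord_diff:
  assumes "schauder_basis smul x"
  shows "coord smul x n (f - g) = coord smul x n f - coord smul x n g"
  using sums_diff[OF sums_coord[OF assms, of f] sums_coord[OF assms, of g]]
  by (intro sums_unique_coeffs[OF assms]) (simp add: scale_left_diff_distrib)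

lemma coord_lincomb:
  assumes "schauder_basis smul x"
  shows "coord smul x k (lincomb c x n) = (if k < n then c k else 0)"
proof -
  have "(\<lambda>k. smul (if k < n then c k else 0) (x k)) sums (\<Sum>k<n. smul (if k < n then c k else 0) (x k))"
    by (rule sums_finite) auto
  then have "(\<lambda>k. smul (if k < n then c k else 0) (x k)) sums lincomb c x n"
    by (simp add: lincomb_def)
  then show ?thesis by (rule sums_unique_coeffs[OF assms])
qed

lemma schauder_nonzero:
  assumes "schauder_basis smul x"
  shows "x k \<noteq> 0"
proof
  assume "x k = 0"
  then have "(\<lambda>n. smul (if n = k then 1 else 0) (x n)) = (\<lambda>n. 0)"
    by auto
  then have "(\<lambda>n. smul (if n = k then 1 else 0) (x n)) sums 0" by simp
  from sums_unique_coeffs[OF assms this, of k] have 1: "coord smul x k 0 = 1" by simp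
  have "(\<lambda>n. smul 0 (x n)) sums 0" by simp
  from sums_unique_coeffs[OF assms this, of k] 1 show False by simp
qed

lemma schauder_fundamental:
  assumes "schauder_basis smul x"
  shows "fundamental x"
  unfolding fundamental_def
proof (intro allI impI)
  fix f e assume e: "(0::real) < e"
  have "(\<lambda>n. lincomb (\<lambda>k. coord smul x k f) x n) \<longlonglongrightarrow> f"
    using sums_coord[OF assms, of f] by (simp add: sums_def lincomb_def)
  from LIMSEQ_D[OF this e] obtain n where "norm (lincomb (\<lambda>k. coord smul x k f) x n - f) < e"
    by blast
  then show "\<exists>c n. norm (f - lincomb c x n) < e" by (metis norm_minus_commute)
qed

text \<open>The definition of a Schauder basis says nothing about continuity of the coordinates, so
  Banach-Steinhaus does not apply to the partial sums directly. As in the open mapping theorem,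
  Baire's theorem bounds them on a dense part of a ball, and successive approximation extends the
  bound to every vector.\<close>

lemma schauder_basic_seq:
  assumes sb: "schauder_basis smul x"
  shows "\<exists>K. basic_seq K x"
proof -
  define P where "P m f = lincomb (\<lambda>k. coord smul x k f) x m" for m f
  have P_diff: "P m (f - g) = P m f - P m g" for m f g
    by (simp add: P_def coord_diff[OF sb] lincomb_diff)
  have P_scale: "P m (smul a f) = smul a (P m f)" for m a f
    by (simp add: P_def coord_scale[OF sb] lincomb_scale)
  have P_lim: "(\<lambda>m. P m f) \<longlonglongrightarrow> f" for f
    using sums_coord[OF sb, of f] by (simp add: sums_def P_def lincomb_def)
  \<comment> \<open>Convergent partial sums are bounded, so these sets cover X. They are not known
    to be closed, which is why \<open>Baire_ball\<close> speaks of closures.\<close>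
  define V where "V k = {f. \<forall>m. norm (P m f) \<le> real k}" for k :: nat
  have "f \<in> \<Union>(range V)" for f
  proof -
    from convergentI[OF P_lim[of f]] obtain B where B: "\<And>m. norm (P m f) \<le> B"
      by (metis Bseq_def convergent_imp_Bseq)
    have "B \<le> real (nat \<lceil>B\<rceil>)" by linarith
    then have "f \<in> V (nat \<lceil>B\<rceil>)"
      using B by (auto simp: V_def intro: order_trans)
    then show ?thesis by blast
  qed
  then have "\<Union>(range V) = UNIV" by blast
  from Baire_ball[OF this] obtain k f0 r where r: "r > 0" and sub: "ball f0 r \<subseteq> closure (V k)"
    by blast
  \<comment> \<open>Subtracting approximants of the centre moves the ball to the origin and doubles
    the bound.\<close>
  have near: "\<exists>v. norm (h - v) < e \<and> (\<forall>m. norm (P m v) \<le> 2 * real k)"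
    if h: "norm h < r" and e: "e > 0" for h e
  proof -
    have "f0 + h \<in> closure (V k)" "f0 \<in> closure (V k)"
      using sub r h by (auto simp: dist_norm)
    then obtain v w where v: "v \<in> V k" "dist v (f0 + h) < e/2" and w: "w \<in> V k" "dist w f0 < e/2"
      using e unfolding closure_approachable by (meson half_gt_zero)
    have "h - (v - w) = (f0 + h - v) - (f0 - w)" by simp
    also have "norm \<dots> \<le> norm (f0 + h - v) + norm (f0 - w)" by (rule norm_triangle_ineq4)
    also have "\<dots> < e" using v(2) w(2) by (simp add: dist_norm norm_minus_commute)
    finally have 1: "norm (h - (v - w)) < e" .
    have "norm (P m (v - w)) \<le> 2 * real k" for m
    proof -
      have "norm (P m v) \<le> k" "norm (P m w) \<le> k" using v(1) w(1) by (auto simp: V_def)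
      then show ?thesis unfolding P_diff using norm_triangle_ineq4[of "P m v" "P m w"] by linarith
    qed
    with 1 show ?thesis by blast
  qed
  \<comment> \<open>Scaling h to norm r/2 turns the bound 2k into 4k/r times the norm of h.\<close>
  define L where "L = 4 * real k / r"
  have L0: "L \<ge> 0" using r by (simp add: L_def)
  have "\<exists>v. norm (h - v) < e \<and> (\<forall>m. norm (P m v) \<le> L * norm h)" if e: "e > 0" for h e
  proof (cases "h = 0")
    case True
    have "P m 0 = 0" for m using P_scale[of m 0 0] by simp
    then show ?thesis using True e by (intro exI[of _ 0]) simp
  next
    case False
    define t where "t = r / (2 * norm h)"
    have t: "t > 0" using False r by (simp add: t_def)
    have "norm (smul (of_real t) h) < r" using t False r by (simp add: norm_scale) (simp add: t_def)
    from near[OF this, of "t * e"] t e obtain v where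
      v: "norm (smul (of_real t) h - v) < t * e" "\<And>m. norm (P m v) \<le> 2 * real k" by auto
    define v' where "v' = smul (of_real (1/t)) v"
    have "h - v' = smul (of_real (1/t)) (smul (of_real t) h - v)"
      using t by (simp add: v'_def scale_right_diff_distrib flip: of_real_mult)
    then have "norm (h - v') = norm (smul (of_real t) h - v) / t"
      using t by (simp add: norm_scale norm_divide)
    also have "\<dots> < e" using v(1) t by (simp add: field_simps)
    finally have 1: "norm (h - v') < e" .
    have "norm (P m v') \<le> L * norm h" for m
    proof -
      have "norm (P m v') = norm (P m v) / t"
        using t by (simp add: v'_def P_scale norm_scale norm_divide)
      also have "\<dots> \<le> 2 * real k / t" using v(2) t by (simp add: divide_right_mono)
      also have "\<dots> = L * norm h" using r False by (simp add: t_def L_def field_simps)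
      finally show ?thesis .
    qed
    with 1 show ?thesis by blast
  qed
  note ex_approx = this
  define F where "F h e = (SOME v. norm (h - v) < e \<and> (\<forall>m. norm (P m v) \<le> L * norm h))" for h e
  have F: "norm (h - F h e) < e" "norm (P m (F h e)) \<le> L * norm h" if "e > 0" for h e m
    using someI_ex[OF ex_approx[OF that, of h]] by (simp_all add: F_def)
  have bound: "norm (P m h) \<le> 2 * L * norm h" for m h
  proof (cases "h = 0")
    case True
    have "P m 0 = 0" for m using P_scale[of m 0 0] by simp
    then show ?thesis using True by simp
  next
    case False
    \<comment> \<open>\<open>H i\<close> is what remains of h after i approximants; its norm bound
      halves at each step, so h is the sum of the \<open>v i\<close>, and the partial sum operators
      are bounded on \<open>v i\<close> by a geometric sequence.\<close>
    define H where "H = rec_nat h (\<lambda>i g. g - F g (norm h / 2^(Suc i)))"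
    define v where "v i = F (H i) (norm h / 2^(Suc i))" for i
    have H0: "H 0 = h" and HS: "H (Suc i) = H i - v i" for i
      by (simp_all add: H_def v_def)
    have pos: "norm h / 2^i > 0" for i :: nat using False by simp
    have Hn: "norm (H i) \<le> norm h / 2^i" for i
    proof (cases i)
      case (Suc j)
      then show ?thesis using F(1)[OF pos[of "Suc j"], of "H j"] by (simp add: HS v_def)
    qed (simp add: H0)
    have Pv: "norm (P m (v i)) \<le> L * norm h / 2^i" for m i
    proof -
      have "norm (P m (v i)) \<le> L * norm (H i)" unfolding v_def by (rule F(2)[OF pos])
      also have "\<dots> \<le> L * (norm h / 2^i)" using Hn L0 by (intro mult_left_mono) auto
      finally show ?thesis by simp
    qed
    have geo: "(\<lambda>i. B / 2^i) sums (2 * B)" for B :: real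
      using sums_mult[OF geometric_sums[of "1/2::real"], of B] by (simp add: power_divide mult.commute)
    have sumv: "(\<Sum>i<n. v i) = h - H n" for n
      by (induction n) (simp_all add: H0 HS)
    \<comment> \<open>Termwise sums of the coordinates of the \<open>v i\<close>; uniqueness of
      expansions will identify them with the coordinates of h.\<close>
    define C where "C k = (\<Sum>i. coord smul x k (v i))" for k
    have Csums: "(\<lambda>i. coord smul x k (v i)) sums C k" for k
    proof -
      have xk: "norm (x k) > 0" using schauder_nonzero[OF sb] by simp
      have le: "norm (coord smul x k (v i)) \<le> (2 * L * norm h / norm (x k)) / 2^i" for i
      proof -
        have "smul (coord smul x k (v i)) (x k) = P (Suc k) (v i) - P k (v i)"
          by (simp add: P_def lincomb_def)
        then have "norm (coord smul x k (v i)) * norm (x k) = norm (P (Suc k) (v i) - P k (v i))"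
          by (metis norm_scale)
        also have "\<dots> \<le> L * norm h / 2^i + L * norm h / 2^i"
          by (intro order_trans[OF norm_triangle_ineq4] add_mono Pv)
        finally show ?thesis using xk by (simp add: field_simps)
      qed
      have "summable (\<lambda>i. norm (coord smul x k (v i)))"
        by (rule summable_comparison_test[OF _ sums_summable[OF geo[of "2 * L * norm h / norm (x k)"]]])
          (use le in auto)
      from summable_sums[OF summable_norm_cancel[OF this]] show ?thesis by (simp only: C_def)
    qed
    have Wsums: "(\<lambda>i. P m (v i)) sums lincomb C x m" for m
      unfolding P_def lincomb_def
      by (intro sums_sum bounded_linear.sums[OF bounded_bilinear.bounded_linear_left[OF bounded_bilinear_smul]] Csums)
    \<comment> \<open>Uniform in m, which permits the exchange of the limits in m and n below. The
      case n = 0 is the final bound.\<close>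
    have Wtail: "norm (lincomb C x m - (\<Sum>i<n. P m (v i))) \<le> 2 * L * norm h / 2^n" for m n
    proof -
      have 1: "(\<lambda>i. P m (v (i + n))) sums (lincomb C x m - (\<Sum>i<n. P m (v i)))"
        using Wsums[of m] by (subst sums_iff_shift) simp
      have 2: "(\<lambda>i. (L * norm h / 2^n) / 2^i) sums (2 * (L * norm h / 2^n))" by (rule geo)
      have "norm (P m (v (i + n))) \<le> (L * norm h / 2^n) / 2^i" for i
        using Pv[of m "i+n"] by (simp add: power_add field_simps)
      from norm_sums_le[OF 1 2 this] show ?thesis by simp
    qed
    have "(\<lambda>m. lincomb C x m) \<longlonglongrightarrow> h"
    proof (rule LIMSEQ_I)
      fix e :: real assume e: "e > 0"
      have "(\<lambda>n. (2 * L + 1) * norm h * (1/2)^n) \<longlonglongrightarrow> (2 * L + 1) * norm h * 0"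
        by (intro tendsto_intros) auto
      from LIMSEQ_D[OF this, of "e/2"] e obtain n where
        "norm ((2 * L + 1) * norm h * (1/2)^n) < e/2" by auto
      then have n: "2 * L * norm h / 2^n + norm h / 2^n < e/2"
        using L0 by (simp add: power_divide field_simps abs_mult)
      have "(\<lambda>m. \<Sum>i<n. P m (v i)) \<longlonglongrightarrow> (\<Sum>i<n. v i)"
        by (intro tendsto_sum P_lim)
      from LIMSEQ_D[OF this, of "e/2"] e obtain M where
        M: "\<And>m. m \<ge> M \<Longrightarrow> norm ((\<Sum>i<n. P m (v i)) - (\<Sum>i<n. v i)) < e/2" by auto
      show "\<exists>M. \<forall>m\<ge>M. norm (lincomb C x m - h) < e"
      proof (intro exI[of _ M] allI impI)
        fix m assume m: "m \<ge> M"
        have "lincomb C x m - h = (lincomb C x m - (\<Sum>i<n. P m (v i))) +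
            (((\<Sum>i<n. P m (v i)) - (\<Sum>i<n. v i)) - H n)"
          by (simp add: sumv)
        also have "norm \<dots> \<le> norm (lincomb C x m - (\<Sum>i<n. P m (v i))) +
            (norm ((\<Sum>i<n. P m (v i)) - (\<Sum>i<n. v i)) + norm (H n))"
          by (intro order_trans[OF norm_triangle_ineq] add_left_mono norm_triangle_ineq4)
        also have "\<dots> < e" using Wtail[of m n] M[OF m] Hn[of n] n by linarith
        finally show "norm (lincomb C x m - h) < e" .
      qed
    qed
    then have "(\<lambda>k. smul (C k) (x k)) sums h" by (simp add: sums_def lincomb_def)
    from sums_unique_coeffs[OF sb this] have "P m h = lincomb C x m" for m
      by (simp add: P_def)
    then show ?thesis using Wtail[of m 0] by simp
  qed
  have "norm (lincomb c x m) \<le> 2 * L * norm (lincomb c x n)" if "m \<le> n" for c m n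
  proof -
    have "P m (lincomb c x n) = lincomb c x m"
      unfolding P_def coord_lincomb[OF sb] using that by (intro lincomb_cong) auto
    then show ?thesis using bound[of m "lincomb c x n"] by simp
  qed
  then show ?thesis by (auto simp: basic_seq_def)
qed

lemma basic_seqD: "basic_seq K x \<Longrightarrow> m \<le> n \<Longrightarrow> norm (lincomb c x m) \<le> K * norm (lincomb c x n)"
  by (simp add: basic_seq_def)

lemma basic_seq_coeff:
  assumes "basic_seq K x" "k < n"
  shows "norm (c k) * norm (x k) \<le> 2 * K * norm (lincomb c x n)"
proof -
  have "smul (c k) (x k) = lincomb c x (Suc k) - lincomb c x k"
    by (simp add: lincomb_def)
  then have "norm (c k) * norm (x k) = norm (lincomb c x (Suc k) - lincomb c x k)"
    by (metis norm_scale)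
  also have "\<dots> \<le> K * norm (lincomb c x n) + K * norm (lincomb c x n)"
    using assms by (intro order_trans[OF norm_triangle_ineq4] add_mono basic_seqD) auto
  finally show ?thesis by simp
qed

lemma basic_seq_nonneg:
  assumes "basic_seq K x" "x 0 \<noteq> 0"
  shows "0 \<le> K"
proof -
  have "lincomb (\<lambda>k. 1) x 1 = x 0" by (simp add: lincomb_def)
  moreover have "norm (lincomb (\<lambda>k. 1) x 0) \<le> K * norm (lincomb (\<lambda>k. 1) x 1)"
    using assms(1) by (rule basic_seqD) simp
  ultimately have "0 \<le> K * norm (x 0)" by (simp add: lincomb_def)
  then show ?thesis using assms(2) by (simp add: zero_le_mult_iff)
qed

text \<open>Grunblum's criterion. The coefficients of finite combinations approximating f form
  Cauchy sequences, because each coefficient is controlled by the difference of two consecutive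
  partial sums; their limits are the coefficients of f.\<close>

lemma schauder_basisI:
  assumes bs: "basic_seq K x" and fd: "fundamental x" and nz: "\<And>k. x k \<noteq> 0"
  shows "schauder_basis smul x"
  unfolding schauder_basis_def
proof (intro allI ex_ex1I)
  have K0: "K \<ge> 0" using basic_seq_nonneg[OF bs nz] .
  fix f
  have "\<exists>c n. norm (f - lincomb c x n) < 1 / real (Suc i)" for i
    using fd by (simp add: fundamental_def)
  then obtain c N where cN: "\<And>i. norm (f - lincomb (c i) x (N i)) < 1 / real (Suc i)"
    by metis
  \<comment> \<open>Padding by zeros lets combinations of different lengths be subtracted.\<close>
  define d where "d i k = (if k < N i then c i k else 0)" for i k
  have dl: "lincomb (d i) x n = lincomb (c i) x (N i)" if "n \<ge> N i" for i n
    unfolding d_def using lincomb_truncate[OF that] .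
  define g where "g i = lincomb (d i) x (N i)" for i
  have gf: "g \<longlonglongrightarrow> f"
  proof -
    have "(\<lambda>i. f - g i) \<longlonglongrightarrow> 0"
      by (rule Lim_null_comparison[OF _ LIMSEQ_inverse_real_of_nat])
        (use cN in \<open>auto simp: g_def dl inverse_eq_divide less_imp_le intro!: always_eventually\<close>)
    from tendsto_diff[OF tendsto_const[of f] this] show ?thesis by simp
  qed
  have pd: "norm (lincomb (\<lambda>k. d i k - d j k) x m) \<le> K * norm (g i - g j)" for i j m
  proof -
    define n where "n = max m (max (N i) (N j))"
    have "lincomb (\<lambda>k. d i k - d j k) x n = g i - g j"
      by (simp add: lincomb_diff g_def dl n_def)
    moreover have "norm (lincomb (\<lambda>k. d i k - d j k) x m) \<le> K * norm (lincomb (\<lambda>k. d i k - d j k) x n)"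
      using bs by (rule basic_seqD) (simp add: n_def)
    ultimately show ?thesis by simp
  qed
  have cauchy_d: "Cauchy (\<lambda>i. d i k)" for k
  proof (rule metric_CauchyI)
    fix e :: real assume e: "e > 0"
    have xk: "norm (x k) > 0" using nz by simp
    define e' where "e' = e * norm (x k) / (2 * K + 1)"
    have e': "e' > 0" using e xk K0 by (simp add: e'_def)
    from LIMSEQ_imp_Cauchy[OF gf] obtain M where
      M: "\<And>i j. i \<ge> M \<Longrightarrow> j \<ge> M \<Longrightarrow> norm (g i - g j) < e'"
      using e' by (metis CauchyD)
    have "dist (d i k) (d j k) < e" if ij: "i \<ge> M" "j \<ge> M" for i j
    proof -
      have "smul (d i k - d j k) (x k) =
          lincomb (\<lambda>k. d i k - d j k) x (Suc k) - lincomb (\<lambda>k. d i k - d j k) x k"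
        by (simp add: lincomb_def)
      then have "norm (d i k - d j k) * norm (x k) = norm (lincomb (\<lambda>k. d i k - d j k) x (Suc k)
          - lincomb (\<lambda>k. d i k - d j k) x k)"
        by (metis norm_scale)
      also have "\<dots> \<le> K * norm (g i - g j) + K * norm (g i - g j)"
        by (intro order_trans[OF norm_triangle_ineq4] add_mono pd)
      also have "\<dots> \<le> 2 * K * e'" using M[OF ij] K0 by (simp add: mult_left_mono)
      also have "\<dots> < (2 * K + 1) * e'" using e' by (simp add: algebra_simps)
      also have "\<dots> = e * norm (x k)" using K0 by (simp add: e'_def)
      finally show ?thesis using xk by (simp add: dist_norm)
    qed
    then show "\<exists>M. \<forall>m\<ge>M. \<forall>n\<ge>M. dist (d m k) (d n k) < e" by blast
  qed
  define C where "C k = lim (\<lambda>i. d i k)" for k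
  have dC: "(\<lambda>i. d i k) \<longlonglongrightarrow> C k" for k
    unfolding C_def using cauchy_d[of k] by (simp add: Cauchy_convergent_iff convergent_LIMSEQ_iff)
  \<comment> \<open>Letting j tend to infinity in \<open>pd\<close> compares the approximants with
    the limit coefficients, uniformly in the length m.\<close>
  have pC: "norm (lincomb (\<lambda>k. d i k - C k) x m) \<le> K * norm (g i - f)" for i m
  proof (rule tendsto_le)
    show "(\<lambda>j. norm (lincomb (\<lambda>k. d i k - d j k) x m)) \<longlonglongrightarrow> norm (lincomb (\<lambda>k. d i k - C k) x m)"
      unfolding lincomb_def
      by (intro tendsto_intros bounded_linear.tendsto[OF bounded_bilinear.bounded_linear_left[OF bounded_bilinear_smul]] dC)
    show "(\<lambda>j. K * norm (g i - g j)) \<longlonglongrightarrow> K * norm (g i - f)"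
      by (intro tendsto_intros gf)
  qed (simp_all add: pd)
  have "(\<lambda>m. lincomb C x m) \<longlonglongrightarrow> f"
  proof (rule LIMSEQ_I)
    fix e :: real assume e: "e > 0"
    then obtain i where i: "norm (g i - f) < e / (K + 1)"
      using LIMSEQ_D[OF gf, of "e / (K + 1)"] K0 by auto
    have "norm (lincomb C x m - f) < e" if m: "m \<ge> N i" for m
    proof -
      \<comment> \<open>Beyond \<open>N i\<close> the partial sum of \<open>d i\<close> is
        \<open>g i\<close>, so only the errors bounded by \<open>pC\<close> and by the choice of i
        remain.\<close>
      have "lincomb C x m - f = (g i - f) - lincomb (\<lambda>k. d i k - C k) x m"
        by (simp add: lincomb_diff g_def dl[OF m] dl[OF order_refl])
      also have "norm \<dots> \<le> norm (g i - f) + K * norm (g i - f)"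
        by (intro order_trans[OF norm_triangle_ineq4] add_left_mono pC)
      also have "\<dots> = (K + 1) * norm (g i - f)" by (simp add: algebra_simps)
      also have "\<dots> < e" using i K0 by (simp add: field_simps)
      finally show ?thesis .
    qed
    then show "\<exists>M. \<forall>m\<ge>M. norm (lincomb C x m - f) < e" by blast
  qed
  then show "\<exists>c. (\<lambda>n. smul (c n) (x n)) sums f"
    by (auto simp: sums_def lincomb_def)
  fix c d :: "nat \<Rightarrow> 'k"
  assume "(\<lambda>n. smul (c n) (x n)) sums f" "(\<lambda>n. smul (d n) (x n)) sums f"
  from sums_diff[OF this] have z: "(\<lambda>n. lincomb (\<lambda>k. c k - d k) x n) \<longlonglongrightarrow> 0"
    by (simp add: sums_def lincomb_def scale_left_diff_distrib)
  have "c k = d k" for k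
  proof -
    have "norm (c k - d k) * norm (x k) \<le> 2 * K * norm (0 :: 'a)"
    proof (rule tendsto_lowerbound)
      show "(\<lambda>n. 2 * K * norm (lincomb (\<lambda>k. c k - d k) x n)) \<longlonglongrightarrow> 2 * K * norm (0 :: 'a)"
        by (intro tendsto_intros z)
      show "\<forall>\<^sub>F n in sequentially. norm (c k - d k) * norm (x k) \<le> 2 * K * norm (lincomb (\<lambda>k. c k - d k) x n)"
        using eventually_gt_at_top[of k]
      proof eventually_elim
        case (elim n)
        then show ?case using basic_seq_coeff[OF bs, of k n "\<lambda>k. c k - d k"] by simp
      qed
    qed simp
    then show ?thesis using nz[of k] by (simp add: mult_le_0_iff)
  qed
  then show "c = d" by auto
qed

lemma schauder_normalize:
  assumes sb: "schauder_basis smul x"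
  shows "\<exists>K y. basic_seq K y \<and> fundamental y \<and> (\<forall>k. norm (y k) = 1)"
proof -
  obtain K where K: "basic_seq K x" using schauder_basic_seq[OF sb] by blast
  have nz: "norm (x k) \<noteq> 0" for k using schauder_nonzero[OF sb] by simp
  define y where "y k = smul (of_real (1 / norm (x k))) (x k)" for k
  have l1: "lincomb c y n = lincomb (\<lambda>k. c k * of_real (1 / norm (x k))) x n" for c n
    by (simp add: lincomb_def y_def)
  have l2: "lincomb c x n = lincomb (\<lambda>k. c k * of_real (norm (x k))) y n" for c n
    unfolding l1 using nz by (intro lincomb_cong) simp
  have "basic_seq K y"
    unfolding basic_seq_def l1 using K by (simp add: basic_seq_def)
  moreover have "fundamental y"
    using schauder_fundamental[OF sb] unfolding fundamental_def l2 by metis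
  moreover have "norm (y k) = 1" for k
    using nz by (simp add: y_def norm_scale norm_divide)
  ultimately show ?thesis by blast
qed

end

section \<open>Complemented copies of $\ell_p$\<close>

text \<open>The index set is part of a type and families vanish off it, so that pairs of sequences
  and sequences on part of the naturals fall under one notion.\<close>

definition lp_on :: "real \<Rightarrow> 'i set \<Rightarrow> ('i \<Rightarrow> 'k::real_normed_field) set" where
  "lp_on p I = {u. (\<forall>i. i \<notin> I \<longrightarrow> u i = 0) \<and> (\<lambda>i. norm (u i) powr p) summable_on UNIV}"

definition lpn :: "real \<Rightarrow> ('i \<Rightarrow> 'k::real_normed_field) \<Rightarrow> real" where
  "lpn p u = (\<Sum>\<^sub>\<infinity>i. norm (u i) powr p) powr (1 / p)"

lemma powr_add_le:
  fixes x y p :: real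
  assumes "0 \<le> x" "0 \<le> y" "0 < p"
  shows "(x + y) powr p \<le> 2 powr p * (x powr p + y powr p)"
proof -
  have "(x + y) powr p \<le> (2 * max x y) powr p"
    using assms by (intro powr_mono2) auto
  also have "\<dots> = 2 powr p * max x y powr p"
    using assms by (simp add: powr_mult)
  also have "\<dots> \<le> 2 powr p * (x powr p + y powr p)"
    by (intro mult_left_mono) (auto simp: max_def)
  finally show ?thesis .
qed

lemma powr_inverse_add_le:
  fixes x y p :: real
  assumes "0 \<le> x" "0 \<le> y" "1 \<le> p"
  shows "(x + y) powr (1/p) \<le> x powr (1/p) + y powr (1/p)"
proof (cases "x + y = 0")
  case False
  define s where "s = x + y"
  have s: "s > 0" using False assms by (simp add: s_def)
  have *: "z / s \<le> (z / s) powr (1/p)" if "0 \<le> z" "z \<le> s" for z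
  proof (cases "z = 0")
    case False
    then have "(z / s) powr 1 \<le> (z / s) powr (1/p)"
      using that s assms by (intro powr_mono') auto
    then show ?thesis using that s False by simp
  qed simp
  have "1 = x / s + y / s" using s by (simp add: s_def add_divide_distrib[symmetric])
  also have "\<dots> \<le> (x / s) powr (1/p) + (y / s) powr (1/p)"
    using assms by (intro add_mono *) (auto simp: s_def)
  also have "\<dots> = (x powr (1/p) + y powr (1/p)) / s powr (1/p)"
    using assms s by (simp add: powr_divide add_divide_distrib)
  finally show ?thesis using s by (simp add: field_simps s_def)
qed (use assms in auto)

lemma lpn_nonneg: "0 \<le> lpn p u"
  by (simp add: lpn_def)

lemma lpn_powr:
  assumes "0 < p"
  shows "lpn p u powr p = (\<Sum>\<^sub>\<infinity>i. norm (u i) powr p)"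
  using assms by (simp add: lpn_def powr_powr infsum_nonneg)

lemma lp_on_mono: "u \<in> lp_on p I \<Longrightarrow> (\<And>i. i \<notin> J \<Longrightarrow> u i = 0) \<Longrightarrow> u \<in> lp_on p J"
  by (auto simp: lp_on_def)

lemma lp_on_dominated:
  assumes u: "u \<in> lp_on p I" and p: "0 < p" and le: "\<And>i. norm (v i) \<le> norm (u i)"
  shows "v \<in> lp_on p I" "lpn p v \<le> lpn p u"
proof -
  have le': "norm (v i) powr p \<le> norm (u i) powr p" for i
    using le p by (intro powr_mono2) auto
  have s: "(\<lambda>i. norm (v i) powr p) summable_on UNIV"
    by (rule summable_on_comparison_test[of "\<lambda>i. norm (u i) powr p"])
      (use u le' in \<open>auto simp: lp_on_def\<close>)
  then show "v \<in> lp_on p I" using u le by (auto simp: lp_on_def) (metis norm_le_zero_iff norm_zero)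
  have "(\<Sum>\<^sub>\<infinity>i. norm (v i) powr p) \<le> (\<Sum>\<^sub>\<infinity>i. norm (u i) powr p)"
    using u s le' by (intro infsum_mono) (auto simp: lp_on_def)
  then show "lpn p v \<le> lpn p u"
    unfolding lpn_def using p by (intro powr_mono2 infsum_nonneg) auto
qed

text \<open>The constant 2 comes from \<open>powr_add_le\<close>; it stands in for Minkowski's
  inequality, since norms matter only up to equivalence.\<close>

lemma lp_on_add:
  assumes u: "u \<in> lp_on p I" and v: "v \<in> lp_on p I" and p: "1 \<le> p"
  shows "(\<lambda>i. u i + v i) \<in> lp_on p I" "lpn p (\<lambda>i. u i + v i) \<le> 2 * (lpn p u + lpn p v)"
proof -
  have le: "norm (u i + v i) powr p \<le> 2 powr p * (norm (u i) powr p + norm (v i) powr p)" for i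
  proof -
    have "norm (u i + v i) powr p \<le> (norm (u i) + norm (v i)) powr p"
      using p by (intro powr_mono2 norm_triangle_ineq) auto
    also have "\<dots> \<le> 2 powr p * (norm (u i) powr p + norm (v i) powr p)"
      using p by (intro powr_add_le) auto
    finally show ?thesis .
  qed
  have s: "(\<lambda>i. norm (u i) powr p) summable_on UNIV" "(\<lambda>i. norm (v i) powr p) summable_on UNIV"
    using u v by (auto simp: lp_on_def)
  have s2: "(\<lambda>i. 2 powr p * (norm (u i) powr p + norm (v i) powr p)) summable_on UNIV"
    by (intro summable_on_cmult_right summable_on_add s)
  have s3: "(\<lambda>i. norm (u i + v i) powr p) summable_on UNIV"
    by (rule summable_on_comparison_test[OF s2]) (use le in auto)
  then show "(\<lambda>i. u i + v i) \<in> lp_on p I"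
    using u v by (auto simp: lp_on_def)
  have "(\<Sum>\<^sub>\<infinity>i. norm (u i + v i) powr p) \<le> (\<Sum>\<^sub>\<infinity>i. 2 powr p * (norm (u i) powr p + norm (v i) powr p))"
    by (intro infsum_mono s2 s3 le)
  also have "\<dots> = 2 powr p * ((\<Sum>\<^sub>\<infinity>i. norm (u i) powr p) + (\<Sum>\<^sub>\<infinity>i. norm (v i) powr p))"
    by (simp add: infsum_cmult_right' infsum_add s)
  finally have "lpn p (\<lambda>i. u i + v i) \<le>
      (2 powr p * ((\<Sum>\<^sub>\<infinity>i. norm (u i) powr p) + (\<Sum>\<^sub>\<infinity>i. norm (v i) powr p))) powr (1/p)"
    unfolding lpn_def using p by (intro powr_mono2 infsum_nonneg) auto
  also have "\<dots> = 2 * ((\<Sum>\<^sub>\<infinity>i. norm (u i) powr p) + (\<Sum>\<^sub>\<infinity>i. norm (v i) powr p)) powr (1/p)"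
    using p by (simp add: powr_mult powr_powr infsum_nonneg)
  also have "\<dots> \<le> 2 * (lpn p u + lpn p v)"
    unfolding lpn_def using p by (intro mult_left_mono powr_inverse_add_le infsum_nonneg) auto
  finally show "lpn p (\<lambda>i. u i + v i) \<le> 2 * (lpn p u + lpn p v)" .
qed

lemma lp_on_scale:
  assumes u: "u \<in> lp_on p I" and p: "0 < p"
  shows "(\<lambda>i. c * u i) \<in> lp_on p I" "lpn p (\<lambda>i. c * u i) = norm c * lpn p u"
proof -
  have eq: "norm (c * u i) powr p = norm c powr p * norm (u i) powr p" for i
    by (simp add: norm_mult powr_mult)
  show "(\<lambda>i. c * u i) \<in> lp_on p I"
    using u by (auto simp: lp_on_def eq intro: summable_on_cmult_right)
  show "lpn p (\<lambda>i. c * u i) = norm c * lpn p u"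
    unfolding lpn_def eq using p
    by (simp add: infsum_cmult_right' powr_mult powr_powr infsum_nonneg)
qed

lemma lp_on_diff:
  assumes u: "u \<in> lp_on p I" and v: "v \<in> lp_on p I" and p: "1 \<le> p"
  shows "(\<lambda>i. u i - v i) \<in> lp_on p I" "lpn p (\<lambda>i. u i - v i) \<le> 2 * (lpn p u + lpn p v)"
  using lp_on_add[OF u lp_on_scale(1)[OF v, of "-1"] p] lp_on_scale(2)[OF v, of "-1"] p
  by auto

lemma lp_on_bounded_sums:
  assumes "\<And>i. i \<notin> I \<Longrightarrow> u i = 0" "0 < p" "0 \<le> B"
    "\<And>F. finite F \<Longrightarrow> (\<Sum>i\<in>F. norm (u i) powr p) \<le> B powr p"
  shows "u \<in> lp_on p I" "lpn p u \<le> B"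
proof -
  have s: "(\<lambda>i. norm (u i) powr p) summable_on UNIV"
    using assms(4) by (intro nonneg_bdd_above_summable_on) (auto intro!: bdd_aboveI)
  then show "u \<in> lp_on p I" using assms(1) by (auto simp: lp_on_def)
  have "(\<Sum>\<^sub>\<infinity>i. norm (u i) powr p) \<le> B powr p"
    using s assms(4) by (intro infsum_le_finite_sums) auto
  then have "lpn p u \<le> (B powr p) powr (1/p)"
    unfolding lpn_def using assms(2) by (intro powr_mono2 infsum_nonneg) auto
  also have "\<dots> = B" using assms by (simp add: powr_powr)
  finally show "lpn p u \<le> B" .
qed

lemma sum_le_lpn:
  assumes "u \<in> lp_on p I" "0 < p" "finite F"
  shows "(\<Sum>i\<in>F. norm (u i) powr p) \<le> lpn p u powr p"
  unfolding lpn_powr[OF assms(2)] using assms by (intro finite_sum_le_infsum) (auto simp: lp_on_def)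

lemma lp_on_finite:
  assumes "finite F" "\<And>i. i \<notin> F \<Longrightarrow> u i = 0" "F \<subseteq> I" "0 < p"
  shows "u \<in> lp_on p I" "lpn p u = (\<Sum>i\<in>F. norm (u i) powr p) powr (1/p)"
proof -
  have *: "((\<lambda>i. norm (u i) powr p) has_sum (\<Sum>i\<in>F. norm (u i) powr p)) UNIV"
    using has_sum_finite[OF assms(1), of "\<lambda>i. norm (u i) powr p"]
    by (subst has_sum_cong_neutral[where S = F and T = UNIV and g = "\<lambda>i. norm (u i) powr p", symmetric])
      (use assms in auto)
  then show "u \<in> lp_on p I" using assms by (auto simp: lp_on_def summable_on_def)
  show "lpn p u = (\<Sum>i\<in>F. norm (u i) powr p) powr (1/p)"
    using infsumI[OF *] by (simp add: lpn_def)
qed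

lemma lp_on_tail:
  assumes u: "u \<in> lp_on p I" and p: "0 < p" and e: "0 < e"
  shows "\<exists>F. finite F \<and> F \<subseteq> I \<and> lpn p (\<lambda>i. if i \<in> F then 0 else u i) < e"
proof -
  let ?f = "\<lambda>i. norm (u i) powr p"
  have s: "?f summable_on UNIV" using u by (simp add: lp_on_def)
  have e': "(e/2) powr p > 0" using e by simp
  obtain G where G: "finite G" "dist (sum ?f G) (infsum ?f UNIV) \<le> (e/2) powr p"
    using infsum_finite_approximation[OF s e'] by blast
  have "lpn p (\<lambda>i. if i \<in> G \<inter> I then 0 else u i) \<le> e/2"
  proof (rule lp_on_bounded_sums(2)[where I = UNIV])
    fix F :: "'a set" assume F: "finite F"
    have "(\<Sum>i\<in>F. norm (if i \<in> G \<inter> I then 0 else u i) powr p) = (\<Sum>i\<in>F. if i \<in> G then 0 else ?f i)"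
      using u p by (intro sum.cong) (auto simp: lp_on_def)
    also have "\<dots> = sum ?f (F - G)"
      using F by (intro sum.mono_neutral_cong_right) auto
    finally have 1: "(\<Sum>i\<in>F. norm (if i \<in> G \<inter> I then 0 else u i) powr p) = sum ?f (F - G)" .
    have "sum ?f (F - G) + sum ?f G = sum ?f ((F - G) \<union> G)"
      using F G(1) by (intro sum.union_disjoint[symmetric]) auto
    also have "\<dots> \<le> infsum ?f UNIV"
      using F G(1) by (intro finite_sum_le_infsum[OF s]) auto
    finally have "sum ?f (F - G) + sum ?f G \<le> infsum ?f UNIV" .
    then show "(\<Sum>i\<in>F. norm (if i \<in> G \<inter> I then 0 else u i) powr p) \<le> (e/2) powr p"
      unfolding 1 using G(2) by (simp add: dist_real_def abs_le_iff)
  qed (use p e in auto)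
  then show ?thesis using G(1) e by (intro exI[of _ "G \<inter> I"]) auto
qed

lemma lp_space_eq: "lp_space p = lp_on p UNIV"
  by (auto simp: lp_space_def lp_on_def summable_on_UNIV_nonneg_real_iff)

lemma lp_norm_eq:
  assumes "u \<in> lp_space p"
  shows "lp_norm p u = lpn p u"
proof -
  have "(\<lambda>n. norm (u n) powr p) summable_on UNIV"
    using assms by (simp add: lp_space_eq lp_on_def)
  from has_sum_imp_sums[OF has_sum_infsum[OF this]] show ?thesis
    by (simp add: lp_norm_def lpn_def sums_iff)
qed

text \<open>An injective relabelling uses every term at most once. Extraction and insertion of the
  even or odd coordinates are of this form.\<close>

lemma lp_on_compose_inj:
  assumes u: "u \<in> lp_on p I" and e: "inj_on e J" and p: "0 < p"
  shows "(\<lambda>j. if j \<in> J then u (e j) else 0) \<in> lp_on p J"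
    "lpn p (\<lambda>j. if j \<in> J then u (e j) else 0) \<le> lpn p u"
proof -
  have *: "(\<Sum>j\<in>F. norm (if j \<in> J then u (e j) else 0) powr p) \<le> lpn p u powr p" if F: "finite F" for F
  proof -
    have "(\<Sum>j\<in>F. norm (if j \<in> J then u (e j) else 0) powr p) = (\<Sum>j\<in>F \<inter> J. norm (u (e j)) powr p)"
      using F p by (intro sum.mono_neutral_cong_right) auto
    also have "\<dots> = (\<Sum>i\<in>e ` (F \<inter> J). norm (u i) powr p)"
      using e by (subst sum.reindex) (auto intro: inj_on_subset)
    also have "\<dots> \<le> lpn p u powr p"
      using u p F by (intro sum_le_lpn) auto
    finally show ?thesis .
  qed
  show "(\<lambda>j. if j \<in> J then u (e j) else 0) \<in> lp_on p J"
    by (rule lp_on_bounded_sums(1)[OF _ p lpn_nonneg *]) auto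
  show "lpn p (\<lambda>j. if j \<in> J then u (e j) else 0) \<le> lpn p u"
    by (rule lp_on_bounded_sums(2)[OF _ p lpn_nonneg *, where I = J]) auto
qed

section \<open>Splitting X into X and a copy of ell_p\<close>

context banach_space_over
begin

text \<open>A complemented copy of ell_p is used as a factorisation of the identity of ell_p through
  X: \<open>R\<close> is the projection followed by the inverse of \<open>T\<close>.\<close>

lemma lp_factorization:
  assumes p: "1 \<le> p" and cs: "complemented_subspace smul Y" and iso: "lp_isomorphic_to p smul Y"
  obtains T :: "(nat \<Rightarrow> 'k) \<Rightarrow> 'a" and R C where
    "\<And>u v. u \<in> lp_on p UNIV \<Longrightarrow> v \<in> lp_on p UNIV \<Longrightarrow> T (\<lambda>n. u n + v n) = T u + T v"
    "\<And>c u. u \<in> lp_on p UNIV \<Longrightarrow> T (\<lambda>n. c * u n) = smul c (T u)"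
    "\<And>f. R f \<in> lp_on p UNIV"
    "\<And>f g. R (f + g) = (\<lambda>n. R f n + R g n)"
    "\<And>c f. R (smul c f) = (\<lambda>n. c * R f n)"
    "\<And>u. u \<in> lp_on p UNIV \<Longrightarrow> R (T u) = u"
    "C \<ge> 0" "\<And>u. u \<in> lp_on p UNIV \<Longrightarrow> norm (T u) \<le> C * lpn p u"
    "\<And>f. lpn p (R f) \<le> C * norm f"
proof -
  let ?L = "lp_on p UNIV :: (nat \<Rightarrow> 'k) set"
  obtain T :: "(nat \<Rightarrow> 'k) \<Rightarrow> 'a" and C1 C2 where
    bij: "bij_betw T ?L Y" and
    Tadd: "\<And>u v. u \<in> ?L \<Longrightarrow> v \<in> ?L \<Longrightarrow> T (\<lambda>n. u n + v n) = T u + T v" and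
    Tscale: "\<And>c u. u \<in> ?L \<Longrightarrow> T (\<lambda>n. c * u n) = smul c (T u)" and
    C1: "\<And>u. u \<in> ?L \<Longrightarrow> norm (T u) \<le> C1 * lp_norm p u" and
    C2: "\<And>u. u \<in> ?L \<Longrightarrow> lp_norm p u \<le> C2 * norm (T u)"
    using iso unfolding lp_isomorphic_to_def lp_space_eq by blast
  obtain P where P: "bounded_linear P" "Vector_Spaces.linear smul smul P" "P \<circ> P = P" "range P = Y"
    using cs unfolding complemented_subspace_def by blast
  interpret P: Vector_Spaces.linear smul smul P by (rule P(2))
  obtain B where B: "B > 0" "\<And>f. norm (P f) \<le> norm f * B"
    using bounded_linear.pos_bounded[OF P(1)] by blast
  define R where "R f = inv_into ?L T (P f)" for f
  have PY: "P f \<in> T ` ?L" for f using P(4) bij by (auto simp: bij_betw_def)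
  have RL: "R f \<in> ?L" for f unfolding R_def by (rule inv_into_into[OF PY])
  have TR: "T (R f) = P f" for f unfolding R_def by (rule f_inv_into_f[OF PY])
  have inj: "u = v" if "u \<in> ?L" "v \<in> ?L" "T u = T v" for u v
    using bij that by (auto simp: bij_betw_def dest: inj_onD)
  have p0: "0 < p" using p by simp
  have RT: "R (T u) = u" if "u \<in> ?L" for u
  proof (rule inj[OF RL that])
    have "T u \<in> Y" using bij that by (auto simp: bij_betw_def)
    then obtain f where "T u = P f" using P(4) by auto
    then show "T (R (T u)) = T u" using P(3) by (metis TR comp_apply)
  qed
  have Radd: "R (f + g) = (\<lambda>n. R f n + R g n)" for f g
    by (rule inj[OF RL lp_on_add(1)[OF RL RL p]]) (simp add: TR Tadd RL P.add)
  have Rscale: "R (smul c f) = (\<lambda>n. c * R f n)" for c f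
    by (rule inj[OF RL lp_on_scale(1)[OF RL p0]]) (simp add: TR Tscale RL P.scale)
  \<comment> \<open>No sign of \<open>C1\<close> and \<open>C2\<close> is given; the maximum with 0
    yields one nonnegative constant for both estimates.\<close>
  define C where "C = max 0 (max C1 (C2 * B))"
  have "norm (T u) \<le> C * lpn p u" if "u \<in> ?L" for u
  proof -
    have "norm (T u) \<le> C1 * lpn p u" using C1[OF that] that lp_norm_eq[of u p] by (simp add: lp_space_eq)
    also have "\<dots> \<le> C * lpn p u" by (intro mult_right_mono lpn_nonneg) (simp add: C_def)
    finally show ?thesis .
  qed
  moreover have "lpn p (R f) \<le> C * norm f" for f
  proof -
    have le: "lpn p (R f) \<le> C2 * norm (P f)"
      using C2[OF RL, of f] RL[of f] lp_norm_eq[of "R f" p] by (simp add: lp_space_eq TR)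
    show ?thesis
    proof (cases "C2 \<ge> 0")
      case True
      have "C2 * norm (P f) \<le> C2 * (norm f * B)" using B(2) True by (intro mult_left_mono)
      also have "\<dots> = (C2 * B) * norm f" by simp
      also have "\<dots> \<le> C * norm f" by (intro mult_right_mono) (auto simp: C_def)
      finally show ?thesis using le by simp
    next
      case False
      then have "C2 * norm (P f) \<le> 0" by (simp add: mult_nonpos_nonneg)
      also have "0 \<le> C * norm f" by (simp add: C_def)
      finally show ?thesis using le by simp
    qed
  qed
  moreover have "C \<ge> 0" by (simp add: C_def)
  ultimately show ?thesis
    using that[of T R C] Tadd Tscale RL Radd Rscale RT by blast
qed

text \<open>
  Up to equivalence of norms, \<open>(g, u) \<mapsto> \<Phi> g + D u\<close> identifies $X \oplus \ell_p(I)$ with $X$; the values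
  of \<open>D\<close> outside \<open>lp_on p I\<close> are irrelevant.
\<close>
definition lp_splitting ::
    "real \<Rightarrow> 'i set \<Rightarrow> ('a \<Rightarrow> 'a) \<Rightarrow> (('i \<Rightarrow> 'k) \<Rightarrow> 'a) \<Rightarrow> real \<Rightarrow> bool" where
  "lp_splitting p I \<Phi> D C \<longleftrightarrow> C > 0 \<and>
     (\<forall>f g. \<Phi> (f + g) = \<Phi> f + \<Phi> g) \<and> (\<forall>c f. \<Phi> (smul c f) = smul c (\<Phi> f)) \<and>
     (\<forall>u\<in>lp_on p I. \<forall>v\<in>lp_on p I. D (\<lambda>i. u i + v i) = D u + D v) \<and>
     (\<forall>c. \<forall>u\<in>lp_on p I. D (\<lambda>i. c * u i) = smul c (D u)) \<and>
     (\<forall>g. \<forall>u\<in>lp_on p I. norm (\<Phi> g + D u) \<le> C * (norm g + lpn p u) \<and>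
        norm g + lpn p u \<le> C * norm (\<Phi> g + D u)) \<and>
     (\<forall>f. \<exists>g. \<exists>u\<in>lp_on p I. f = \<Phi> g + D u)"

text \<open>Split ell_p into its even and odd coordinates. \<open>\<Phi>\<close> moves the
  ell_p-component of g to the even coordinates and keeps the complementary component,
  \<open>D\<close> puts u on the odd coordinates, and \<open>R\<close> reads both back.\<close>

lemma lp_splitting_exists:
  fixes I :: "'i set"
  assumes p: "1 \<le> p" and cs: "complemented_subspace smul Y" and iso: "lp_isomorphic_to p smul Y"
    and I: "countable I" "infinite I"
  shows "\<exists>\<Phi> D C. lp_splitting p I \<Phi> D C"
proof -
  let ?L = "lp_on p UNIV :: (nat \<Rightarrow> 'k) set"
  have p0: "0 < p" using p by simp
  obtain T :: "(nat \<Rightarrow> 'k) \<Rightarrow> 'a" and R C where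
    Tadd: "\<And>u v. u \<in> ?L \<Longrightarrow> v \<in> ?L \<Longrightarrow> T (\<lambda>n. u n + v n) = T u + T v" and
    Tscale: "\<And>c u. u \<in> ?L \<Longrightarrow> T (\<lambda>n. c * u n) = smul c (T u)" and
    RL: "\<And>f. R f \<in> ?L" and
    Radd: "\<And>f g. R (f + g) = (\<lambda>n. R f n + R g n)" and
    Rscale: "\<And>c f. R (smul c f) = (\<lambda>n. c * R f n)" and
    RT: "\<And>u. u \<in> ?L \<Longrightarrow> R (T u) = u" and
    C: "C \<ge> 0" "\<And>u. u \<in> ?L \<Longrightarrow> norm (T u) \<le> C * lpn p u" "\<And>f. lpn p (R f) \<le> C * norm f"
  proof (rule lp_factorization[OF p cs iso], goal_cases)
    case (1 T R C)
    show ?case by (rule 1(1)[OF 1(2-10)])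
  qed
  have Rdiff: "R (f - g) = (\<lambda>n. R f n - R g n)" for f g
    using Radd[of f "- g"] Rscale[of "-1" g] by simp
  define e where "e = to_nat_on I"
  define e' where "e' = from_nat_into I"
  have e: "inj_on e I" "\<And>n. e' n \<in> I" "\<And>i. i \<in> I \<Longrightarrow> e' (e i) = i" "\<And>n. e (e' n) = n"
    using I by (auto simp: e_def e'_def to_nat_on_infinite bij_betw_imp_inj_on from_nat_into_to_nat_on
      infinite_imp_nonempty from_nat_into to_nat_on_from_nat_into_infinite)
  \<comment> \<open>\<open>E\<close> and \<open>O'\<close> insert into even and odd positions,
    \<open>Ei\<close> and \<open>Oi\<close> extract from them; \<open>e\<close> and
    \<open>e'\<close> enumerate \<open>I\<close>.\<close>
  define E where "E w m = (if even m then w (m div 2) else 0)" for w :: "nat \<Rightarrow> 'k" and m :: nat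
  define O' where "O' u m = (if odd m then u (e' (m div 2)) else 0)" for u :: "'i \<Rightarrow> 'k" and m :: nat
  define Ei where "Ei w n = w (2 * n)" for w :: "nat \<Rightarrow> 'k" and n :: nat
  define Oi where "Oi w i = (if i \<in> I then w (2 * e i + 1) else 0)" for w :: "nat \<Rightarrow> 'k" and i
  have E: "E w \<in> ?L" "lpn p (E w) \<le> lpn p w" if "w \<in> ?L" for w
  proof -
    have *: "inj_on (\<lambda>m. m div 2) {m::nat. even m}" by (auto intro!: inj_onI elim!: evenE)
    have "E w = (\<lambda>j. if j \<in> {m::nat. even m} then w (j div 2) else 0)" by (auto simp: E_def)
    then show "E w \<in> ?L" "lpn p (E w) \<le> lpn p w"
      using lp_on_compose_inj[OF that * p0] by (auto intro: lp_on_mono)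
  qed
  have O': "O' u \<in> ?L" "lpn p (O' u) \<le> lpn p u" if "u \<in> lp_on p I" for u
  proof -
    have *: "inj_on (\<lambda>m. e' (m div 2)) {m::nat. odd m}"
    proof (rule inj_onI)
      fix m n :: nat assume *: "m \<in> {m. odd m}" "n \<in> {m. odd m}" "e' (m div 2) = e' (n div 2)"
      then have "m div 2 = n div 2" by (metis e(4))
      then show "m = n" using * by (auto elim!: oddE)
    qed
    have "O' u = (\<lambda>j. if j \<in> {m::nat. odd m} then u (e' (j div 2)) else 0)" by (auto simp: O'_def)
    then show "O' u \<in> ?L" "lpn p (O' u) \<le> lpn p u"
      using lp_on_compose_inj[OF that * p0] by (auto intro: lp_on_mono)
  qed
  have Ei: "Ei w \<in> ?L" "lpn p (Ei w) \<le> lpn p w" if "w \<in> ?L" for w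
    using lp_on_compose_inj[OF that, of "\<lambda>n. 2 * n" UNIV] p0 by (auto simp: Ei_def[abs_def] inj_on_def)
  have Oi: "Oi w \<in> lp_on p I" "lpn p (Oi w) \<le> lpn p w" if "w \<in> ?L" for w
    using lp_on_compose_inj[OF that, of "\<lambda>i. 2 * e i + 1" I] p0 e(1)
    by (auto simp: Oi_def[abs_def] inj_on_def)
  have EO: "(\<lambda>n. E (Ei w) n + O' (Oi w) n) = w" for w
    by (rule ext) (auto simp: E_def Ei_def O'_def Oi_def e)
  have Ei_EO: "Ei (\<lambda>n. E w n + O' u n) = w" for w u
    by (auto simp: E_def Ei_def O'_def)
  have Oi_EO: "Oi (\<lambda>n. E w n + O' u n) = u" if "u \<in> lp_on p I" for w u
    using that by (auto simp: E_def Oi_def O'_def e lp_on_def)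
  define \<Phi> where "\<Phi> g = g - T (R g) + T (E (R g))" for g
  define D where "D u = T (O' u)" for u
  have R\<Phi>D: "R (\<Phi> g + D u) = (\<lambda>n. E (R g) n + O' u n)" if "u \<in> lp_on p I" for g u
    by (rule ext) (simp add: \<Phi>_def D_def Radd Rdiff RT RL E O' that)
  have inv: "g = (f - T (R f)) + T (Ei (R f))" "u = Oi (R f)"
    if u: "u \<in> lp_on p I" and f: "f = \<Phi> g + D u" for g u f
  proof -
    have Rf: "R f = (\<lambda>n. E (R g) n + O' u n)" using R\<Phi>D[OF u] f by simp
    have "T (R f) = T (E (R g)) + T (O' u)" unfolding Rf by (rule Tadd[OF E(1)[OF RL] O'(1)[OF u]])
    moreover have "Ei (R f) = R g" unfolding Rf by (rule Ei_EO)
    ultimately show "g = (f - T (R f)) + T (Ei (R f))" by (simp add: f \<Phi>_def D_def)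
    show "u = Oi (R f)" unfolding Rf by (simp add: Oi_EO[OF u])
  qed
  have TRf: "norm (T (R f)) \<le> C * (C * norm f)" for f
    using C(2)[OF RL, of f] C(1,3) by (meson mult_left_mono order_trans)
  \<comment> \<open>Removing the ell_p-component and putting its replacement back cost C^2 each; the
    component u costs C.\<close>
  define B where "B = 1 + C + 2 * (C * C)"
  have B: "B > 0" using C(1) by (simp add: B_def add_pos_nonneg)
  have up: "norm (\<Phi> g + D u) \<le> B * (norm g + lpn p u)" if u: "u \<in> lp_on p I" for g u
  proof -
    have "norm (T (E (R g))) \<le> C * lpn p (E (R g))" by (rule C(2)[OF E(1)[OF RL]])
    also have "\<dots> \<le> C * (C * norm g)"
      by (intro mult_left_mono C(1) order_trans[OF E(2)[OF RL] C(3)])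
    finally have 1: "norm (T (E (R g))) \<le> C * (C * norm g)" .
    have "norm (D u) \<le> C * lpn p (O' u)" unfolding D_def by (rule C(2)[OF O'(1)[OF u]])
    also have "\<dots> \<le> C * lpn p u" by (intro mult_left_mono C(1) O'(2)[OF u])
    finally have 2: "norm (D u) \<le> C * lpn p u" .
    have "norm (\<Phi> g + D u) \<le> norm g + norm (T (R g)) + norm (T (E (R g))) + norm (D u)"
      unfolding \<Phi>_def by (intro order_trans[OF norm_triangle_ineq] add_right_mono
        order_trans[OF norm_triangle_ineq] norm_triangle_ineq4)
    also have "\<dots> \<le> (1 + 2 * (C * C)) * norm g + C * lpn p u"
      using TRf[of g] 1 2 by (simp add: algebra_simps)
    also have "\<dots> \<le> B * norm g + B * lpn p u"
      using C(1) by (intro add_mono mult_right_mono lpn_nonneg) (auto simp: B_def)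
    finally show ?thesis by (simp add: distrib_left)
  qed
  have lo: "norm g + lpn p u \<le> B * norm (\<Phi> g + D u)" if u: "u \<in> lp_on p I" for g u
  proof -
    define f where "f = \<Phi> g + D u"
    note iv = inv[OF u f_def]
    have "norm (T (Ei (R f))) \<le> C * lpn p (Ei (R f))" by (rule C(2)[OF Ei(1)[OF RL]])
    also have "\<dots> \<le> C * (C * norm f)"
      by (intro mult_left_mono C(1) order_trans[OF Ei(2)[OF RL] C(3)])
    finally have 1: "norm (T (Ei (R f))) \<le> C * (C * norm f)" .
    have "norm g \<le> norm f + norm (T (R f)) + norm (T (Ei (R f)))"
      by (subst iv(1)) (intro order_trans[OF norm_triangle_ineq] add_right_mono norm_triangle_ineq4)
    moreover have "lpn p u \<le> C * norm f"
      by (subst iv(2)) (rule order_trans[OF Oi(2)[OF RL] C(3)])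
    ultimately have "norm g + lpn p u \<le> B * norm f"
      using TRf[of f] 1 by (simp add: B_def algebra_simps)
    then show ?thesis by (simp add: f_def)
  qed
  have onto: "\<exists>g. \<exists>u\<in>lp_on p I. f = \<Phi> g + D u" for f
  proof (intro exI bexI)
    define g where "g = f - T (R f) + T (Ei (R f))"
    have Rg: "R g = Ei (R f)" unfolding g_def by (rule ext) (simp add: Radd Rdiff RT RL Ei)
    have "T (E (Ei (R f))) + T (O' (Oi (R f))) = T (R f)"
      using Tadd[OF E(1)[OF Ei(1)[OF RL]] O'(1)[OF Oi(1)[OF RL]], of f f] by (simp add: EO)
    then show "f = \<Phi> g + D (Oi (R f))"
      unfolding \<Phi>_def D_def Rg by (simp add: g_def algebra_simps)
    show "Oi (R f) \<in> lp_on p I" by (rule Oi(1)[OF RL])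
  qed
  have E_add: "E (\<lambda>n. v n + w n) = (\<lambda>n. E v n + E w n)" "E (\<lambda>n. c * w n) = (\<lambda>n. c * E w n)"
    for v w c by (auto simp: E_def)
  have O_add: "O' (\<lambda>n. v n + w n) = (\<lambda>n. O' v n + O' w n)" "O' (\<lambda>n. c * w n) = (\<lambda>n. c * O' w n)"
    for v w c by (auto simp: O'_def)
  have "lp_splitting p I \<Phi> D B"
    unfolding lp_splitting_def
  proof (intro conjI allI ballI B up lo onto)
    show "\<Phi> (f + g) = \<Phi> f + \<Phi> g" for f g
      by (simp add: \<Phi>_def Radd E_add Tadd RL E)
    show "\<Phi> (smul c f) = smul c (\<Phi> f)" for c f
      by (simp add: \<Phi>_def Rscale E_add Tscale RL E scale_right_distrib scale_right_diff_distrib)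
    show "D (\<lambda>i. u i + v i) = D u + D v" if "u \<in> lp_on p I" "v \<in> lp_on p I" for u v
      using that by (simp add: D_def O_add Tadd O')
    show "D (\<lambda>i. c * u i) = smul c (D u)" if "u \<in> lp_on p I" for c u
      using that by (simp add: D_def O_add Tscale O')
  qed
  then show ?thesis by blast
qed

section \<open>Closed linear spans\<close>

definition cspan :: "(nat \<Rightarrow> 'a) \<Rightarrow> 'a set" where
  "cspan b = {f. \<forall>e>0. \<exists>c n. norm (f - lincomb c b n) < e}"

lemma fundamental_iff: "fundamental b \<longleftrightarrow> cspan b = UNIV"
  by (simp add: fundamental_def cspan_def set_eq_iff)

lemma cspanD: "f \<in> cspan b \<Longrightarrow> 0 < e \<Longrightarrow> \<exists>c n. norm (f - lincomb c b n) < e"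
  by (simp add: cspan_def)

lemma cspan_add:
  assumes "f \<in> cspan b" "g \<in> cspan b"
  shows "f + g \<in> cspan b"
  unfolding cspan_def
proof (intro CollectI allI impI)
  fix e :: real assume "e > 0"
  then have "e/2 > 0" by simp
  then obtain c n d m where c: "norm (f - lincomb c b n) < e/2" and d: "norm (g - lincomb d b m) < e/2"
    using assms unfolding cspan_def by blast
  define N where "N = max n m"
  let ?c = "\<lambda>k. if k < n then c k else 0" and ?d = "\<lambda>k. if k < m then d k else 0"
  have "lincomb (\<lambda>k. ?c k + ?d k) b N = lincomb c b n + lincomb d b m"
    by (simp add: lincomb_add lincomb_truncate N_def)
  then have "f + g - lincomb (\<lambda>k. ?c k + ?d k) b N = (f - lincomb c b n) + (g - lincomb d b m)" by simp
  also have "norm \<dots> < e" using norm_triangle_ineq[of "f - lincomb c b n" "g - lincomb d b m"] c d by linarith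
  finally show "\<exists>c n. norm (f + g - lincomb c b n) < e" by blast
qed

lemma cspan_scale:
  assumes "f \<in> cspan b"
  shows "smul a f \<in> cspan b"
  unfolding cspan_def
proof (intro CollectI allI impI)
  fix e :: real assume e: "e > 0"
  then have "e / (norm a + 1) > 0" by (simp add: add_nonneg_pos)
  then obtain c n where c: "norm (f - lincomb c b n) < e / (norm a + 1)"
    using assms unfolding cspan_def by blast
  have "smul a f - lincomb (\<lambda>k. a * c k) b n = smul a (f - lincomb c b n)"
    by (simp add: lincomb_scale scale_right_diff_distrib)
  also have "norm \<dots> \<le> (norm a + 1) * norm (f - lincomb c b n)"
    by (simp add: norm_scale mult_right_mono)
  also have "\<dots> < e" using c by (simp add: pos_less_divide_eq add_nonneg_pos mult.commute)
  finally show "\<exists>c n. norm (smul a f - lincomb c b n) < e" by blast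
qed

lemma cspan_closure:
  assumes "\<And>e. e > 0 \<Longrightarrow> \<exists>g\<in>cspan b. norm (f - g) < e"
  shows "f \<in> cspan b"
  unfolding cspan_def
proof (intro CollectI allI impI)
  fix e :: real assume e: "e > 0"
  obtain g where g: "g \<in> cspan b" "norm (f - g) < e/2" using assms[of "e/2"] e by auto
  obtain c n where "norm (g - lincomb c b n) < e/2" using cspanD[OF g(1), of "e/2"] e by auto
  then have "norm (f - lincomb c b n) < e"
    using g(2) norm_triangle_ineq[of "f - g" "g - lincomb c b n"] by simp
  then show "\<exists>c n. norm (f - lincomb c b n) < e" by blast
qed

lemma cspan_lincomb: "lincomb c b n \<in> cspan b"
  unfolding cspan_def by (auto intro!: exI[of _ c] exI[of _ n])

lemma cspan_0: "0 \<in> cspan b"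
  using cspan_lincomb[of _ b 0] by (simp add: lincomb_def)

lemma cspan_sum: "(\<And>i. i \<in> F \<Longrightarrow> f i \<in> cspan b) \<Longrightarrow> sum f F \<in> cspan b"
  by (induction F rule: infinite_finite_induct) (auto simp: cspan_0 cspan_add)

lemma cspan_basis: "b n \<in> cspan b"
proof -
  have "lincomb (\<lambda>k. if k = n then 1 else 0) b (Suc n) = b n"
    by (simp add: lincomb_def)
  then show ?thesis using cspan_lincomb by metis
qed

text \<open>\<open>\<Phi>\<close> and \<open>D\<close> are continuous, so it suffices to catch the
  images of a fundamental sequence of X and of the unit vectors of ell_p; finitely supported u are
  dense by \<open>lp_on_tail\<close>.\<close>

lemma lp_splitting_fundamental:
  fixes D :: "('i \<Rightarrow> 'k) \<Rightarrow> 'a"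
  assumes sp: "lp_splitting p I \<Phi> D C" and p: "1 \<le> p" and x: "fundamental x"
    and bx: "\<And>n. \<Phi> (x n) \<in> cspan b"
    and bD: "\<And>i. i \<in> I \<Longrightarrow> D (\<lambda>j. if j = i then 1 else 0) \<in> cspan b"
  shows "fundamental b"
proof -
  let ?L = "lp_on p I :: ('i \<Rightarrow> 'k) set"
  have p0: "0 < p" using p by simp
  have C: "C > 0" and \<Phi>add: "\<And>f g. \<Phi> (f + g) = \<Phi> f + \<Phi> g" and \<Phi>scale: "\<And>c f. \<Phi> (smul c f) = smul c (\<Phi> f)"
    and Dadd: "\<And>u v. u \<in> ?L \<Longrightarrow> v \<in> ?L \<Longrightarrow> D (\<lambda>i. u i + v i) = D u + D v"
    and Dscale: "\<And>c u. u \<in> ?L \<Longrightarrow> D (\<lambda>i. c * u i) = smul c (D u)"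
    and up: "\<And>g u. u \<in> ?L \<Longrightarrow> norm (\<Phi> g + D u) \<le> C * (norm g + lpn p u)"
    and onto: "\<And>f. \<exists>g. \<exists>u\<in>?L. f = \<Phi> g + D u"
    using sp by (auto simp: lp_splitting_def)
  have z: "(\<lambda>i. 0) \<in> ?L" "lpn p (\<lambda>i::'i. 0 :: 'k) = 0"
    using p by (auto simp: lp_on_def lpn_def)
  have D0: "D (\<lambda>i. 0) = 0" using Dscale[OF z(1), of 0] by simp
  have \<Phi>0: "\<Phi> 0 = 0" using \<Phi>scale[of 0 0] by simp
  have \<Phi>le: "norm (\<Phi> g) \<le> C * norm g" for g using up[OF z(1), of g] by (simp add: D0 z(2))
  have Dle: "norm (D u) \<le> C * lpn p u" if "u \<in> ?L" for u using up[OF that, of 0] by (simp add: \<Phi>0)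
  have \<Phi>comb: "\<Phi> (lincomb c x n) \<in> cspan b" for c n
  proof -
    have "\<Phi> (lincomb c x n) = (\<Sum>k<n. smul (c k) (\<Phi> (x k)))"
      by (induction n) (simp_all add: lincomb_def \<Phi>0 \<Phi>add \<Phi>scale)
    then show ?thesis by (simp add: cspan_sum cspan_scale bx)
  qed
  have \<Phi>in: "\<Phi> g \<in> cspan b" for g
  proof (rule cspan_closure)
    fix e :: real assume e: "e > 0"
    then obtain c n where c: "norm (g - lincomb c x n) < e / C"
      using x C unfolding fundamental_def by (metis divide_pos_pos)
    have "\<Phi> g - \<Phi> (lincomb c x n) = \<Phi> (g - lincomb c x n)"
      by (metis \<Phi>add add_diff_cancel_right' diff_add_cancel)
    then have "norm (\<Phi> g - \<Phi> (lincomb c x n)) \<le> C * norm (g - lincomb c x n)" using \<Phi>le by simp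
    also have "\<dots> < e" using c C by (simp add: field_simps)
    finally show "\<exists>h\<in>cspan b. norm (\<Phi> g - h) < e" using \<Phi>comb by blast
  qed
  have Dfin: "D (\<lambda>i. if i \<in> F then u i else 0) \<in> cspan b" if "finite F" "F \<subseteq> I" for F u
    using that
  proof (induction F rule: finite_induct)
    case empty
    then show ?case by (simp add: D0 cspan_0)
  next
    case (insert a F)
    have 1: "(\<lambda>i. if i \<in> F then u i else 0) \<in> ?L"
      using insert p0 by (intro lp_on_finite(1)[of F]) auto
    have 2: "(\<lambda>i. if i = a then 1 else 0 :: 'k) \<in> ?L"
      using insert p0 by (intro lp_on_finite(1)[of "{a}"]) auto
    have "(\<lambda>i. if i \<in> insert a F then u i else 0) =
        (\<lambda>i. (if i \<in> F then u i else 0) + u a * (if i = a then 1 else 0))"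
      using insert by auto
    then have "D (\<lambda>i. if i \<in> insert a F then u i else 0) =
        D (\<lambda>i. if i \<in> F then u i else 0) + smul (u a) (D (\<lambda>i. if i = a then 1 else 0))"
      using Dadd[OF 1 lp_on_scale(1)[OF 2 p0, of "u a"]] Dscale[OF 2, of "u a"] by simp
    then show ?case using insert by (auto intro!: cspan_add cspan_scale bD)
  qed
  have Din: "D u \<in> cspan b" if u: "u \<in> ?L" for u
  proof (rule cspan_closure)
    fix e :: real assume e: "e > 0"
    obtain F where F: "finite F" "F \<subseteq> I" "lpn p (\<lambda>i. if i \<in> F then 0 else u i) < e / C"
      using lp_on_tail[OF u p0, of "e / C"] e C by auto
    let ?v = "\<lambda>i. if i \<in> F then u i else 0" and ?w = "\<lambda>i. if i \<in> F then 0 else u i"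
    have v: "?v \<in> ?L" and w: "?w \<in> ?L"
      by (rule lp_on_dominated(1)[OF u p0], simp)+
    have "(\<lambda>i. ?v i + ?w i) = u" by auto
    then have "D u - D ?v = D ?w" using Dadd[OF v w] by simp
    then have "norm (D u - D ?v) \<le> C * lpn p ?w" using Dle[OF w] by simp
    also have "\<dots> < e" using F(3) C by (simp add: field_simps)
    finally show "\<exists>h\<in>cspan b. norm (D u - h) < e" using Dfin[OF F(1,2)] by blast
  qed
  have "f \<in> cspan b" for f
    using onto[of f] \<Phi>in Din by (auto intro: cspan_add)
  then show ?thesis by (auto simp: fundamental_iff)
qed

end

section \<open>Dyadic Haar coefficients\<close>

text \<open>Convexity of t^p for the decomposition of r(y + x) into y with weight r and r x / (1 -
  r) with weight 1 - r. The point is the factor r < 1 in front of y^p, which a recursion can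
  absorb.\<close>

lemma powr_hardy_step:
  fixes x y r p :: real
  assumes r: "0 < r" "r < 1" and p: "1 \<le> p" and "0 \<le> x" "0 \<le> y"
  shows "(r * (y + x)) powr p \<le> r * y powr p + (1 - r) powr (1 - p) * x powr p"
proof -
  have rp: "r powr p \<le> r" using r p powr_mono'[of 1 p r] by simp
  have one: "1 \<le> (1 - r) powr (1 - p)"
    using r p powr_mono'[of "1 - p" 0 "1 - r"] by simp
  consider "x = 0" | "y = 0" | "x > 0" "y > 0" using assms by linarith
  then show ?thesis
  proof cases
    case 1
    then show ?thesis using rp r p by (simp add: powr_mult mult_right_mono)
  next
    case 2
    have "r powr p \<le> (1 - r) powr (1 - p)" using rp r one by linarith
    then show ?thesis using 2 r p by (simp add: powr_mult mult_right_mono)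
  next
    case 3
    have "((1 - (1 - r)) *\<^sub>R y + (1 - r) *\<^sub>R (r / (1 - r) * x)) powr p \<le>
        (1 - (1 - r)) * y powr p + (1 - r) * (r / (1 - r) * x) powr p"
      using convex_onD[OF powr_convex[OF p], of "1 - r" y "r / (1 - r) * x"] r 3 by simp
    also have "(1 - (1 - r)) *\<^sub>R y + (1 - r) *\<^sub>R (r / (1 - r) * x) = r * (y + x)"
      using r by (simp add: distrib_left)
    also have "(1 - r) * (r / (1 - r) * x) powr p = r powr p * ((1 - r) powr (1 - p) * x powr p)"
      using r 3 by (simp add: powr_mult powr_divide powr_diff)
    also have "\<dots> \<le> 1 * ((1 - r) powr (1 - p) * x powr p)"
      using rp r by (intro mult_right_mono) auto
    finally show ?thesis by simp
  qed
qed

text \<open>After raising the recursion to the power p and summing, the shifted sum of y^p returns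
  with the factor r and is absorbed on the left; the boundary term \<open>y N powr p\<close>
  disappears because y tends to 0.\<close>

lemma hardy_backward:
  fixes y d :: "nat \<Rightarrow> real"
  assumes r: "0 < r" "r < 1" and p: "1 \<le> p" and nn: "\<And>l. 0 \<le> y l" "\<And>l. 0 \<le> d l"
    and step: "\<And>l. y l \<le> r * (y (Suc l) + d l)"
    and lim: "y \<longlonglongrightarrow> 0"
    and B: "\<And>J. (\<Sum>l<J. d l powr p) \<le> B"
  shows "(\<Sum>l<J. y l powr p) \<le> (1 - r) powr (1 - p) * B / (1 - r)"
proof -
  define H where "H = (1 - r) powr (1 - p)"
  have H: "H \<ge> 0" by (simp add: H_def)
  have s: "y l powr p \<le> r * y (Suc l) powr p + H * d l powr p" for l
  proof -
    have "y l powr p \<le> (r * (y (Suc l) + d l)) powr p"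
      using step nn p by (intro powr_mono2) auto
    also have "\<dots> \<le> r * y (Suc l) powr p + H * d l powr p"
      unfolding H_def using r p nn by (intro powr_hardy_step) auto
    finally show ?thesis .
  qed
  have fin: "(1 - r) * (\<Sum>l<N. y l powr p) \<le> r * y N powr p + H * B" for N
  proof -
    have "(\<Sum>l<N. y l powr p) \<le> (\<Sum>l<N. r * y (Suc l) powr p + H * d l powr p)"
      by (intro sum_mono s)
    also have "\<dots> = r * (\<Sum>l<N. y (Suc l) powr p) + H * (\<Sum>l<N. d l powr p)"
      by (simp add: sum.distrib sum_distrib_left)
    also have "(\<Sum>l<N. y (Suc l) powr p) = (\<Sum>l<N. y l powr p) + y N powr p - y 0 powr p"
      by (induction N) auto
    also have "r * ((\<Sum>l<N. y l powr p) + y N powr p - y 0 powr p) + H * (\<Sum>l<N. d l powr p)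
        \<le> r * ((\<Sum>l<N. y l powr p) + y N powr p) + H * B"
      using r H B by (intro add_mono mult_left_mono) auto
    finally show ?thesis by (simp add: algebra_simps)
  qed
  have "(1 - r) * (\<Sum>l<J. y l powr p) \<le> r * 0 + H * B"
  proof (rule tendsto_lowerbound)
    have "((\<lambda>N. y N powr p) \<longlongrightarrow> 0) sequentially"
      using tendsto_powr'[OF lim tendsto_const[of p]] p nn by simp
    then show "(\<lambda>N. r * y N powr p + H * B) \<longlonglongrightarrow> r * 0 + H * B"
      by (intro tendsto_intros)
    show "\<forall>\<^sub>F N in sequentially. (1 - r) * (\<Sum>l<J. y l powr p) \<le> r * y N powr p + H * B"
      using eventually_ge_at_top[of J]
    proof eventually_elim
      case (elim N)
      have "(1 - r) * (\<Sum>l<J. y l powr p) \<le> (1 - r) * (\<Sum>l<N. y l powr p)"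
        using r elim by (intro mult_left_mono sum_mono2) auto
      then show ?case using fin[of N] by linarith
    qed
  qed simp
  then show ?thesis using r by (simp add: H_def field_simps)
qed

text \<open>The same absorption for a recursion that runs upwards; the start \<open>z 0 = 0\<close>
  takes the place of the limit condition.\<close>

lemma hardy_forward:
  fixes z e :: "nat \<Rightarrow> real"
  assumes r: "0 < r" "r < 1" and p: "1 \<le> p" and nn: "\<And>l. 0 \<le> z l" "\<And>l. 0 \<le> e l"
    and step: "\<And>l. z (Suc l) \<le> r * (z l + e l)" and z0: "z 0 = 0"
    and B: "\<And>J. (\<Sum>l<J. e l powr p) \<le> B"
  shows "(\<Sum>l<J. z l powr p) \<le> (1 - r) powr (1 - p) * B / (1 - r)"
proof -
  define H where "H = (1 - r) powr (1 - p)"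
  have H: "H \<ge> 0" by (simp add: H_def)
  have s: "z (Suc l) powr p \<le> r * z l powr p + H * e l powr p" for l
  proof -
    have "z (Suc l) powr p \<le> (r * (z l + e l)) powr p"
      using step nn p by (intro powr_mono2) auto
    also have "\<dots> \<le> r * z l powr p + H * e l powr p"
      unfolding H_def using r p nn by (intro powr_hardy_step) auto
    finally show ?thesis .
  qed
  have "(\<Sum>l<J. z l powr p) \<le> (\<Sum>l<Suc J. z l powr p)" by simp
  also have "\<dots> = (\<Sum>l<J. z (Suc l) powr p)"
    using z0 p by (subst sum.lessThan_Suc_shift) simp
  also have "\<dots> \<le> (\<Sum>l<J. r * z l powr p + H * e l powr p)"
    by (intro sum_mono s)
  also have "\<dots> = r * (\<Sum>l<J. z l powr p) + H * (\<Sum>l<J. e l powr p)"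
    by (simp add: sum.distrib sum_distrib_left)
  also have "\<dots> \<le> r * (\<Sum>l<J. z l powr p) + H * B"
    using H B by (intro add_left_mono mult_left_mono) auto
  finally have "(1 - r) * (\<Sum>l<J. z l powr p) \<le> H * B" by (simp add: algebra_simps)
  then show ?thesis using r by (simp add: H_def field_simps)
qed

section \<open>Sums over dyadic intervals\<close>

lemma div_two_power_Suc: "n div 2^(Suc l) = (n div 2^l) div (2::nat)"
  by (simp add: power_Suc2 div_mult2_eq del: power_Suc)

lemma sum_lessThan_add:
  fixes f :: "nat \<Rightarrow> real"
  shows "(\<Sum>l<k + J. f l) = (\<Sum>l<k. f l) + (\<Sum>l<J. f (k + l))"
  by (induction J) simp_all

lemma lp_on_zero: "0 < p \<Longrightarrow> (\<lambda>i. 0) \<in> lp_on p I" "0 < p \<Longrightarrow> lpn p (\<lambda>i. 0) = 0"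
  by (simp_all add: lp_on_def lpn_def)

lemma powr_le_cancel:
  fixes a b p :: real
  assumes "0 < p" "0 \<le> b" "a powr p \<le> b powr p" "0 \<le> a"
  shows "a \<le> b"
  using assms by (metis not_less powr_less_mono2)

lemma norm_le_lpn:
  assumes "u \<in> lp_on p I" "0 < p"
  shows "norm (u i) \<le> lpn p u"
proof -
  have "norm (u i) powr p \<le> lpn p u powr p"
    using sum_le_lpn[OF assms, of "{i}"] by simp
  with assms(2) lpn_nonneg show ?thesis by (rule powr_le_cancel) auto
qed

text \<open>The sum over the dyadic interval of all n with n div 2^l = i; the recursion makes the
  split into two halves definitional.\<close>

primrec dyadic_sum :: "nat \<Rightarrow> (nat \<Rightarrow> 'k::comm_ring_1) \<Rightarrow> nat \<Rightarrow> 'k" where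
  "dyadic_sum 0 c i = c i"
| "dyadic_sum (Suc l) c i = dyadic_sum l c (2 * i) + dyadic_sum l c (2 * i + 1)"

lemma dyadic_sum_add: "dyadic_sum l (\<lambda>n. c n + d n) i = dyadic_sum l c i + dyadic_sum l d i"
  by (induction l arbitrary: i) (simp_all add: algebra_simps)

lemma dyadic_sum_scale: "dyadic_sum l (\<lambda>n. a * c n) i = a * dyadic_sum l c i"
  by (induction l arbitrary: i) (simp_all add: algebra_simps)

lemma dyadic_sum_cong:
  assumes "\<And>n. n div 2^l = i \<Longrightarrow> c n = d n"
  shows "dyadic_sum l c i = dyadic_sum l d i"
  using assms
proof (induction l arbitrary: i)
  case (Suc l)
  have "c n = d n" if "n div 2^l = 2 * i \<or> n div 2^l = 2 * i + 1" for n
  proof -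
    have "n div 2^(Suc l) = (n div 2^l) div 2" by (rule div_two_power_Suc)
    then show ?thesis using that by (intro Suc.prems) auto
  qed
  then show ?case using Suc.IH by simp
qed simp

lemma dyadic_sum_zero:
  assumes "\<And>n. n div 2^l = i \<Longrightarrow> c n = 0"
  shows "dyadic_sum l c i = 0"
proof -
  have "dyadic_sum l (\<lambda>n. 0) i = (0 :: 'a)" for l and i
    by (induction l arbitrary: i) auto
  then show ?thesis using dyadic_sum_cong[of l i c "\<lambda>n. 0"] assms by metis
qed

lemma dyadic_sum_single:
  "dyadic_sum l (\<lambda>k. if k = n then 1 else 0) i = (if i = n div 2^l then 1 else 0)"
proof (induction l arbitrary: i)
  case (Suc l)
  have "n div 2^(Suc l) = (n div 2^l) div 2" by (rule div_two_power_Suc)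
  moreover have "i = x div 2 \<longleftrightarrow> (2 * i = x \<or> 2 * i + 1 = x)" for x by presburger
  ultimately have "i = n div 2^(Suc l) \<longleftrightarrow> (2 * i = n div 2^l \<or> 2 * i + 1 = n div 2^l)" by simp
  then show ?case unfolding dyadic_sum.simps Suc.IH by (auto simp del: power_Suc)
qed auto

text \<open>Up to level j an interval sees a single value of g; \<open>dyadic_sum_coarse\<close>
  treats the levels from j on.\<close>

lemma dyadic_sum_coarse_le:
  assumes "l \<le> j"
  shows "dyadic_sum l (\<lambda>n. g (n div 2^j)) i = 2^l * g (i div 2^(j - l))"
  using assms
proof (induction l arbitrary: i)
  case (Suc l)
  then obtain r where r: "j - l = Suc r" "j - Suc l = r" by (metis Suc_diff_Suc Suc_le_lessD)
  have "2 * i div 2^Suc r = i div 2^r" "(2 * i + 1) div 2^Suc r = i div 2^r"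
    by (simp_all add: div_mult2_eq)
  then show ?case using Suc by (simp add: r)
qed simp

lemma dyadic_sum_coarse:
  "dyadic_sum (j + l) (\<lambda>n. g (n div 2^j)) i = 2^j * dyadic_sum l g i"
proof (induction l arbitrary: i)
  case 0
  then show ?case using dyadic_sum_coarse_le[of j j g i] by simp
qed (simp add: algebra_simps)

text \<open>
  Up to the weight, \<open>haar \<tau> c (l, i)\<close> is the difference of the sums of \<open>c\<close> over the two halves of the
  dyadic interval \<open>{i * 2^(l+1)..<(i+1) * 2^(l+1)}\<close>; its \<open>p\<close>-norm is a Besov-type norm of \<open>c\<close>.
\<close>
definition haar :: "real \<Rightarrow> (nat \<Rightarrow> 'k::real_normed_field) \<Rightarrow> nat \<times> nat \<Rightarrow> 'k" where
  "haar \<tau> c = (\<lambda>(l, i). of_real (2 powr (- \<tau> * real l)) *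
     (dyadic_sum l c (2 * i) - dyadic_sum l c (2 * i + 1)))"

lemma haar_add: "haar \<tau> (\<lambda>n. c n + d n) = (\<lambda>q. haar \<tau> c q + haar \<tau> d q)"
  by (auto simp: haar_def dyadic_sum_add algebra_simps)

lemma haar_scale: "haar \<tau> (\<lambda>n. a * c n) = (\<lambda>q. a * haar \<tau> c q)"
  by (auto simp: haar_def dyadic_sum_scale algebra_simps)

lemma haar_zero: "haar \<tau> (\<lambda>n. 0) = (\<lambda>q. 0)"
  using haar_scale[of \<tau> 0 "\<lambda>n. 0"] by simp

text \<open>With at most one nonzero entry per level, the norm is that of a sequence indexed by the
  levels. Unit vectors, initial segments and the effect of a cut all lead to such families.\<close>

lemma lp_on_path:
  fixes u :: "nat \<times> nat \<Rightarrow> 'k::real_normed_field"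
  assumes p: "0 < p" and supp: "\<And>l i. i \<noteq> \<pi> l \<Longrightarrow> u (l, i) = 0" and B: "0 \<le> B"
    and le: "\<And>J. (\<Sum>l<J. norm (u (l, \<pi> l)) powr p) \<le> B powr p"
  shows "u \<in> lp_on p UNIV" "lpn p u \<le> B"
proof -
  have *: "(\<Sum>q\<in>F. norm (u q) powr p) \<le> B powr p" if F: "finite F" for F
  proof -
    obtain J where J: "\<And>l. l \<in> fst ` F \<Longrightarrow> l < J"
      using finite_nat_bounded[of "fst ` F"] F by auto
    have "(\<Sum>q\<in>F. norm (u q) powr p) = (\<Sum>q\<in>F \<inter> (\<lambda>l. (l, \<pi> l)) ` {..<J}. norm (u q) powr p)"
    proof (intro sum.mono_neutral_right F ballI)
      fix q assume q: "q \<in> F - F \<inter> (\<lambda>l. (l, \<pi> l)) ` {..<J}"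
      obtain l i where li: "q = (l, i)" by (cases q)
      have "l < J" using q li by (intro J) (auto intro: rev_image_eqI)
      then have "i \<noteq> \<pi> l" using q li by auto
      then show "norm (u q) powr p = 0" using supp li p by simp
    qed auto
    also have "\<dots> \<le> (\<Sum>q\<in>(\<lambda>l. (l, \<pi> l)) ` {..<J}. norm (u q) powr p)"
      by (intro sum_mono2) auto
    also have "\<dots> = (\<Sum>l<J. norm (u (l, \<pi> l)) powr p)"
      by (subst sum.reindex) (auto simp: inj_on_def)
    also have "\<dots> \<le> B powr p" by (rule le)
    finally show ?thesis .
  qed
  show "u \<in> lp_on p UNIV" by (rule lp_on_bounded_sums(1)[OF _ p B *]) auto
  show "lpn p u \<le> B" by (rule lp_on_bounded_sums(2)[OF _ p B *, where I = UNIV]) auto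
qed

lemma lp_on_geometric_path:
  fixes u :: "nat \<times> nat \<Rightarrow> 'k::real_normed_field"
  assumes p: "0 < p" and \<tau>: "0 < \<tau>" and supp: "\<And>l i. i \<noteq> \<pi> l \<Longrightarrow> u (l, i) = 0"
    and small: "\<And>l. l < k \<Longrightarrow> u (l, \<pi> l) = 0"
    and le: "\<And>l. norm (u (k + l, \<pi> (k + l))) \<le> A * 2 powr (- \<tau> * real l)" and A: "0 \<le> A"
  shows "u \<in> lp_on p UNIV" "lpn p u \<le> A * (1 / (1 - 2 powr (- \<tau> * p))) powr (1/p)"
proof -
  define q where "q = 2 powr (- \<tau> * p)"
  have q: "0 < q" "q < 1" using p \<tau> by (auto simp: q_def powr_less_one)
  have *: "(\<Sum>l<J. norm (u (l, \<pi> l)) powr p) \<le> (A * (1 / (1 - q)) powr (1/p)) powr p" for J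
  proof -
    have "(\<Sum>l<J. norm (u (l, \<pi> l)) powr p) \<le> (\<Sum>l<k + J. norm (u (l, \<pi> l)) powr p)"
      by (intro sum_mono2) auto
    also have "\<dots> = (\<Sum>l<k. norm (u (l, \<pi> l)) powr p) + (\<Sum>l<J. norm (u (k + l, \<pi> (k + l))) powr p)"
      by (rule sum_lessThan_add)
    also have "(\<Sum>l<k. norm (u (l, \<pi> l)) powr p) = 0" using small p by simp
    also have "(\<Sum>l<J. norm (u (k + l, \<pi> (k + l))) powr p) \<le> (\<Sum>l<J. A powr p * q ^ l)"
    proof (rule sum_mono)
      fix l
      have "norm (u (k + l, \<pi> (k + l))) powr p \<le> (A * 2 powr (- \<tau> * real l)) powr p"
        using p le by (intro powr_mono2) auto
      also have "\<dots> = A powr p * 2 powr (- \<tau> * p * real l)"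
        using A by (simp add: powr_mult powr_powr mult.commute mult.left_commute)
      also have "2 powr (- \<tau> * p * real l) = q ^ l"
        using q by (simp add: powr_realpow[symmetric]) (simp add: q_def powr_powr)
      finally show "norm (u (k + l, \<pi> (k + l))) powr p \<le> A powr p * q ^ l" .
    qed
    also have "(\<Sum>l<J. A powr p * q ^ l) = A powr p * ((1 - q ^ J) / (1 - q))"
      using q by (simp add: sum_distrib_left[symmetric] sum_gp_strict)
    also have "\<dots> \<le> A powr p * (1 / (1 - q))"
      using q by (intro mult_left_mono divide_right_mono) auto
    also have "\<dots> = (A * (1 / (1 - q)) powr (1/p)) powr p"
      using A q p by (simp add: powr_mult powr_powr)
    finally show ?thesis by simp
  qed
  have B: "0 \<le> A * (1 / (1 - q)) powr (1/p)" using A by simp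
  from lp_on_path[where u = u and \<pi> = \<pi>, OF p supp B *]
  show "u \<in> lp_on p UNIV" "lpn p u \<le> A * (1 / (1 - 2 powr (- \<tau> * p))) powr (1/p)"
    by (simp_all add: q_def)
qed

lemma haar_single:
  assumes p: "0 < p" and \<tau>: "0 < \<tau>"
  shows "haar \<tau> (\<lambda>k. if k = n then 1 else 0 :: 'k::real_normed_field) \<in> lp_on p UNIV"
    "lpn p (haar \<tau> (\<lambda>k. if k = n then 1 else 0 :: 'k)) \<le> (1 / (1 - 2 powr (- \<tau> * p))) powr (1/p)"
proof -
  let ?u = "haar \<tau> (\<lambda>k. if k = n then 1 else 0 :: 'k)"
  have supp: "?u (l, i) = 0" if "i \<noteq> n div 2^Suc l" for l i
  proof -
    have "n div 2^Suc l = (n div 2^l) div 2" by (rule div_two_power_Suc)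
    then show ?thesis using that by (auto simp: haar_def dyadic_sum_single)
  qed
  have le: "norm (?u (0 + l, n div 2^Suc (0 + l))) \<le> 1 * 2 powr (- \<tau> * real l)" for l
    by (auto simp: haar_def dyadic_sum_single norm_mult)
  from lp_on_geometric_path[where u = ?u and \<pi> = "\<lambda>l. n div 2^Suc l" and k = 0 and A = 1, OF p \<tau> supp _ le]
  show "?u \<in> lp_on p UNIV" "lpn p ?u \<le> (1 / (1 - 2 powr (- \<tau> * p))) powr (1/p)"
    by simp_all
qed

text \<open>Even for finitely supported c there are in general infinitely many nonzero entries: once
  an interval at 0 contains the support, each coarser level repeats the total sum. The weight with
  \<open>0 < \<tau>\<close> makes these entries p-summable.\<close>

lemma haar_lp_on:
  fixes c :: "nat \<Rightarrow> 'k::real_normed_field"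
  assumes p: "1 \<le> p" and \<tau>: "0 < \<tau>" and c: "\<And>n. N \<le> n \<Longrightarrow> c n = 0"
  shows "haar \<tau> c \<in> lp_on p UNIV"
proof -
  have "haar \<tau> (\<lambda>n. if n < M then c n else 0) \<in> lp_on p UNIV" for M
  proof (induction M)
    case 0
    show ?case using p by (simp add: haar_zero lp_on_zero)
  next
    case (Suc M)
    have "(\<lambda>n. if n < Suc M then c n else 0) =
        (\<lambda>n. (if n < M then c n else 0) + c M * (if n = M then 1 else 0))"
      by (auto simp: fun_eq_iff less_Suc_eq)
    then show ?case
      using p \<tau> Suc.IH by (auto simp: haar_add haar_scale intro!: lp_on_add lp_on_scale haar_single)
  qed
  moreover have "(\<lambda>n. if n < N then c n else 0) = c" using c by (auto simp: not_less)
  ultimately show ?thesis by metis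
qed

text \<open>The indicator of the first 2^k integers is balanced on all intervals below level k. From
  level k on only the interval at 0 contributes, with sum 2^k and geometrically decaying weights, so
  the norm is of order N^(1-\<tau>) for N = 2^k.\<close>

lemma haar_initial:
  assumes p: "0 < p" and \<tau>: "0 < \<tau>"
  shows "lpn p (haar \<tau> (\<lambda>n::nat. if n < 2^k then 1 else 0 :: 'k::real_normed_field))
      \<le> 2 powr ((1 - \<tau>) * real k) * (1 / (1 - 2 powr (- \<tau> * p))) powr (1/p)"
    "2 powr ((1 - \<tau>) * real k) \<le> lpn p (haar \<tau> (\<lambda>n::nat. if n < 2^k then 1 else 0 :: 'k))"
proof -
  let ?g = "\<lambda>k. if k = 0 then 1 else 0 :: 'k"
  let ?c = "\<lambda>n::nat. if n < 2^k then 1 else 0 :: 'k"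
  have c: "?c = (\<lambda>n. ?g (n div 2^k))" by (auto simp: div_eq_0_iff)
  have d1: "dyadic_sum (k + l) ?c i = 2^k * (if i = 0 then 1 else 0)" for l i
    unfolding c using dyadic_sum_coarse[of k l ?g i] dyadic_sum_single[of l 0 i] by simp
  have z: "haar \<tau> ?c (l, i) = 0" if l: "l < k" for l i
  proof -
    from l obtain r where r: "k - l = Suc r" by (metis Suc_diff_Suc)
    have "2 * i div 2^Suc r = i div 2^r" "(2 * i + 1) div 2^Suc r = i div 2^r"
      by (simp_all add: div_mult2_eq)
    then show ?thesis
      unfolding haar_def c using l dyadic_sum_coarse_le[of l k ?g] by (simp add: r)
  qed
  have z2: "haar \<tau> ?c (l, i) = 0" if i: "i \<noteq> 0" for l i
  proof (cases "l < k")
    case False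
    then show ?thesis using i d1[of "l - k"] by (simp add: haar_def)
  qed (rule z)
  have v: "norm (haar \<tau> ?c (k + l, 0)) = 2 powr ((1 - \<tau>) * real k) * 2 powr (- \<tau> * real l)" for l
  proof -
    have "norm (haar \<tau> ?c (k + l, 0)) = 2 powr (- \<tau> * real (k + l)) * 2 ^ k"
      unfolding haar_def by (simp add: d1[of l] norm_mult norm_power)
    also have "\<dots> = 2 powr ((1 - \<tau>) * real k) * 2 powr (- \<tau> * real l)"
      by (simp add: powr_realpow[symmetric] powr_add[symmetric] algebra_simps)
    finally show ?thesis .
  qed
  have le: "norm (haar \<tau> ?c (k + l, 0)) \<le> 2 powr ((1 - \<tau>) * real k) * 2 powr (- \<tau> * real l)" for l
    using v by simp
  note path = lp_on_geometric_path[where u = "haar \<tau> ?c" and \<pi> = "\<lambda>l. 0" and k = k, OF p \<tau> z2 z le]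
  show "lpn p (haar \<tau> ?c) \<le> 2 powr ((1 - \<tau>) * real k) * (1 / (1 - 2 powr (- \<tau> * p))) powr (1/p)"
    by (rule path(2)) auto
  have "norm (haar \<tau> ?c (k, 0)) \<le> lpn p (haar \<tau> ?c)"
    by (rule norm_le_lpn[OF path(1) p]) auto
  then show "2 powr ((1 - \<tau>) * real k) \<le> lpn p (haar \<tau> ?c)" using v[of 0] by simp
qed

lemma powr_inverse_bound:
  fixes B N K p :: real
  assumes "0 < p" "0 \<le> N" "0 \<le> K"
  shows "(K powr (1/p) * N) powr p = K * N powr p"
  using assms by (simp add: powr_mult powr_powr)

text \<open>
  Cutting \<open>c\<close> off at \<open>m\<close> changes only the Haar coefficients on the path of dyadic intervals that
  contain \<open>m\<close>; there the two Hardy inequalities apply to the sums of \<open>c\<close> over these intervals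
  and over their parts to the left of \<open>m\<close>.
\<close>
lemma haar_truncate:
  assumes p: "1 \<le> p" and \<tau>: "0 < \<tau>" "\<tau> < 1"
  shows "\<exists>K\<ge>0. \<forall>(c :: nat \<Rightarrow> 'k::real_normed_field) N m. (\<forall>n\<ge>N. c n = 0) \<longrightarrow>
    lpn p (haar \<tau> (\<lambda>n. if n < m then c n else 0)) \<le> K * lpn p (haar \<tau> c) \<and>
    norm (c m) \<le> K * lpn p (haar \<tau> c)"
proof -
  have p0: "0 < p" using p by simp
  \<comment> \<open>The contraction factors of the two recursions along the path to m:
    \<open>\<sigma>\<close> is the ratio of consecutive weights and \<open>\<rho>\<close> is half of
    its inverse. Both are below 1 because 0 < \<tau> < 1.\<close>
  define \<rho> where "\<rho> = 2 powr (\<tau> - 1)"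
  define \<sigma> where "\<sigma> = 2 powr (- \<tau>)"
  have \<rho>: "0 < \<rho>" "\<rho> < 1" using \<tau> by (auto simp: \<rho>_def powr_less_one)
  have \<sigma>: "0 < \<sigma>" "\<sigma> < 1" using \<tau> by (auto simp: \<sigma>_def powr_less_one)
  have \<rho>half: "1/2 \<le> \<rho>"
    using powr_mono[of "-1" "\<tau> - 1" 2] \<tau> by (simp add: \<rho>_def powr_minus_divide)
  define K1 where "K1 = (1 - \<rho>) powr (1 - p) / (1 - \<rho>)"
  define K2 where "K2 = 2 powr p * (K1 + 1)"
  define K3 where "K3 = (1 - \<sigma>) powr (1 - p) / (1 - \<sigma>) * K2"
  define K4 where "K4 = 2 powr p * (K3 + K2)"
  have K: "K1 \<ge> 0" "K2 \<ge> 0" "K3 \<ge> 0" "K4 \<ge> 0"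
    using \<rho> \<sigma> by (auto simp: K1_def K2_def K3_def K4_def)
  \<comment> \<open>The first term serves the coefficient at m, the second the norm of the
    truncation.\<close>
  define K where "K = K1 powr (1/p) + 2 * (1 + K4 powr (1/p))"
  have "lpn p (haar \<tau> (\<lambda>n. if n < m then c n else 0)) \<le> K * lpn p (haar \<tau> c) \<and>
      norm (c m) \<le> K * lpn p (haar \<tau> c)"
    if c: "\<forall>n\<ge>N. c n = 0" for c :: "nat \<Rightarrow> 'k" and N m
  proof -
    define h where "h = haar \<tau> c"
    have hL: "h \<in> lp_on p UNIV" unfolding h_def by (rule haar_lp_on[OF p \<tau>(1)]) (use c in auto)
    define M where "M = lpn p h"
    have M: "M \<ge> 0" by (simp add: M_def lpn_nonneg)
    define c' where "c' n = (if n < m then c n else 0)" for n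
    have c': "\<forall>n\<ge>N. c' n = 0" using c by (simp add: c'_def)
    define w where "w l = 2 powr (- \<tau> * real l)" for l :: nat
    have w: "w l > 0" for l by (simp add: w_def)
    have wS: "w (Suc l) = \<sigma> * w l" for l
      by (simp add: w_def \<sigma>_def powr_add[symmetric] algebra_simps)
    have w\<rho>: "w l = 2 * \<rho> * w (Suc l)" for l
    proof -
      have "2 * \<rho> = 2 powr \<tau>" by (simp add: \<rho>_def powr_diff)
      then have "2 * \<rho> * \<sigma> = 1" by (simp add: \<sigma>_def powr_add[symmetric])
      then show ?thesis unfolding wS by (metis mult.assoc mult_1)
    qed
    define \<pi> where "\<pi> l = m div 2^l" for l
    have \<pi>S: "\<pi> (Suc l) = \<pi> l div 2" for l by (simp add: \<pi>_def div_two_power_Suc del: power_Suc)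
    define d where "d l = norm (h (l, \<pi> (Suc l)))" for l
    have d_eq: "d l = w l * norm (dyadic_sum l c (2 * \<pi> (Suc l)) - dyadic_sum l c (2 * \<pi> (Suc l) + 1))" for l
      by (simp add: d_def h_def haar_def w_def norm_mult)
    \<comment> \<open>\<open>S\<close> and \<open>T\<close> belong to the interval of level l that
      contains m and to its sibling; \<open>R\<close> and \<open>Q\<close> are the same sums for the
      truncated sequence.\<close>
    define S where "S l = dyadic_sum l c (\<pi> l)" for l
    define T where "T l = dyadic_sum l c (if odd (\<pi> l) then \<pi> l - 1 else \<pi> l + 1)" for l
    define R where "R l = dyadic_sum l c' (\<pi> l)" for l
    define Q where "Q l = dyadic_sum l c' (if odd (\<pi> l) then \<pi> l - 1 else \<pi> l + 1)" for l
    have cases: "(odd (\<pi> l) \<and> 2 * \<pi> (Suc l) = \<pi> l - 1 \<and> 2 * \<pi> (Suc l) + 1 = \<pi> l) \<or>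
        (even (\<pi> l) \<and> 2 * \<pi> (Suc l) = \<pi> l)" for l
      unfolding \<pi>S by auto
    have SS: "S (Suc l) = S l + T l" and RS: "R (Suc l) = R l + Q l" for l
      using cases[of l] by (auto simp: S_def T_def R_def Q_def simp del: \<pi>S)
    have dST: "d l = w l * norm (S l - T l)" for l
      unfolding d_eq S_def T_def using cases[of l] by (auto simp: norm_minus_commute)
    define y where "y l = w l * norm (S l)" for l
    define z where "z l = w l * norm (R l)" for l
    have nn: "0 \<le> d l" "0 \<le> y l" "0 \<le> z l" for l using w[of l] by (auto simp: d_def y_def z_def)
    \<comment> \<open>The sibling lies entirely to the left or entirely to the right of m, so
      \<open>Q l\<close> is \<open>T l\<close> or 0.\<close>
    have Qle: "norm (Q l) \<le> norm (T l)" for l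
    proof (cases "odd (\<pi> l)")
      case True
      have "Q l = T l" unfolding Q_def T_def
      proof (rule dyadic_sum_cong)
        fix n assume n: "n div 2^l = (if odd (\<pi> l) then \<pi> l - 1 else \<pi> l + 1)"
        have "\<pi> l > 0" using True by (cases "\<pi> l") auto
        then have "n div 2^l < m div 2^l" using n True by (simp add: \<pi>_def)
        then have "n < m" by (meson div_le_mono leD leI)
        then show "c' n = c n" by (simp add: c'_def)
      qed
      then show ?thesis by simp
    next
      case False
      have "Q l = 0" unfolding Q_def
      proof (rule dyadic_sum_zero)
        fix n assume n: "n div 2^l = (if odd (\<pi> l) then \<pi> l - 1 else \<pi> l + 1)"
        then have "n div 2^l > m div 2^l" using False by (simp add: \<pi>_def)
        then have "n > m" by (meson div_le_mono leD leI)
        then show "c' n = 0" by (simp add: c'_def)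
      qed
      then show ?thesis by simp
    qed
    have wT: "w l * norm (T l) \<le> y l + d l" for l
    proof -
      have "norm (T l) \<le> norm (S l) + norm (S l - T l)"
        using norm_triangle_ineq4[of "S l" "S l - T l"] by simp
      then have "w l * norm (T l) \<le> w l * (norm (S l) + norm (S l - T l))"
        using w[of l] by (intro mult_left_mono) auto
      then show ?thesis by (simp add: y_def dST distrib_left)
    qed
    have ystep: "y l \<le> \<rho> * (y (Suc l) + d l)" for l
    proof -
      \<comment> \<open>2 S = (S + T) + (S - T), where S + T is the sum over the parent interval. A
        fine sum is thus expressed by a coarser one, hence the backward inequality.\<close>
      have "2 * norm (S l) = norm (S (Suc l) + (S l - T l))"
        by (simp add: SS norm_mult flip: mult_2)
      also have "\<dots> \<le> norm (S (Suc l)) + norm (S l - T l)" by (rule norm_triangle_ineq)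
      finally have "w l * (2 * norm (S l)) \<le> w l * (norm (S (Suc l)) + norm (S l - T l))"
        using w[of l] by (intro mult_left_mono) auto
      then have "2 * y l \<le> w l * norm (S (Suc l)) + d l"
        by (simp add: y_def dST algebra_simps)
      also have "w l * norm (S (Suc l)) = 2 * (\<rho> * y (Suc l))"
        by (simp add: y_def w\<rho>[of l])
      finally have "y l \<le> \<rho> * y (Suc l) + d l * (1/2)" by simp
      also have "\<dots> \<le> \<rho> * y (Suc l) + d l * \<rho>"
        using \<rho>half nn(1) by (intro add_left_mono mult_left_mono)
      finally show ?thesis by (simp add: algebra_simps)
    qed
    have zstep: "z (Suc l) \<le> \<sigma> * (z l + (y l + d l))" for l
    proof -
      have "norm (R (Suc l)) \<le> norm (R l) + norm (T l)"
        using norm_triangle_ineq[of "R l" "Q l"] Qle[of l] by (simp add: RS)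
      then have "w (Suc l) * norm (R (Suc l)) \<le> w (Suc l) * (norm (R l) + norm (T l))"
        using w[of "Suc l"] by (intro mult_left_mono) auto
      also have "\<dots> = \<sigma> * (z l + w l * norm (T l))" by (simp add: wS z_def algebra_simps)
      also have "\<dots> \<le> \<sigma> * (z l + (y l + d l))"
        using wT \<sigma> by (intro mult_left_mono add_left_mono) auto
      finally show ?thesis by (simp add: z_def)
    qed
    \<comment> \<open>The cut is strict, so the truncation vanishes at m, which is its own interval
      of level 0.\<close>
    have z0: "z 0 = 0" by (simp add: z_def R_def \<pi>_def c'_def)
    have dB: "(\<Sum>l<J. d l powr p) \<le> M powr p" for J
    proof -
      have "(\<Sum>l<J. d l powr p) = (\<Sum>q\<in>(\<lambda>l. (l, \<pi> (Suc l))) ` {..<J}. norm (h q) powr p)"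
        by (subst sum.reindex) (auto simp: inj_on_def d_def)
      also have "\<dots> \<le> M powr p" unfolding M_def by (rule sum_le_lpn[OF hL p0]) simp
      finally show ?thesis .
    qed
    have ylim: "y \<longlonglongrightarrow> 0"
    proof -
      \<comment> \<open>From level L on the interval containing m starts at 0 and contains the
        support, so its sum is constant while the weight tends to 0.\<close>
      define L where "L = max N (Suc m)"
      have "L < 2 ^ L" by (rule less_exp)
      have ev: "y l = \<sigma> ^ l * norm (dyadic_sum L c 0)" if "l \<ge> L" for l
      proof -
        have "S (L + j) = dyadic_sum L c 0" for j
        proof (induction j)
          case 0
          have "m < L" by (simp add: L_def)
          then have "m < 2 ^ L" using \<open>L < 2 ^ L\<close> by linarith
          then show ?case by (simp add: S_def \<pi>_def)
        next
          case (Suc j)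
          have L: "L < 2 ^ (L + j)"
            using \<open>L < 2 ^ L\<close> power_increasing[of L "L + j" "2::nat"] by linarith
          have "m < L" by (simp add: L_def)
          then have "m < 2 ^ (L + j)" using L by linarith
          then have e: "\<pi> (L + j) = 0" by (simp add: \<pi>_def)
          have "T (L + j) = 0"
            unfolding T_def
          proof (rule dyadic_sum_zero)
            fix n assume n: "n div 2^(L + j) = (if odd (\<pi> (L + j)) then \<pi> (L + j) - 1 else \<pi> (L + j) + 1)"
            then have "n div 2^(L + j) = 1" by (simp add: e)
            then have "n \<ge> 2^(L + j)" by (cases "n < 2^(L + j)") auto
            moreover have "N \<le> L" by (simp add: L_def)
            ultimately have "n \<ge> N" using L by linarith
            then show "c n = 0" using c by simp
          qed
          then show ?case using Suc SS[of "L + j"] by simp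
        qed
        from this[of "l - L"] that have "S l = dyadic_sum L c 0" by simp
        moreover have "w l = \<sigma> ^ l"
          using powr_realpow[OF \<sigma>(1), of l] by (simp add: w_def \<sigma>_def powr_powr)
        ultimately show ?thesis by (simp add: y_def)
      qed
      have "(\<lambda>l. \<sigma> ^ l * norm (dyadic_sum L c 0)) \<longlonglongrightarrow> 0"
        using \<sigma> by (intro tendsto_mult_left_zero LIMSEQ_power_zero) auto
      then show ?thesis
        by (rule Lim_transform_eventually) (use ev in \<open>auto simp: eventually_sequentially intro!: exI[of _ L]\<close>)
    qed
    have yB: "(\<Sum>l<J. y l powr p) \<le> K1 * M powr p" for J
      using hardy_backward[OF \<rho> p nn(2) nn(1) ystep ylim dB] by (simp add: K1_def)
    have eB: "(\<Sum>l<J. (y l + d l) powr p) \<le> K2 * M powr p" for J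
    proof -
      have "(\<Sum>l<J. (y l + d l) powr p) \<le> (\<Sum>l<J. 2 powr p * (y l powr p + d l powr p))"
        using nn p0 by (intro sum_mono powr_add_le) auto
      also have "\<dots> = 2 powr p * ((\<Sum>l<J. y l powr p) + (\<Sum>l<J. d l powr p))"
        by (simp only: sum_distrib_left sum.distrib[symmetric])
      also have "\<dots> \<le> 2 powr p * (K1 * M powr p + M powr p)"
        by (intro mult_left_mono add_mono yB dB) auto
      finally show ?thesis by (simp add: K2_def algebra_simps)
    qed
    have zB: "(\<Sum>l<J. z l powr p) \<le> K3 * M powr p" for J
      using hardy_forward[OF \<sigma> p nn(3) _ zstep z0 eB, where J = J] nn by (simp add: K3_def mult.assoc)
    have fB: "(\<Sum>l<J. (z l + (y l + d l)) powr p) \<le> K4 * M powr p" for J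
    proof -
      have "(\<Sum>l<J. (z l + (y l + d l)) powr p) \<le> (\<Sum>l<J. 2 powr p * (z l powr p + (y l + d l) powr p))"
        using nn p0 by (intro sum_mono powr_add_le) auto
      also have "\<dots> = 2 powr p * ((\<Sum>l<J. z l powr p) + (\<Sum>l<J. (y l + d l) powr p))"
        by (simp only: sum_distrib_left sum.distrib[symmetric])
      also have "\<dots> \<le> 2 powr p * (K3 * M powr p + K2 * M powr p)"
        by (intro mult_left_mono add_mono zB eB) auto
      finally show ?thesis by (simp add: K4_def algebra_simps)
    qed
    \<comment> \<open>\<open>u\<close> collects the entries on the path and \<open>v\<close> those
      to its left, which truncation does not change; to its right all entries vanish.\<close>
    define u where "u = (\<lambda>(l, i). if i = \<pi> (Suc l) then haar \<tau> c' (l, i) else 0)"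
    define v where "v = (\<lambda>(l, i). if i < \<pi> (Suc l) then h (l, i) else 0)"
    have split: "haar \<tau> c' = (\<lambda>q. v q + u q)"
    proof (rule ext)
      fix q :: "nat \<times> nat"
      obtain l i where q: "q = (l, i)" by (cases q)
      consider "i < \<pi> (Suc l)" | "i = \<pi> (Suc l)" | "i > \<pi> (Suc l)" by linarith
      then show "haar \<tau> c' q = v q + u q"
      proof cases
        case 1
        have "dyadic_sum l c' j = dyadic_sum l c j" if "j = 2 * i \<or> j = 2 * i + 1" for j
        proof (rule dyadic_sum_cong)
          fix n assume "n div 2^l = j"
          then have "n div 2^Suc l = i" using that by (auto simp: div_two_power_Suc simp del: power_Suc)
          then have "n div 2^Suc l < m div 2^Suc l" using 1 by (simp add: \<pi>_def del: power_Suc)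
          then have "n < m" by (meson div_le_mono leD leI)
          then show "c' n = c n" by (simp add: c'_def)
        qed
        then show ?thesis using 1 by (simp add: q u_def v_def h_def haar_def)
      next
        case 2
        then show ?thesis by (simp add: q u_def v_def)
      next
        case 3
        have "dyadic_sum l c' j = 0" if "j = 2 * i \<or> j = 2 * i + 1" for j
        proof (rule dyadic_sum_zero)
          fix n assume "n div 2^l = j"
          then have "n div 2^Suc l = i" using that by (auto simp: div_two_power_Suc simp del: power_Suc)
          then have "n div 2^Suc l > m div 2^Suc l" using 3 by (simp add: \<pi>_def del: power_Suc)
          then have "n > m" by (meson div_le_mono leD leI)
          then show "c' n = 0" by (simp add: c'_def)
        qed
        then show ?thesis using 3 by (simp add: q u_def v_def haar_def)
      qed
    qed
    have ule: "norm (u (l, \<pi> (Suc l))) \<le> z l + (y l + d l)" for l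
    proof -
      have "norm (u (l, \<pi> (Suc l))) = w l * norm (R l - Q l)"
        unfolding u_def haar_def R_def Q_def
        using cases[of l] by (auto simp: w_def norm_mult norm_minus_commute)
      also have "\<dots> \<le> w l * (norm (R l) + norm (T l))"
        using w[of l] norm_triangle_ineq4[of "R l" "Q l"] Qle[of l] by (intro mult_left_mono) auto
      also have "\<dots> \<le> z l + (y l + d l)" using wT[of l] by (simp add: z_def distrib_left)
      finally show ?thesis .
    qed
    have uB: "(\<Sum>l<J. norm (u (l, \<pi> (Suc l))) powr p) \<le> (K4 powr (1/p) * M) powr p" for J
    proof -
      have "(\<Sum>l<J. norm (u (l, \<pi> (Suc l))) powr p) \<le> (\<Sum>l<J. (z l + (y l + d l)) powr p)"
        using ule p0 by (intro sum_mono powr_mono2) auto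
      also have "\<dots> \<le> K4 * M powr p" by (rule fB)
      also have "\<dots> = (K4 powr (1/p) * M) powr p"
        by (rule powr_inverse_bound[symmetric]) (use p0 M K in auto)
      finally show ?thesis .
    qed
    have uL: "u \<in> lp_on p UNIV" "lpn p u \<le> K4 powr (1/p) * M"
      by (rule lp_on_path[where \<pi> = "\<lambda>l. \<pi> (Suc l)", OF p0 _ _ uB]; use M in \<open>simp add: u_def\<close>)+
    have vL: "v \<in> lp_on p UNIV" "lpn p v \<le> M"
      unfolding M_def by (rule lp_on_dominated[OF hL p0]; force simp: v_def)+
    have "lpn p (haar \<tau> c') \<le> 2 * (M + K4 powr (1/p) * M)"
      unfolding split by (rule order_trans[OF lp_on_add(2)[OF vL(1) uL(1) p]])
        (intro mult_left_mono add_mono vL(2) uL(2), simp)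
    also have "\<dots> = 2 * (1 + K4 powr (1/p)) * M" by (simp add: algebra_simps)
    also have "\<dots> \<le> K * M" using M by (intro mult_right_mono) (auto simp: K_def)
    finally have 1: "lpn p (haar \<tau> c') \<le> K * M" .
    \<comment> \<open>The coefficient at m is the level 0 term of y, so the backward Hardy bound
      already contains it.\<close>
    have "norm (c m) powr p = (\<Sum>l<Suc 0. y l powr p)" by (simp add: y_def S_def \<pi>_def w_def)
    also have "\<dots> \<le> K1 * M powr p" by (rule yB)
    also have "\<dots> = (K1 powr (1/p) * M) powr p"
      by (rule powr_inverse_bound[symmetric]) (use p0 M K in auto)
    finally have cM: "norm (c m) powr p \<le> (K1 powr (1/p) * M) powr p" .
    have "norm (c m) \<le> K1 powr (1/p) * M"
      by (rule powr_le_cancel[OF p0 _ cM]) (use M in auto)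
    also have "\<dots> \<le> K * M" using M by (intro mult_right_mono) (auto simp: K_def)
    finally have 2: "norm (c m) \<le> K * M" .
    from 1 2 show ?thesis unfolding c'_def[abs_def] M_def h_def by blast
  qed
  moreover have "K \<ge> 0" by (simp add: K_def)
  ultimately show ?thesis by blast
qed

section \<open>A conditional basis\<close>

text \<open>Encodes the sum of two copies of ell_p as a single ell_p over pairs with a boolean
  tag.\<close>

definition lp_pair :: "('j \<Rightarrow> 'k) \<Rightarrow> ('j \<Rightarrow> 'k) \<Rightarrow> bool \<times> 'j \<Rightarrow> 'k" where
  "lp_pair u v = (\<lambda>(b, q). if b then u q else v q)"

lemma lp_pair:
  fixes u v :: "'j \<Rightarrow> 'k::real_normed_field"
  assumes u: "u \<in> lp_on p UNIV" and v: "v \<in> lp_on p UNIV" and p: "1 \<le> p"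
  shows "lp_pair u v \<in> lp_on p UNIV" "lpn p (lp_pair u v) \<le> 2 * (lpn p u + lpn p v)"
    "lpn p u \<le> lpn p (lp_pair u v)" "lpn p v \<le> lpn p (lp_pair u v)"
proof -
  have p0: "0 < p" using p by simp
  let ?u = "\<lambda>z. if z \<in> {True} \<times> UNIV then u (snd z) else 0"
  let ?v = "\<lambda>z. if z \<in> {False} \<times> UNIV then v (snd z) else 0"
  have i: "inj_on snd ({True} \<times> (UNIV :: 'j set))" "inj_on snd ({False} \<times> (UNIV :: 'j set))"
    by (auto simp: inj_on_def)
  have uL: "?u \<in> lp_on p UNIV" and vL: "?v \<in> lp_on p UNIV"
    using lp_on_compose_inj(1)[OF u i(1) p0] lp_on_compose_inj(1)[OF v i(2) p0]
    by (auto intro: lp_on_mono)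
  have eq: "lp_pair u v = (\<lambda>z. ?u z + ?v z)" by (auto simp: lp_pair_def)
  show L: "lp_pair u v \<in> lp_on p UNIV" unfolding eq by (rule lp_on_add(1)[OF uL vL p])
  show "lpn p (lp_pair u v) \<le> 2 * (lpn p u + lpn p v)"
    unfolding eq by (rule order_trans[OF lp_on_add(2)[OF uL vL p]])
      (intro mult_left_mono add_mono lp_on_compose_inj(2)[OF u i(1) p0] lp_on_compose_inj(2)[OF v i(2) p0], simp)
  show "lpn p u \<le> lpn p (lp_pair u v)"
    using lp_on_compose_inj(2)[OF L, of "Pair True" UNIV] p0 by (simp add: inj_on_def lp_pair_def)
  show "lpn p v \<le> lpn p (lp_pair u v)"
    using lp_on_compose_inj(2)[OF L, of "Pair False" UNIV] p0 by (simp add: inj_on_def lp_pair_def)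
qed

text \<open>A Haar function has exactly one nonzero Haar coefficient. Finitely supported sequences
  therefore reach multiples of all unit vectors of ell_p, which is what makes the new basis
  fundamental.\<close>

lemma haar_of_haar_function:
  "haar \<tau> (\<lambda>n. (if n div 2^l = 2 * i then 1 else 0) + (- 1) * (if n div 2^l = 2 * i + 1 then 1 else 0 :: 'k::real_normed_field)) =
    (\<lambda>q. of_real (2 powr (- \<tau> * real l) * 2 ^ Suc l) * (if q = (l, i) then 1 else 0))"
proof (rule ext)
  let ?g = "\<lambda>n. (if n = 2 * i then 1 else 0) + (- 1) * (if n = 2 * i + 1 then 1 else 0 :: 'k)"
  let ?c = "\<lambda>n. ?g (n div 2^l)"
  fix q :: "nat \<times> nat"
  obtain l' i' where q: "q = (l', i')" by (cases q)
  \<comment> \<open>At coarser levels both values fall into the same dyadic interval and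
    cancel.\<close>
  have g: "dyadic_sum k ?g j = 0" if "k > 0" for k j
  proof -
    obtain k' where k': "k = Suc k'" using \<open>k > 0\<close> gr0_implies_Suc by blast
    have "2 * i div 2^k = (2 * i + 1) div 2^k"
      unfolding k' power_Suc div_mult2_eq by simp
    then show ?thesis
      unfolding dyadic_sum_add dyadic_sum_scale dyadic_sum_single by simp
  qed
  consider "l' < l" | "l' = l" | "l < l'" by linarith
  then have "haar \<tau> ?c q = of_real (2 powr (- \<tau> * real l) * 2 ^ Suc l) * (if q = (l, i) then 1 else 0)"
  proof cases
    case 1
    from 1 obtain r where r: "l - l' = Suc r" by (metis Suc_diff_Suc)
    have "2 * i' div 2^Suc r = i' div 2^r" "(2 * i' + 1) div 2^Suc r = i' div 2^r"
      by (simp_all add: div_mult2_eq)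
    then have "dyadic_sum l' ?c (2 * i') = dyadic_sum l' ?c (2 * i' + 1)"
      using 1 dyadic_sum_coarse_le[of l' l ?g "2 * i'"] dyadic_sum_coarse_le[of l' l ?g "2 * i' + 1"]
      by (simp only: r) 
    then show ?thesis using 1 by (simp add: q haar_def)
  next
    case 2
    have "dyadic_sum l ?c j = 2^l * ?g j" for j
      using dyadic_sum_coarse_le[of l l ?g j] by simp
    moreover have "2 * i' \<noteq> 2 * i + 1" "2 * i' + 1 \<noteq> 2 * i" by presburger+
    ultimately show ?thesis using 2 by (auto simp: q haar_def)
  next
    case 3
    have "dyadic_sum l' ?c j = 0" for j
      using dyadic_sum_coarse[of l "l' - l" ?g j] g[of "l' - l"] 3 by simp
    then show ?thesis using 3 by (simp add: q haar_def)
  qed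
  then show "haar \<tau> ?c q = of_real (2 powr (- \<tau> * real l) * 2 ^ Suc l) * (if q = (l, i) then 1 else 0)" .
qed

section \<open>Finitely supported coefficient sequences\<close>

definition fin_supp :: "(nat \<Rightarrow> 'k::zero) \<Rightarrow> bool" where
  "fin_supp c \<longleftrightarrow> (\<exists>N. \<forall>n\<ge>N. c n = 0)"

lemma fin_supp_add: "fin_supp c \<Longrightarrow> fin_supp d \<Longrightarrow> fin_supp (\<lambda>n. c n + (d n :: 'k::comm_ring_1))"
  unfolding fin_supp_def
proof (elim exE)
  fix N M assume "\<forall>n\<ge>N. c n = 0" "\<forall>n\<ge>M. d n = 0"
  then show "\<exists>N. \<forall>n\<ge>N. c n + d n = 0" by (intro exI[of _ "max N M"]) auto
qed

lemma fin_supp_scale: "fin_supp c \<Longrightarrow> fin_supp (\<lambda>n. a * (c n :: 'k::comm_ring_1))"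
  unfolding fin_supp_def by fastforce

lemma fin_supp_zero: "fin_supp (\<lambda>n. 0)"
  by (simp add: fin_supp_def)

lemma fin_supp_single: "fin_supp (\<lambda>n. if n = k then a else 0)"
  unfolding fin_supp_def by (intro exI[of _ "Suc k"]) auto

lemma fin_supp_less: "fin_supp (\<lambda>n. if n < k then c n else 0)"
  unfolding fin_supp_def by (intro exI[of _ k]) auto

lemma fin_supp_div: "fin_supp (\<lambda>n. if n div 2^l = (i::nat) then a else 0)"
  unfolding fin_supp_def
proof (intro exI[of _ "Suc i * 2^l"] allI impI)
  fix n assume "n \<ge> Suc i * 2^l"
  then have "Suc i * 2^l div 2^l \<le> n div 2^l" by (rule div_le_mono)
  then show "(if n div 2^l = i then a else 0) = 0" by auto
qed

lemma three_mult_add_eq: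
  fixes r i n :: nat
  assumes "r < 3"
  shows "3 * i + r = n \<longleftrightarrow> n mod 3 = r \<and> i = n div 3"
proof
  assume "3 * i + r = n"
  then have "n = r + i * 3" by simp
  then show "n mod 3 = r \<and> i = n div 3" using assms by (simp only: mod_mult_self1 div_mult_self1) simp
next
  assume "n mod 3 = r \<and> i = n div 3"
  then show "3 * i + r = n" by auto
qed

context banach_space_over
begin

text \<open>
  With $\tau_1 < \tau_2$, the initial sums of the unit vectors are large in the norm of \<open>haar \<tau>1\<close> and
  small in that of \<open>haar \<tau>2\<close>. The new basis contains $e_n \oplus e_n$ and $e_n \oplus (-e_n)$: the sum of
  their differences sees only the small norm, its projection to the $e_n \oplus e_n$ also the large one.
\<close>
lemma conditional_basis_exists:
  assumes p: "1 \<le> p" and cs: "complemented_subspace smul Y" and iso: "lp_isomorphic_to p smul Y"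
    and bs: "basic_seq K0 x" and fd: "fundamental x" and nx: "\<And>k. norm (x k) = 1"
    and a: "0 < a" "a < 1"
  obtains y K A B \<gamma> where "basic_seq K y" "fundamental y" "A > 0"
    "\<And>n. A \<le> norm (y n)" "\<And>n. norm (y n) \<le> B" "\<gamma> > 0"
    "\<And>m. m \<ge> 1 \<Longrightarrow> \<exists>c S. lincomb c y m \<noteq> 0 \<and>
       \<gamma> * real m powr a * norm (lincomb c y m) \<le> norm (lincomb (\<lambda>k. if k \<in> S then c k else 0) y m)"
proof -
  have p0: "0 < p" using p by simp
  let ?I = "UNIV :: (bool \<times> nat \<times> nat) set"
  have "infinite ?I" by (simp add: finite_prod)
  then obtain \<Phi> and D :: "(bool \<times> nat \<times> nat \<Rightarrow> 'k) \<Rightarrow> 'a" and C where sp: "lp_splitting p ?I \<Phi> D C"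
    using lp_splitting_exists[OF p cs iso, of ?I] by auto
  let ?L = "lp_on p ?I :: (bool \<times> nat \<times> nat \<Rightarrow> 'k) set"
  have C: "C > 0" and \<Phi>add: "\<And>f g. \<Phi> (f + g) = \<Phi> f + \<Phi> g" and \<Phi>scale: "\<And>c f. \<Phi> (smul c f) = smul c (\<Phi> f)"
    and Dadd: "\<And>u v. u \<in> ?L \<Longrightarrow> v \<in> ?L \<Longrightarrow> D (\<lambda>i. u i + v i) = D u + D v"
    and Dscale: "\<And>c u. u \<in> ?L \<Longrightarrow> D (\<lambda>i. c * u i) = smul c (D u)"
    and up: "\<And>g u. u \<in> ?L \<Longrightarrow> norm (\<Phi> g + D u) \<le> C * (norm g + lpn p u)"
    and lo: "\<And>g u. u \<in> ?L \<Longrightarrow> norm g + lpn p u \<le> C * norm (\<Phi> g + D u)"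
    using sp by (auto simp: lp_splitting_def)
  have \<Phi>0: "\<Phi> 0 = 0" using \<Phi>scale[of 0 0] by simp
  \<comment> \<open>Symmetric about 1/2 with difference a: initial sums of length 2^k get norms of
    order 2^((1+a) k/2) and 2^((1-a) k/2).\<close>
  define \<tau>1 where "\<tau>1 = (1 - a) / 2"
  define \<tau>2 where "\<tau>2 = (1 + a) / 2"
  have \<tau>: "0 < \<tau>1" "\<tau>1 < 1" "0 < \<tau>2" "\<tau>2 < 1" using a by (auto simp: \<tau>1_def \<tau>2_def)
  define h1 where "h1 = (haar \<tau>1 :: (nat \<Rightarrow> 'k) \<Rightarrow> _)"
  define h2 where "h2 = (haar \<tau>2 :: (nat \<Rightarrow> 'k) \<Rightarrow> _)"
  have hL: "h1 c \<in> lp_on p UNIV" "h2 c \<in> lp_on p UNIV" if "fin_supp c" for c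
    using that unfolding h1_def h2_def fin_supp_def by (auto intro: haar_lp_on[OF p \<tau>(1)] haar_lp_on[OF p \<tau>(3)])
  define u where "u c d = lp_pair (h1 c) (h2 d)" for c d
  have uL: "u c d \<in> ?L" "lpn p (u c d) \<le> 2 * (lpn p (h1 c) + lpn p (h2 d))"
    "lpn p (h1 c) \<le> lpn p (u c d)" "lpn p (h2 d) \<le> lpn p (u c d)"
    if "fin_supp c" "fin_supp d" for c d
    unfolding u_def using lp_pair[OF hL(1)[OF that(1)] hL(2)[OF that(2)] p] by auto
  define W where "W c d = D (u c d)" for c d
  have W_add: "W (\<lambda>i. c i + c' i) (\<lambda>i. d i + d' i) = W c d + W c' d'"
    if "fin_supp c" "fin_supp d" "fin_supp c'" "fin_supp d'" for c d c' d'
  proof -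
    have "u (\<lambda>i. c i + c' i) (\<lambda>i. d i + d' i) = (\<lambda>z. u c d z + u c' d' z)"
      by (auto simp: u_def lp_pair_def h1_def h2_def haar_add)
    then show ?thesis unfolding W_def using Dadd uL(1) that by metis
  qed
  have W_scale: "W (\<lambda>i. b * c i) (\<lambda>i. b * d i) = smul b (W c d)" if "fin_supp c" "fin_supp d" for b c d
  proof -
    have "u (\<lambda>i. b * c i) (\<lambda>i. b * d i) = (\<lambda>z. b * u c d z)"
      by (auto simp: u_def lp_pair_def h1_def h2_def haar_scale)
    then show ?thesis unfolding W_def using Dscale uL(1) that by metis
  qed
  define \<delta> where "\<delta> k i = (if i = k then 1 else 0 :: 'k)" for k i :: nat
  have f\<delta>: "fin_supp (\<delta> k)" "fin_supp (\<lambda>i. b * \<delta> k i)" for k b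
    unfolding \<delta>_def by (intro fin_supp_single fin_supp_scale)+
  define s where "s n = (if n mod 3 = 1 then 1 else - 1 :: 'k)" for n :: nat
  \<comment> \<open>Residues modulo 3 interleave the given basis with the two diagonal families;
    \<open>s n\<close> is the sign of the second component.\<close>
  define y where "y n = (if n mod 3 = 0 then \<Phi> (x (n div 3))
      else W (\<delta> (n div 3)) (\<lambda>i. s n * \<delta> (n div 3) i))" for n
  \<comment> \<open>The first n coefficients sorted by residue; \<open>P\<close> and
    \<open>Q\<close> are the resulting coefficient sequences in the two Haar norms.\<close>
  define X where "X c n k = (if 3 * k < n then c (3 * k) else 0)" for c :: "nat \<Rightarrow> 'k" and n k
  define A where "A c n k = (if 3 * k + 1 < n then c (3 * k + 1) else 0)" for c :: "nat \<Rightarrow> 'k" and n k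
  define B where "B c n k = (if 3 * k + 2 < n then c (3 * k + 2) else 0)" for c :: "nat \<Rightarrow> 'k" and n k
  define P where "P c n k = A c n k + B c n k" for c n k
  define Q where "Q c n k = A c n k + (- 1) * B c n k" for c n k
  have fAB: "fin_supp (A c n)" "fin_supp (B c n)" for c n
    unfolding fin_supp_def by (intro exI[of _ n]; simp add: A_def B_def)+
  have fPQ: "fin_supp (P c n)" "fin_supp (Q c n)" for c n
    unfolding P_def[abs_def] Q_def[abs_def]
    by (rule fin_supp_add[OF fAB(1) fAB(2)], rule fin_supp_add[OF fAB(1) fin_supp_scale[OF fAB(2)]])
  have Xi: "X c (Suc n) i = X c n i + (if n mod 3 = 0 then c n else 0) * \<delta> (n div 3) i"
    and Ai: "A c (Suc n) i = A c n i + (if n mod 3 = 1 then c n else 0) * \<delta> (n div 3) i"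
    and Bi: "B c (Suc n) i = B c n i + (if n mod 3 = 2 then c n else 0) * \<delta> (n div 3) i" for c n i
  proof -
    have step: "(if j < Suc n then c j else 0) = (if j < n then c j else 0) + (if m then c n else 0) * (if e then 1 else 0)"
      if "j = n \<longleftrightarrow> m \<and> e" for j m e
      using that by (auto simp: less_Suc_eq)
    show "X c (Suc n) i = X c n i + (if n mod 3 = 0 then c n else 0) * \<delta> (n div 3) i"
      unfolding X_def \<delta>_def by (rule step) (use three_mult_add_eq[of 0 i n] in simp)
    show "A c (Suc n) i = A c n i + (if n mod 3 = 1 then c n else 0) * \<delta> (n div 3) i"
      unfolding A_def \<delta>_def by (rule step) (rule three_mult_add_eq, simp)
    show "B c (Suc n) i = B c n i + (if n mod 3 = 2 then c n else 0) * \<delta> (n div 3) i"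
      unfolding B_def \<delta>_def by (rule step) (rule three_mult_add_eq, simp)
  qed
  have Xstep: "X c (Suc n) = (\<lambda>i. X c n i + (if n mod 3 = 0 then c n else 0) * \<delta> (n div 3) i)" for c n
    using Xi by (rule ext)
  have Pstep: "P c (Suc n) = (\<lambda>i. P c n i + (if n mod 3 = 0 then 0 else c n) * \<delta> (n div 3) i)"
    and Qstep: "Q c (Suc n) = (\<lambda>i. Q c n i + (if n mod 3 = 0 then 0 else c n) * (s n * \<delta> (n div 3) i))" for c n
  proof -
    have alg: "(a + (if m1 then b else 0) * d) + (a' + (if m2 then b else 0) * d) = (a + a') + (if m0 then 0 else b) * d"
      "(a + (if m1 then b else 0) * d) + - 1 * (a' + (if m2 then b else 0) * d) =
        (a + - 1 * a') + (if m0 then 0 else b) * ((if m1 then 1 else - 1) * d)"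
      if "m0 \<and> \<not> m1 \<and> \<not> m2 \<or> \<not> m0 \<and> m1 \<and> \<not> m2 \<or> \<not> m0 \<and> \<not> m1 \<and> m2"
      for m0 m1 m2 and a a' b d :: 'k
      using that by (auto simp: algebra_simps)
    have m: "n mod 3 = 0 \<and> n mod 3 \<noteq> 1 \<and> n mod 3 \<noteq> 2 \<or> n mod 3 \<noteq> 0 \<and> n mod 3 = 1 \<and> n mod 3 \<noteq> 2 \<or>
      n mod 3 \<noteq> 0 \<and> n mod 3 \<noteq> 1 \<and> n mod 3 = 2" by presburger
    show "P c (Suc n) = (\<lambda>i. P c n i + (if n mod 3 = 0 then 0 else c n) * \<delta> (n div 3) i)"
      unfolding P_def Ai Bi by (rule ext, rule alg(1)[OF m])
    show "Q c (Suc n) = (\<lambda>i. Q c n i + (if n mod 3 = 0 then 0 else c n) * (s n * \<delta> (n div 3) i))"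
      unfolding Q_def Ai Bi s_def by (rule ext, rule alg(2)[OF m])
  qed
  \<comment> \<open>The length N is free so that a shorter partial sum of y can be written with as
    many terms of x as a longer one.\<close>
  have rep: "lincomb c y n = \<Phi> (lincomb (X c n) x N) + W (P c n) (Q c n)" if "n \<le> N" for c n N
    using that
  proof (induction n)
    case 0
    have "P c 0 = (\<lambda>i. 0 * \<delta> 0 i)" "Q c 0 = (\<lambda>i. 0 * \<delta> 0 i)" "X c 0 = (\<lambda>i. 0)"
      by (auto simp: P_def Q_def A_def B_def X_def)
    then have "W (P c 0) (Q c 0) = 0" "lincomb (X c 0) x N = 0"
      using W_scale[OF f\<delta>(1) f\<delta>(1), of 0 0 0] by (simp_all add: lincomb_def)
    then show ?case by (simp add: lincomb_def \<Phi>0)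
  next
    case (Suc n)
    define k where "k = n div 3"
    have k: "k < N" using Suc.prems by (simp add: k_def)
    have l\<delta>: "lincomb (\<lambda>i. b * \<delta> k i) x N = smul b (x k)" for b
    proof -
      have "lincomb (\<lambda>i. b * \<delta> k i) x N = (\<Sum>i<N. if i = k then smul b (x k) else 0)"
        unfolding lincomb_def by (intro sum.cong) (auto simp: \<delta>_def)
      then show ?thesis using k by simp
    qed
    have "lincomb c y (Suc n) = lincomb c y n + smul (c n) (y n)" by (simp add: lincomb_def)
    also have "lincomb c y n = \<Phi> (lincomb (X c n) x N) + W (P c n) (Q c n)" using Suc by simp
    finally have 1: "lincomb c y (Suc n) = \<Phi> (lincomb (X c n) x N) + W (P c n) (Q c n) + smul (c n) (y n)" .
    let ?b = "if n mod 3 = 0 then c n else 0" and ?b' = "if n mod 3 = 0 then 0 else c n"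
    have 2: "\<Phi> (lincomb (X c (Suc n)) x N) = \<Phi> (lincomb (X c n) x N) + smul ?b (\<Phi> (x k))"
      unfolding Xstep k_def[symmetric] lincomb_add l\<delta> by (simp add: \<Phi>add \<Phi>scale)
    have 3: "W (P c (Suc n)) (Q c (Suc n)) = W (P c n) (Q c n) + smul ?b' (W (\<delta> k) (\<lambda>i. s n * \<delta> k i))"
      unfolding Pstep Qstep k_def[symmetric]
      by (subst W_add) (simp_all only: fPQ f\<delta> fin_supp_scale W_scale)
    show ?case unfolding 1 2 3 by (cases "n mod 3 = 0") (simp_all add: y_def k_def)
  qed
  obtain K1 where K1: "K1 \<ge> 0" "\<And>c m. fin_supp c \<Longrightarrow> lpn p (h1 (\<lambda>n. if n < m then c n else 0)) \<le> K1 * lpn p (h1 c)"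
    "\<And>c m. fin_supp c \<Longrightarrow> norm (c m) \<le> K1 * lpn p (h1 c)"
    using haar_truncate[OF p \<tau>(1,2), where ?'k = 'k] unfolding fin_supp_def h1_def by blast
  obtain K2 where K2: "K2 \<ge> 0" "\<And>c m. fin_supp c \<Longrightarrow> lpn p (h2 (\<lambda>n. if n < m then c n else 0)) \<le> K2 * lpn p (h2 c)"
    "\<And>c m. fin_supp c \<Longrightarrow> norm (c m) \<le> K2 * lpn p (h2 c)"
    using haar_truncate[OF p \<tau>(3,4), where ?'k = 'k] unfolding fin_supp_def h2_def by blast
  define G1 where "G1 = (1 / (1 - 2 powr (- \<tau>1 * p))) powr (1/p)"
  define G2 where "G2 = (1 / (1 - 2 powr (- \<tau>2 * p))) powr (1/p)"
  have G: "0 \<le> G1" "0 < G2"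
    using \<tau> p0 by (auto simp: G1_def G2_def powr_less_one)
  have h\<delta>: "lpn p (h1 (\<lambda>i. b * \<delta> k i)) \<le> norm b * G1" "lpn p (h2 (\<lambda>i. b * \<delta> k i)) \<le> norm b * G2" for b k
    using haar_single(2)[OF p0 \<tau>(1), of k, where ?'k = 'k] haar_single(2)[OF p0 \<tau>(3), of k, where ?'k = 'k]
      lp_on_scale(2)[OF hL(1)[OF f\<delta>(1)] p0, of b k] lp_on_scale(2)[OF hL(2)[OF f\<delta>(1)] p0, of b k]
    by (auto simp: h1_def h2_def haar_scale \<delta>_def[abs_def] G1_def G2_def intro!: mult_left_mono)
  have K00: "K0 \<ge> 0" using basic_seq_nonneg[OF bs] nx[of 0] by force
  define E where "E c n = norm (lincomb (X c n) x n) + lpn p (u (P c n) (Q c n))" for c n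
  have basic: "norm (lincomb c y m) \<le> C * (K0 + 4 * (K1 + K2 + (K1 + K2) * (G1 + G2))) * C * norm (lincomb c y n)"
    if mn: "m \<le> n" for c m n
  proof -
    \<comment> \<open>A cut at m can separate a diagonal pair: its first member, with index 3k + 1,
      is kept and its second is lost. Then \<open>e\<close> is the coefficient left over.\<close>
    define k where "k = m div 3"
    define e where "e = (if m mod 3 = 2 then c (m - 1) else 0)"
    have l0: "3 * i < m \<longleftrightarrow> i < (m + 2) div 3" for i by presburger
    have l1: "3 * i + 1 < m \<longleftrightarrow> i < k \<or> m mod 3 = 2 \<and> i = k" for i unfolding k_def by presburger
    have l2: "3 * i + 2 < m \<longleftrightarrow> i < k" for i unfolding k_def by presburger
    have mk: "m - 1 = 3 * k + 1" if "m mod 3 = 2" using that unfolding k_def by presburger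
    have Xm: "X c m = (\<lambda>i. if i < (m + 2) div 3 then X c n i else 0)"
    proof (rule ext)
      fix i
      have "3 * i < n" if "3 * i < m" using that mn by simp
      then show "X c m i = (if i < (m + 2) div 3 then X c n i else 0)"
        unfolding X_def l0[symmetric] by simp
    qed
    have Ami: "A c m i = (if i < k then A c n i else 0) + e * \<delta> k i" for i
    proof -
      have n: "3 * i + 1 < n" if "3 * i + 1 < m" using that mn by simp
      consider "i < k" | "i = k" "m mod 3 = 2" | "i = k" "m mod 3 \<noteq> 2" | "k < i" by linarith
      then show ?thesis
      proof cases
        case 1
        then have "3 * i + 1 < m" unfolding l1 by simp
        with 1 n show ?thesis by (simp add: A_def \<delta>_def)
      next
        case 2
        then have "3 * i + 1 < m" unfolding l1 by simp
        then have "A c m i = c (3 * k + 1)" unfolding A_def using 2(1) by simp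
        moreover have "e = c (3 * k + 1)" unfolding e_def using 2(2) mk by simp
        ultimately show ?thesis using 2(1) by (simp add: \<delta>_def)
      next
        case 3
        then have "\<not> 3 * i + 1 < m" unfolding l1 by simp
        then have "A c m i = 0" unfolding A_def by simp
        moreover have "e = 0" unfolding e_def using 3(2) by simp
        ultimately show ?thesis using 3(1) by simp
      next
        case 4
        then have "\<not> 3 * i + 1 < m" unfolding l1 by simp
        then have "A c m i = 0" unfolding A_def by simp
        then show ?thesis using 4 by (simp add: \<delta>_def)
      qed
    qed
    have Bmi: "B c m i = (if i < k then B c n i else 0)" for i
    proof -
      have "3 * i + 2 < n" if "3 * i + 2 < m" using that mn by simp
      then show ?thesis unfolding B_def l2[symmetric] by simp
    qed
    have Am: "A c m i + B c m i = (if i < k then A c n i + B c n i else 0) + e * \<delta> k i"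
      "A c m i + - 1 * B c m i = (if i < k then A c n i + - 1 * B c n i else 0) + e * \<delta> k i" for i
      unfolding Ami Bmi by simp_all
    have Pm: "P c m = (\<lambda>i. (if i < k then P c n i else 0) + e * \<delta> k i)"
      and Qm: "Q c m = (\<lambda>i. (if i < k then Q c n i else 0) + e * \<delta> k i)"
      using Am by (simp_all add: fun_eq_iff P_def Q_def)
    let ?p = "lpn p (h1 (P c n))" and ?q = "lpn p (h2 (Q c n))"
    have pq: "0 \<le> ?p" "0 \<le> ?q" by (simp_all add: lpn_nonneg)
    \<comment> \<open>The leftover coefficient is half the sum of the coordinates of
      \<open>P\<close> and \<open>Q\<close> at k, and single coordinates are bounded by the Haar
      norms.\<close>
    have e: "norm e \<le> K1 * ?p + K2 * ?q"
    proof (cases "m mod 3 = 2")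
      case True
      then have "3 * k + 1 < m" unfolding l1 by simp
      then have "3 * k + 1 < n" using mn by simp
      then have "e = A c n k" using mk[OF True] True by (simp add: e_def A_def)
      then have "2 * e = P c n k + Q c n k" by (simp add: P_def Q_def)
      then have "2 * norm e = norm (P c n k + Q c n k)" by (metis norm_mult norm_numeral)
      also have "\<dots> \<le> K1 * ?p + K2 * ?q"
        by (intro order_trans[OF norm_triangle_ineq] add_mono K1 K2 fPQ)
      finally show ?thesis using norm_ge_zero[of e] by linarith
    next
      case False
      then show ?thesis using K1(1) K2(1) pq by (simp add: e_def)
    qed
    have "lpn p (h1 (P c m)) \<le> 2 * (lpn p (h1 (\<lambda>i. if i < k then P c n i else 0)) + lpn p (h1 (\<lambda>i. e * \<delta> k i)))"
      unfolding Pm h1_def haar_add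
      by (rule lp_on_add(2)[OF hL(1)[unfolded h1_def] hL(1)[unfolded h1_def] p]) (intro fin_supp_less f\<delta>)+
    also have "\<dots> \<le> 2 * (K1 * ?p + (K1 * ?p + K2 * ?q) * G1)"
      using G(1) e by (intro mult_left_mono add_mono K1(2) fPQ order_trans[OF h\<delta>(1)] mult_right_mono) auto
    finally have 1: "lpn p (h1 (P c m)) \<le> 2 * (K1 * ?p + (K1 * ?p + K2 * ?q) * G1)" .
    have "lpn p (h2 (Q c m)) \<le> 2 * (lpn p (h2 (\<lambda>i. if i < k then Q c n i else 0)) + lpn p (h2 (\<lambda>i. e * \<delta> k i)))"
      unfolding Qm h2_def haar_add
      by (rule lp_on_add(2)[OF hL(2)[unfolded h2_def] hL(2)[unfolded h2_def] p]) (intro fin_supp_less f\<delta>)+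
    also have "\<dots> \<le> 2 * (K2 * ?q + (K1 * ?p + K2 * ?q) * G2)"
      using G(2) e by (intro mult_left_mono add_mono K2(2) fPQ order_trans[OF h\<delta>(2)] mult_right_mono) auto
    finally have 2: "lpn p (h2 (Q c m)) \<le> 2 * (K2 * ?q + (K1 * ?p + K2 * ?q) * G2)" .
    define U where "U = lpn p (u (P c n) (Q c n))"
    have U: "?p \<le> U" "?q \<le> U" "0 \<le> U" unfolding U_def by (simp_all add: uL fPQ lpn_nonneg)
    have "lpn p (u (P c m) (Q c m)) \<le> 2 * (lpn p (h1 (P c m)) + lpn p (h2 (Q c m)))"
      by (intro uL fPQ)
    also have "\<dots> \<le> 4 * (K1 * ?p + K2 * ?q + (K1 * ?p + K2 * ?q) * (G1 + G2))"
      using 1 2 by (simp add: algebra_simps)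
    also have "\<dots> \<le> 4 * (K1 * U + K2 * U + (K1 * U + K2 * U) * (G1 + G2))"
      using G K1(1) K2(1) U by (intro mult_left_mono add_mono mult_right_mono) auto
    also have "\<dots> = 4 * (K1 + K2 + (K1 + K2) * (G1 + G2)) * U" by (simp add: algebra_simps)
    finally have u: "lpn p (u (P c m) (Q c m)) \<le> 4 * (K1 + K2 + (K1 + K2) * (G1 + G2)) * U" .
    let ?K = "4 * (K1 + K2 + (K1 + K2) * (G1 + G2))"
    have K: "?K \<ge> 0" using K1(1) K2(1) G by (intro mult_nonneg_nonneg add_nonneg_nonneg) auto
    let ?V = "norm (lincomb (X c n) x n)"
    have "(m + 2) div 3 \<le> n" using mn by presburger
    then have v: "norm (lincomb (X c m) x n) \<le> K0 * ?V"
      unfolding Xm by (subst lincomb_truncate) (auto intro: basic_seqD[OF bs])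
    have "norm (lincomb c y m) \<le> C * (norm (lincomb (X c m) x n) + lpn p (u (P c m) (Q c m)))"
      unfolding rep[OF mn] W_def by (intro up uL fPQ)
    also have "\<dots> \<le> C * (K0 * ?V + ?K * U)"
      using u v C by (intro mult_left_mono add_mono) auto
    also have "\<dots> \<le> C * ((K0 + ?K) * ?V + (K0 + ?K) * U)"
      using C K00 K U by (intro mult_left_mono add_mono mult_right_mono) auto
    also have "\<dots> = C * (K0 + ?K) * (?V + U)" by (simp add: algebra_simps)
    also have "\<dots> \<le> C * (K0 + ?K) * (C * norm (lincomb c y n))"
      unfolding rep[OF order_refl] W_def U_def using C K00 K K1(1) K2(1) G
      by (intro mult_left_mono lo uL fPQ mult_nonneg_nonneg add_nonneg_nonneg) auto
    finally show ?thesis by (simp add: mult.assoc)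
  qed
  then have by': "basic_seq (C * (K0 + 4 * (K1 + K2 + (K1 + K2) * (G1 + G2))) * C) y"
    by (simp add: basic_seq_def)
  \<comment> \<open>Sums and differences within a diagonal pair give the unit sequence in each
    component separately; combinations of these include the Haar functions, hence the unit vectors
    of ell_p.\<close>
  have fy: "fundamental y"
  proof (rule lp_splitting_fundamental[OF sp p fd])
    show "\<Phi> (x n) \<in> cspan y" for n
      using cspan_basis[of y "3 * n"] by (simp add: y_def)
    have z: "fin_supp (\<lambda>i. 0 :: 'k)" by (rule fin_supp_zero)
    have w1: "W (\<delta> k) (\<lambda>i. 0) \<in> cspan y" and w2: "W (\<lambda>i. 0) (\<delta> k) \<in> cspan y" for k
    proof -
      have y1: "y (3 * k + 1) = W (\<delta> k) (\<delta> k)"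
      proof -
        have "(3 * k + 1) mod 3 = 1" "(3 * k + 1) div 3 = k" by presburger+
        then show ?thesis unfolding y_def s_def by simp
      qed
      have y2: "y (3 * k + 2) = W (\<delta> k) (\<lambda>i. - 1 * \<delta> k i)"
      proof -
        have "(3 * k + 2) mod 3 = 2" "(3 * k + 2) div 3 = k" by presburger+
        then show ?thesis unfolding y_def s_def by simp
      qed
      have f: "(\<lambda>i. \<delta> k i + \<delta> k i) = (\<lambda>i. 2 * \<delta> k i)" "(\<lambda>i. \<delta> k i + - 1 * \<delta> k i) = (\<lambda>i. 2 * 0)"
        "(\<lambda>i. \<delta> k i + - 1 * (- 1 * \<delta> k i)) = (\<lambda>i. 2 * \<delta> k i)"
        by (auto simp: \<delta>_def fun_eq_iff)
      have "y (3 * k + 1) + y (3 * k + 2) = W (\<lambda>i. \<delta> k i + \<delta> k i) (\<lambda>i. \<delta> k i + - 1 * \<delta> k i)"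
        unfolding y1 y2 by (rule W_add[OF f\<delta>(1) f\<delta>(1) f\<delta>(1) f\<delta>(2), symmetric])
      also have "\<dots> = W (\<lambda>i. 2 * \<delta> k i) (\<lambda>i. 2 * 0)" unfolding f ..
      also have "\<dots> = smul 2 (W (\<delta> k) (\<lambda>i. 0))" by (rule W_scale[OF f\<delta>(1) z])
      finally have "W (\<delta> k) (\<lambda>i. 0) = smul (1/2) (y (3 * k + 1) + y (3 * k + 2))" by simp
      then show "W (\<delta> k) (\<lambda>i. 0) \<in> cspan y"
        by (simp only:) (intro cspan_scale cspan_add cspan_basis)
      have "smul (-1) (y (3 * k + 2)) = W (\<lambda>i. - 1 * \<delta> k i) (\<lambda>i. - 1 * (- 1 * \<delta> k i))"
        unfolding y2 by (rule W_scale[OF f\<delta>(1) f\<delta>(2), symmetric])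
      then have "y (3 * k + 1) + smul (-1) (y (3 * k + 2)) =
          W (\<lambda>i. \<delta> k i + - 1 * \<delta> k i) (\<lambda>i. \<delta> k i + - 1 * (- 1 * \<delta> k i))"
        unfolding y1
        by (simp only: W_add[OF f\<delta>(1) f\<delta>(1) f\<delta>(2) fin_supp_scale[OF f\<delta>(2)]])
      also have "\<dots> = W (\<lambda>i. 2 * 0) (\<lambda>i. 2 * \<delta> k i)" unfolding f ..
      also have "\<dots> = smul 2 (W (\<lambda>i. 0) (\<delta> k))" by (rule W_scale[OF z f\<delta>(1)])
      finally have "W (\<lambda>i. 0) (\<delta> k) = smul (1/2) (y (3 * k + 1) + smul (-1) (y (3 * k + 2)))" by simp
      then show "W (\<lambda>i. 0) (\<delta> k) \<in> cspan y"
        by (simp only:) (intro cspan_scale cspan_add cspan_basis)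
    qed
    have w3: "W c (\<lambda>i. 0) \<in> cspan y \<and> W (\<lambda>i. 0) c \<in> cspan y" if c: "fin_supp c" for c
    proof -
      have "W (\<lambda>n. if n < M then c n else 0) (\<lambda>i. 0) \<in> cspan y \<and>
          W (\<lambda>i. 0) (\<lambda>n. if n < M then c n else 0) \<in> cspan y" for M
      proof (induction M)
        case 0
        then show ?case using W_scale[OF z z, of 0] by (simp add: cspan_0)
      next
        case (Suc M)
        have eq: "(\<lambda>n. if n < Suc M then c n else 0) = (\<lambda>n. (if n < M then c n else 0) + c M * \<delta> M n)"
          by (auto simp: fun_eq_iff \<delta>_def less_Suc_eq)
        have 1: "W (\<lambda>n. c M * \<delta> M n) (\<lambda>i. 0) = smul (c M) (W (\<delta> M) (\<lambda>i. 0))"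
          using W_scale[OF f\<delta>(1) z, of "c M" M] by simp
        have 2: "W (\<lambda>i. 0) (\<lambda>n. c M * \<delta> M n) = smul (c M) (W (\<lambda>i. 0) (\<delta> M))"
          using W_scale[OF z f\<delta>(1), of "c M" M] by simp
        show ?case unfolding eq
          using W_add[OF fin_supp_less[of M c] z f\<delta>(2) z, of "c M" M]
            W_add[OF z fin_supp_less[of M c] z f\<delta>(2), of "c M" M] Suc.IH
          by (auto simp: 1 2 intro!: cspan_add cspan_scale w1 w2)
      qed
      moreover obtain M where "\<forall>n\<ge>M. c n = 0" using c by (auto simp: fin_supp_def)
      then have "(\<lambda>n. if n < M then c n else 0) = c" by (auto simp: not_less)
      ultimately show ?thesis by metis
    qed
    fix q :: "bool \<times> nat \<times> nat"
    obtain b l i where q: "q = (b, l, i)" by (cases q) auto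
    define g where "g n = (if n div 2^l = 2 * i then 1 else 0) +
        (- 1) * (if n div 2^l = 2 * i + 1 then 1 else 0 :: 'k)" for n :: nat
    have fg: "fin_supp g" unfolding g_def by (intro fin_supp_add fin_supp_scale fin_supp_div)
    define \<tau> where "\<tau> = (if b then \<tau>1 else \<tau>2)"
    define r where "r = (of_real (2 powr (- \<tau> * real l) * 2 ^ Suc l) :: 'k)"
    have r: "r \<noteq> 0" by (simp add: r_def)
    have hg: "haar \<tau> g = (\<lambda>q. r * (if q = (l, i) then 1 else 0))"
      unfolding g_def r_def by (rule haar_of_haar_function)
    have "(if b then W g (\<lambda>i. 0) else W (\<lambda>i. 0) g) = smul r (D (\<lambda>j. if j = q then 1 else 0))"
    proof -
      have eq: "(if b then u g (\<lambda>i. 0) else u (\<lambda>i. 0) g) = (\<lambda>j. r * (if j = q then 1 else 0))"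
        using hg by (auto simp: u_def lp_pair_def h1_def h2_def haar_zero q \<tau>_def fun_eq_iff)
      have "(\<lambda>j. if j = q then 1 else 0 :: 'k) \<in> ?L"
        using p0 by (intro lp_on_finite(1)[of "{q}"]) auto
      from Dscale[OF this, of r]
      have "D (if b then u g (\<lambda>i. 0) else u (\<lambda>i. 0) g) = smul r (D (\<lambda>j. if j = q then 1 else 0))"
        unfolding eq .
      then show ?thesis unfolding W_def by (cases b) simp_all
    qed
    then have "D (\<lambda>j. if j = q then 1 else 0) = smul (inverse r) (if b then W g (\<lambda>i. 0) else W (\<lambda>i. 0) g)"
      using r by simp
    then show "D (\<lambda>j. if j = q then 1 else 0) \<in> cspan y"
      using w3[OF fg] by (auto intro!: cspan_scale)
  qed
  have zL: "(\<lambda>i. 0) \<in> ?L" and lz: "lpn p (\<lambda>i :: bool \<times> nat \<times> nat. 0 :: 'k) = 0" using p0 by (simp_all add: lp_on_zero)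
  have D0: "D (\<lambda>i. 0) = 0" using Dscale[OF zL, of 0] by simp
  have ybd: "1 / C \<le> norm (y n) \<and> norm (y n) \<le> C * (1 + 2 * (G1 + G2))" for n
  proof (cases "n mod 3 = 0")
    case True
    have "norm (\<Phi> (x (n div 3))) \<le> C * 1" "1 \<le> C * norm (\<Phi> (x (n div 3)))"
      using up[OF zL, of "x (n div 3)"] lo[OF zL, of "x (n div 3)"] by (simp_all add: D0 lz nx)
    moreover have "C * 1 \<le> C * (1 + 2 * (G1 + G2))" using C G by (intro mult_left_mono) auto
    ultimately show ?thesis using True C by (simp add: y_def field_simps)
  next
    case False
    define k where "k = n div 3"
    let ?v = "u (\<delta> k) (\<lambda>i. s n * \<delta> k i)"
    have y: "y n = \<Phi> 0 + D ?v" using False by (simp add: y_def k_def \<Phi>0 W_def)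
    have vL: "?v \<in> ?L" by (intro uL f\<delta>)
    have "norm (s n) = 1" by (simp add: s_def)
    then have "lpn p ?v \<le> 2 * (G1 + G2)"
      using uL(2)[OF f\<delta>(1) f\<delta>(2), of k "s n" k] h\<delta>(1)[of 1 k] h\<delta>(2)[of "s n" k] by simp
    then have "C * (norm (0::'a) + lpn p ?v) \<le> C * (1 + 2 * (G1 + G2))"
      using C by (intro mult_left_mono) auto
    then have 1: "norm (y n) \<le> C * (1 + 2 * (G1 + G2))" unfolding y using up[OF vL, of 0] by linarith
    \<comment> \<open>At level 0 the weight is 1, so a unit vector has an entry of modulus
      1.\<close>
    have "1 = norm (h1 (\<delta> k) (0, k div 2))"
      unfolding h1_def haar_def \<delta>_def by (auto; presburger)
    also have "\<dots> \<le> lpn p (h1 (\<delta> k))" by (rule norm_le_lpn[OF hL(1)[OF f\<delta>(1)] p0])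
    also have "\<dots> \<le> lpn p ?v" by (intro uL f\<delta>)
    also have "\<dots> \<le> C * norm (y n)" unfolding y using lo[OF vL, of 0] by simp
    finally show ?thesis using 1 C by (simp add: field_simps)
  qed
  \<comment> \<open>The value 1/2 serves m < 3. In the other term 6^a comes from m < 6 * 2^k, C^2
    from using the splitting in both directions, and 4 from the quasi-triangle constant times the
    doubled coefficients.\<close>
  define \<gamma> where "\<gamma> = min (1/2) (1 / (4 * C * C * G2 * 6 powr a))"
  have \<gamma>: "\<gamma> > 0" using C G by (simp add: \<gamma>_def)
  have cond: "\<exists>c S. lincomb c y m \<noteq> 0 \<and>
       \<gamma> * real m powr a * norm (lincomb c y m) \<le> norm (lincomb (\<lambda>k. if k \<in> S then c k else 0) y m)"
    if m: "m \<ge> 1" for m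
  \<comment> \<open>Below 3 there is no complete diagonal pair, and the single vector
    \<open>y 0\<close> suffices.\<close>
  proof (cases "m < 3")
    case True
    have "lincomb (\<lambda>k. if k < 1 then 1 else 0) y m = lincomb (\<lambda>k. 1) y 1"
      using m by (intro lincomb_truncate)
    also have "\<dots> = y 0" by (simp add: lincomb_def)
    finally have l: "lincomb (\<lambda>k. if k < 1 then 1 else 0) y m = y 0" .
    have "real m powr a \<le> real m powr 1" using a m by (intro powr_mono) auto
    also have "\<dots> \<le> 2" using True by simp
    finally have "\<gamma> * real m powr a \<le> (1/2) * 2" using \<gamma> by (intro mult_mono) (auto simp: \<gamma>_def)
    then have "\<gamma> * real m powr a * norm (y 0) \<le> 1 * norm (y 0)" by (intro mult_right_mono) auto
    moreover have "y 0 \<noteq> 0" using ybd[of 0] C by auto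
    ultimately show ?thesis using l
      by (intro exI[of _ "\<lambda>k. if k < 1 then 1 else 0"] exI[of _ UNIV]) simp
  next
    case False
    then have "1 \<le> m div 3" by simp
    from ex_power_ivl1[of 2, OF _ this] obtain k where k: "2^k \<le> m div 3" "m div 3 < 2^(k+1)" by auto
    have km: "3 * 2^k \<le> m" and mk: "m < 6 * 2^k" using k by auto
    \<comment> \<open>Opposite signs on the two members of a pair cancel \<open>P\<close> and double
      \<open>Q\<close>, so only the small norm is seen; keeping the first members alone leaves the
      same initial sum in both norms.\<close>
    define c where "c n = (if n div 3 < 2^k then (if n mod 3 = 1 then 1 else if n mod 3 = 2 then - 1 else 0) else 0 :: 'k)" for n :: nat
    define S where "S = {n::nat. n mod 3 = 1}"
    define c' where "c' n = (if n \<in> S then c n else 0)" for n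
    define o1 where "o1 n = (if n < 2^k then 1 else 0 :: 'k)" for n :: nat
    have fo: "fin_supp o1" "fin_supp (\<lambda>i. 2 * o1 i)" "fin_supp (\<lambda>i. 0 :: 'k)"
      unfolding o1_def by (intro fin_supp_scale fin_supp_less fin_supp_zero)+
    have md: "(3 * i) div 3 = i" "(3 * i + 1) div 3 = i" "(3 * i + 2) div 3 = i"
      "(3 * i) mod 3 = 0" "(3 * i + 1) mod 3 = 1" "(3 * i + 2) mod 3 = 2" for i :: nat by presburger+
    have lt: "3 * i + 1 < m" "3 * i + 2 < m" if "i < 2^k" for i using that km by linarith+
    have cv: "c (3 * i) = 0" "c (3 * i + 1) = o1 i" "c (3 * i + 2) = - o1 i" for i
      unfolding c_def md o1_def by simp_all
    have Sv: "(3 * i \<in> S) = False" "(3 * i + 1 \<in> S) = True"  "(3 * i + 2 \<in> S) = False" for i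
      unfolding S_def mem_Collect_eq md by simp_all
    have cv': "c' (3 * i) = 0" "c' (3 * i + 1) = o1 i" "c' (3 * i + 2) = 0" for i
      unfolding c'_def Sv cv by simp_all
    have AB: "A c m i = o1 i" "B c m i = - o1 i" "A c' m i = o1 i" "B c' m i = 0" "X c m i = 0" "X c' m i = 0" for i
      unfolding A_def B_def X_def cv cv' using lt[of i] by (simp_all add: o1_def)
    have c1: "P c m = (\<lambda>i. 0)" "Q c m = (\<lambda>i. 2 * o1 i)" "P c' m = o1" "Q c' m = o1"
      by (auto simp: P_def Q_def AB fun_eq_iff)
    have c2: "lincomb (X c m) x m = 0" "lincomb (X c' m) x m = 0"
      by (simp_all add: lincomb_def AB)
    have r1: "lincomb c y m = \<Phi> 0 + D (u (\<lambda>i. 0) (\<lambda>i. 2 * o1 i))"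
      and r2: "lincomb c' y m = \<Phi> 0 + D (u o1 o1)"
      unfolding rep[OF order_refl] by (simp_all add: c1 c2 W_def)
    have h2o: "lpn p (h2 (\<lambda>i. 2 * o1 i)) = 2 * lpn p (h2 o1)"
      using lp_on_scale(2)[OF hL(2)[OF fo(1)] p0, of 2] by (simp add: h2_def haar_scale)
    have "lpn p (h1 (\<lambda>i. 0)) = 0" using p0 by (simp add: h1_def haar_zero lp_on_zero)
    then have u1: "lpn p (u (\<lambda>i. 0) (\<lambda>i. 2 * o1 i)) \<le> 4 * lpn p (h2 o1)"
      using uL(2)[OF fo(3) fo(2)] h2o by simp
    have up1: "norm (lincomb c y m) \<le> C * (4 * (2 powr ((1 - \<tau>2) * real k) * G2))"
    proof -
      have "norm (lincomb c y m) \<le> C * (norm (0::'a) + lpn p (u (\<lambda>i. 0) (\<lambda>i. 2 * o1 i)))"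
        unfolding r1 by (intro up uL fo)
      also have "\<dots> \<le> C * (4 * (2 powr ((1 - \<tau>2) * real k) * G2))"
        using u1 haar_initial(1)[OF p0 \<tau>(3), of k, where ?'k = 'k] C
        by (intro mult_left_mono) (auto simp: h2_def o1_def[abs_def] G2_def)
      finally show ?thesis .
    qed
    have nz: "lincomb c y m \<noteq> 0"
    proof
      assume z: "lincomb c y m = 0"
      have "0 < 2 * 2 powr ((1 - \<tau>2) * real k)" by simp
      also have "\<dots> \<le> 2 * lpn p (h2 o1)"
        using haar_initial(2)[OF p0 \<tau>(3), of k, where ?'k = 'k] by (simp add: h2_def o1_def[abs_def])
      also have "\<dots> \<le> lpn p (u (\<lambda>i. 0) (\<lambda>i. 2 * o1 i))"
        using uL(4)[OF fo(3) fo(2)] h2o by simp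
      also have "\<dots> \<le> C * norm (lincomb c y m)"
        unfolding r1 using lo[OF uL(1)[OF fo(3) fo(2)], of 0] by simp
      finally show False using z by simp
    qed
    have lo1: "2 powr ((1 - \<tau>1) * real k) \<le> C * norm (lincomb c' y m)"
    proof -
      have "2 powr ((1 - \<tau>1) * real k) \<le> lpn p (h1 o1)"
        using haar_initial(2)[OF p0 \<tau>(1), of k, where ?'k = 'k] by (simp add: h1_def o1_def[abs_def])
      also have "\<dots> \<le> lpn p (u o1 o1)" by (intro uL fo)
      also have "\<dots> \<le> C * norm (lincomb c' y m)"
        unfolding r2 using lo[OF uL(1)[OF fo(1) fo(1)], of 0] by simp
      finally show ?thesis .
    qed
    have ma: "real m powr a \<le> 6 powr a * 2 powr (a * real k)"
    proof -
      have "real m \<le> real (6 * 2 ^ k)" using mk unfolding of_nat_le_iff by simp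
      then have "real m \<le> 6 * 2 ^ k" by simp
      then have "real m powr a \<le> (6 * 2 ^ k) powr a" using a by (intro powr_mono2) auto
      also have "\<dots> = 6 powr a * 2 powr (a * real k)"
        by (simp add: powr_mult powr_realpow[symmetric] powr_powr mult.commute)
      finally show ?thesis .
    qed
    have "\<gamma> * real m powr a * norm (lincomb c y m) \<le>
        1 / (4 * C * C * G2 * 6 powr a) * (6 powr a * 2 powr (a * real k)) * (C * (4 * (2 powr ((1 - \<tau>2) * real k) * G2)))"
      using \<gamma> ma up1 C G by (intro mult_mono mult_nonneg_nonneg) (auto simp: \<gamma>_def)
    also have "\<dots> = 2 powr (a * real k) * 2 powr ((1 - \<tau>2) * real k) / C"
      using C G by (simp add: field_simps)
    \<comment> \<open>Here a + (1 - \<tau>2) = 1 - \<tau>1.\<close>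
    also have "\<dots> = 2 powr ((1 - \<tau>1) * real k) / C"
      by (simp add: powr_add[symmetric] \<tau>1_def \<tau>2_def field_simps)
    also have "\<dots> \<le> norm (lincomb c' y m)" using lo1 C by (simp add: field_simps)
    finally show ?thesis using nz unfolding c'_def[abs_def] by blast
  qed
  have "1 / C > 0" using C by simp
  then show ?thesis
    by (rule that[OF by' fy _ conjunct1[OF ybd] conjunct2[OF ybd] \<gamma> cond])
qed

end

section \<open>Block means and oscillations\<close>

text \<open>The power mean inequality, from Young's inequality, which is convexity of exp. With
  \<open>\<mu>\<close> the p-th power mean, the two terms of Young's bound sum to the same number
  with weights 1/p and 1 - 1/p.\<close>

lemma sum_powr_le_card:
  fixes f :: "'i \<Rightarrow> real"
  assumes p: "1 < p" and E: "finite E" and f: "\<And>i. i \<in> E \<Longrightarrow> 0 \<le> f i"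
  shows "(\<Sum>i\<in>E. f i) powr p \<le> real (card E) powr (p - 1) * (\<Sum>i\<in>E. f i powr p)"
proof (cases "(\<Sum>i\<in>E. f i powr p) = 0")
  case True
  then have "\<forall>i\<in>E. f i powr p = 0" using E by (subst (asm) sum_nonneg_eq_0_iff) auto
  then have "(\<Sum>i\<in>E. f i) = 0" by simp
  then show ?thesis using True p by simp
next
  case False
  define T where "T = (\<Sum>i\<in>E. f i powr p)"
  have T: "T > 0" using False unfolding T_def by (simp add: sum_nonneg less_le)
  define c where "c = real (card E)"
  have c: "c > 0" using False E by (auto simp: c_def card_gt_0_iff)
  define \<mu> where "\<mu> = (T / c) powr (1/p)"
  have \<mu>: "\<mu> > 0" using T c by (simp add: \<mu>_def)
  have \<mu>p: "\<mu> powr p = T / c" using T c p by (simp add: \<mu>_def powr_powr)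
  have young: "x \<le> (1/p) * (\<mu> powr (1 - p) * x powr p) + (1 - 1/p) * \<mu>" if "x \<ge> 0" for x
  proof (cases "x = 0")
    case False
    then have x: "x > 0" using that by simp
    define a where "a = ln (\<mu> powr (1 - p) * x powr p)"
    have "exp ((1 - (1 - 1/p)) *\<^sub>R a + (1 - 1/p) *\<^sub>R ln \<mu>) \<le> (1 - (1 - 1/p)) * exp a + (1 - 1/p) * exp (ln \<mu>)"
      using convex_onD[OF exp_convex, of "1 - 1/p" a "ln \<mu>"] p by simp
    moreover have "(1 - (1 - 1/p)) *\<^sub>R a + (1 - 1/p) *\<^sub>R ln \<mu> = ln x"
      using x \<mu> p by (simp add: a_def ln_mult ln_powr field_simps)
    moreover have "exp a = \<mu> powr (1 - p) * x powr p"
      using x \<mu> by (simp add: a_def)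
    ultimately show ?thesis using x \<mu> by simp
  qed (use p \<mu> in simp)
  have "(\<Sum>i\<in>E. f i) \<le> (\<Sum>i\<in>E. (1/p) * (\<mu> powr (1 - p) * f i powr p) + (1 - 1/p) * \<mu>)"
    using f by (intro sum_mono young) auto
  also have "\<dots> = (1/p) * (\<mu> powr (1 - p) * T) + (1 - 1/p) * (c * \<mu>)"
    by (simp add: sum.distrib sum_distrib_left T_def c_def mult.commute mult.left_commute)
  also have "\<mu> powr (1 - p) * T = c * \<mu>"
  proof -
    have "\<mu> powr (1 - p) * T = c * (\<mu> powr (1 - p) * \<mu> powr p)" using c by (simp add: \<mu>p)
    then show ?thesis using \<mu> by (simp add: powr_add[symmetric])
  qed
  also have "(1/p) * (c * \<mu>) + (1 - 1/p) * (c * \<mu>) = c * \<mu>" by (simp add: algebra_simps)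
  finally have "(\<Sum>i\<in>E. f i) powr p \<le> (c * \<mu>) powr p"
    using f p by (intro powr_mono2) (auto intro: sum_nonneg)
  also have "\<dots> = c powr p * (T / c)" using c \<mu> by (simp add: powr_mult \<mu>p)
  also have "\<dots> = c powr (p - 1) * T" using c by (simp add: powr_diff)
  finally show ?thesis by (simp add: c_def T_def)
qed

section \<open>Dyadic blocks of indices\<close>

definition block :: "nat \<Rightarrow> nat set" where
  "block n = {2^n - 1..<2^Suc n - 1}"

definition blk :: "nat \<Rightarrow> nat" where
  "blk k = floor_log (Suc k)"

lemma finite_block [simp]: "finite (block n)"
  by (simp add: block_def)

lemma card_block [simp]: "card (block n) = 2^n"
  by (simp add: block_def)

lemma block_iff: "k \<in> block n \<longleftrightarrow> blk k = n"
proof -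
  have k: "k \<in> block n \<longleftrightarrow> 2^n \<le> Suc k \<and> Suc k < 2 * 2^n"
    by (auto simp: block_def)
  show ?thesis
    unfolding k blk_def using floor_log_eqI[of "Suc k" n] floor_log_exp2_le[of "Suc k"] floor_log_exp2_gt[of "Suc k"]
    by auto
qed

lemma blk_first [simp]: "blk (2^n - 1) = n"
  by (simp add: blk_def)

lemma blk_first' [simp]: "blk (2^n - Suc 0) = n"
  using blk_first[of n] by simp

lemma two_powr_minus: "2 powr (- real n) = 1 / 2 ^ n"
  by (simp add: powr_minus powr_realpow divide_inverse)

text \<open>The shift by one in \<open>block\<close> makes block 0 a singleton and the first N
  blocks an initial segment of the naturals.\<close>

lemma less_blk_iff: "k < 2^N - 1 \<longleftrightarrow> blk k < N"
proof -
  have b: "2^blk k \<le> Suc k" "Suc k < 2 * 2^blk k"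
    using block_iff[of k "blk k"] by (auto simp: block_def)
  show ?thesis
  proof
    assume "k < 2^N - 1"
    then have "Suc k < 2^N" by (simp add: less_diff_conv)
    then have "(2::nat)^blk k < 2^N" using b(1) by (rule order_le_less_trans[rotated])
    then show "blk k < N" by simp
  next
    assume "blk k < N"
    then have "(2::nat)^Suc (blk k) \<le> 2^N" by (intro power_increasing) auto
    then show "k < 2^N - 1" using b(2) by simp
  qed
qed

lemma sum_blocks: "(\<Sum>k<2^N - 1. f k) = (\<Sum>n<N. \<Sum>k\<in>block n. f k)"
proof (induction N)
  case (Suc N)
  have "{..<2^Suc N - 1} = {..<2^N - 1} \<union> block N" and "{..<2^N - 1} \<inter> block N = {}"
    by (auto simp: block_def)
  then show ?case using Suc by (simp add: sum.union_disjoint)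
qed simp

definition block_sum :: "(nat \<Rightarrow> 'k::real_normed_field) \<Rightarrow> nat \<Rightarrow> 'k" where
  "block_sum f n = (\<Sum>k\<in>block n. f k)"

text \<open>Normalised so that the constant 2^(-n/p) on block n, a unit vector of ell_p, has mean 1.
  By Holder's inequality the mean is then at most the ell_p-norm on the block.\<close>

definition block_mean :: "real \<Rightarrow> (nat \<Rightarrow> 'k::real_normed_field) \<Rightarrow> nat \<Rightarrow> 'k" where
  "block_mean p f n = of_real (2 powr (- (1 - 1/p) * real n)) * block_sum f n"

definition osc :: "(nat \<Rightarrow> 'k::real_normed_field) \<Rightarrow> nat \<Rightarrow> 'k" where
  "osc f k = f k - block_sum f (blk k) / 2 ^ blk k"

definition nonfirst :: "nat set" where
  "nonfirst = {k. k \<noteq> 2 ^ blk k - 1}"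

text \<open>
  Any function on a block with vanishing sum is determined by its values off the first point;
  subtracting a multiple of the value at the first point makes the passage bounded in both
  directions, uniformly in the block.
\<close>
definition reduced_osc :: "real \<Rightarrow> (nat \<Rightarrow> 'k::real_normed_field) \<Rightarrow> nat \<Rightarrow> 'k" where
  "reduced_osc p f k = (if k \<in> nonfirst
     then osc f k - of_real (2 powr (- real (blk k) / p)) * osc f (2 ^ blk k - 1) else 0)"

lemma block_sum_linear:
  "block_sum (\<lambda>k. f k + g k) n = block_sum f n + block_sum g n"
  "block_sum (\<lambda>k. a * f k) n = a * block_sum f n"
  by (simp_all add: block_sum_def sum.distrib sum_distrib_left)

lemma block_mean_linear:
  "block_mean p (\<lambda>k. f k + g k) n = block_mean p f n + block_mean p g n"
  "block_mean p (\<lambda>k. a * f k) n = a * block_mean p f n"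
  by (simp_all add: block_mean_def block_sum_linear algebra_simps)

lemma osc_linear:
  "osc (\<lambda>k. f k + g k) k = osc f k + osc g k" "osc (\<lambda>k. a * f k) k = a * osc f k"
  by (simp_all add: osc_def block_sum_linear add_divide_distrib algebra_simps)

lemma reduced_osc_linear:
  "reduced_osc p (\<lambda>k. f k + g k) k = reduced_osc p f k + reduced_osc p g k"
  "reduced_osc p (\<lambda>k. a * f k) k = a * reduced_osc p f k"
  by (simp_all add: reduced_osc_def osc_linear algebra_simps)

lemma block_sum_cong: "(\<And>k. blk k = n \<Longrightarrow> f k = g k) \<Longrightarrow> block_sum f n = block_sum g n"
  unfolding block_sum_def by (intro sum.cong) (auto simp: block_iff)

lemma block_mean_cong: "(\<And>k. blk k = n \<Longrightarrow> f k = g k) \<Longrightarrow> block_mean p f n = block_mean p g n"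
  by (simp add: block_mean_def block_sum_cong[of n f g])

lemma block_mean_zero: "(\<And>k. blk k = n \<Longrightarrow> f k = 0) \<Longrightarrow> block_mean p f n = 0"
  using block_mean_cong[of n f "\<lambda>k. 0" p] by (simp add: block_mean_def block_sum_def)

lemma osc_cong: "(\<And>j. blk j = blk k \<Longrightarrow> f j = g j) \<Longrightarrow> osc f k = osc g k"
  unfolding osc_def using block_sum_cong[of "blk k" f g] by simp

lemma osc_zero: "(\<And>j. blk j = blk k \<Longrightarrow> f j = 0) \<Longrightarrow> osc f k = 0"
  using osc_cong[of k f "\<lambda>k. 0"] by (simp add: osc_def block_sum_def)

lemma block_average_eq:
  assumes "1 < p"
  shows "block_sum f n / 2 ^ n = of_real (2 powr (- real n / p)) * block_mean p (f :: nat \<Rightarrow> 'k::real_normed_field) n"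
proof -
  have "2 powr (- real n / p) * 2 powr (- (1 - 1/p) * real n) = 2 powr (- real n)"
    by (simp add: powr_add[symmetric] algebra_simps)
  also have "\<dots> = 1 / 2 ^ n" by (simp add: powr_minus powr_realpow divide_inverse)
  finally have "of_real (2 powr (- real n / p) * 2 powr (- (1 - 1/p) * real n)) = (of_real (1 / 2 ^ n) :: 'k)"
    by (simp only:)
  then have "of_real (2 powr (- real n / p)) * of_real (2 powr (- (1 - 1/p) * real n)) = (1 / 2 ^ n :: 'k)"
    by simp
  then show ?thesis unfolding block_mean_def by (simp add: mult.assoc[symmetric])
qed

lemma norm_block_mean_le:
  "norm (block_mean p f n) \<le> 2 powr (- (1 - 1/p) * real n) * (\<Sum>k\<in>block n. norm (f k))"
  unfolding block_mean_def norm_mult block_sum_def by (intro mult_mono norm_sum) auto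

lemma block_l1_powr_le:
  assumes p: "1 < p"
  shows "(2 powr (- (1 - 1/p) * real n) * (\<Sum>k\<in>block n. norm (f k))) powr p \<le> (\<Sum>k\<in>block n. norm (f k) powr p)"
proof -
  have e: "(1 / p - 1) * real n * p = (1 - p) * real n"
    using p by (simp add: field_simps)
  have "(2 powr (- (1 - 1/p) * real n) * (\<Sum>k\<in>block n. norm (f k))) powr p =
      2 powr (- (p - 1) * real n) * (\<Sum>k\<in>block n. norm (f k)) powr p"
    using p by (simp add: powr_mult powr_powr sum_nonneg e)
  also have "\<dots> \<le> 2 powr (- (p - 1) * real n) * (real (card (block n)) powr (p - 1) * (\<Sum>k\<in>block n. norm (f k) powr p))"
    using p by (intro mult_left_mono sum_powr_le_card) auto
  also have "real (card (block n)) powr (p - 1) = 2 powr ((p - 1) * real n)"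
    by (simp add: powr_powr[symmetric] powr_realpow[symmetric] mult.commute)
  also have "2 powr (- (p - 1) * real n) * (2 powr ((p - 1) * real n) * (\<Sum>k\<in>block n. norm (f k) powr p)) =
      (\<Sum>k\<in>block n. norm (f k) powr p)"
    by (simp add: mult.assoc[symmetric] powr_add[symmetric] distrib_right[symmetric])
  finally show ?thesis .
qed

lemma block_mean_powr_le:
  assumes p: "1 < p"
  shows "norm (block_mean p f n) powr p \<le> (\<Sum>k\<in>block n. norm (f k) powr p)"
proof -
  have "norm (block_mean p f n) powr p \<le> (2 powr (- (1 - 1/p) * real n) * (\<Sum>k\<in>block n. norm (f k))) powr p"
    using p by (intro powr_mono2 norm_block_mean_le) auto
  also have "\<dots> \<le> (\<Sum>k\<in>block n. norm (f k) powr p)" by (rule block_l1_powr_le[OF p])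
  finally show ?thesis .
qed

text \<open>Bounds on single blocks with a common constant add up, as every finite set lies in an
  initial segment of blocks.\<close>

lemma lpn_blockwise:
  fixes u v :: "nat \<Rightarrow> 'k::real_normed_field"
  assumes p: "0 < p" and u: "u \<in> lp_on p UNIV" and C: "0 \<le> C"
    and le: "\<And>n. (\<Sum>k\<in>block n. norm (v k) powr p) \<le> C powr p * (\<Sum>k\<in>block n. norm (u k) powr p)"
  shows "v \<in> lp_on p UNIV" "lpn p v \<le> C * lpn p u"
proof -
  have *: "(\<Sum>k\<in>F. norm (v k) powr p) \<le> (C * lpn p u) powr p" if F: "finite F" for F
  proof -
    obtain M where "F \<subseteq> {..<M}" using finite_nat_bounded[OF F] by blast
    moreover have "M \<le> 2^M - 1" using less_exp[of M] by linarith
    ultimately have F': "F \<subseteq> {..<2^M - 1}" by auto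
    have "(\<Sum>k\<in>F. norm (v k) powr p) \<le> (\<Sum>k<2^M - 1. norm (v k) powr p)"
      using F' by (intro sum_mono2) auto
    also have "\<dots> \<le> (\<Sum>n<M. C powr p * (\<Sum>k\<in>block n. norm (u k) powr p))"
      unfolding sum_blocks by (intro sum_mono le)
    also have "\<dots> = C powr p * (\<Sum>k<2^M - 1. norm (u k) powr p)"
      unfolding sum_blocks by (simp add: sum_distrib_left)
    also have "\<dots> \<le> C powr p * lpn p u powr p"
      by (intro mult_left_mono sum_le_lpn[OF u p]) auto
    also have "\<dots> = (C * lpn p u) powr p" using C lpn_nonneg[of p u] by (simp add: powr_mult)
    finally show ?thesis .
  qed
  have C': "0 \<le> C * lpn p u" using C lpn_nonneg[of p u] by simp
  show "v \<in> lp_on p UNIV" by (rule lp_on_bounded_sums(1)[OF _ p C' *]) auto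
  show "lpn p v \<le> C * lpn p u" by (rule lp_on_bounded_sums(2)[OF _ p C' *, where I = UNIV]) auto
qed

lemma fin_supp_lp_on: "fin_supp f \<Longrightarrow> 0 < p \<Longrightarrow> f \<in> lp_on p UNIV"
  unfolding fin_supp_def
proof (elim exE)
  fix N assume "\<forall>n\<ge>N. f n = 0" "0 < p"
  then show "f \<in> lp_on p UNIV" by (intro lp_on_finite(1)[of "{..<N}"]) auto
qed

lemma sum_block_const: "(\<Sum>k\<in>block n. c (blk k)) = 2 ^ n * (c n :: 'k::real_normed_field)"
proof -
  have "(\<Sum>k\<in>block n. c (blk k)) = (\<Sum>k\<in>block n. c n)"
    by (intro sum.cong) (auto simp: block_iff)
  then show ?thesis by simp
qed

lemma osc_bounded:
  assumes p: "1 < p" and f: "fin_supp f"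
  shows "osc f \<in> lp_on p UNIV" "lpn p (osc f) \<le> 4 * lpn p f"
proof -
  have p0: "0 < p" using p by simp
  have fL: "f \<in> lp_on p UNIV" by (rule fin_supp_lp_on[OF f p0])
  define v where "v k = block_sum f (blk k) / 2 ^ blk k" for k
  have "(\<Sum>k\<in>block n. norm (v k) powr p) \<le> 1 powr p * (\<Sum>k\<in>block n. norm (f k) powr p)" for n
  proof -
    have "(\<Sum>k\<in>block n. norm (v k) powr p) = (\<Sum>k\<in>block n. norm (block_sum f n / 2 ^ n) powr p)"
      by (intro sum.cong) (auto simp: v_def block_iff)
    also have "\<dots> = 2 ^ n * norm (block_sum f n / 2 ^ n) powr p" by simp
    also have "norm (block_sum f n / 2 ^ n) = 2 powr (- real n / p) * norm (block_mean p f n)"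
      unfolding block_average_eq[OF p] norm_mult by simp
    also have "\<dots> powr p = 2 powr (- real n) * norm (block_mean p f n) powr p"
      using p by (simp add: powr_mult powr_powr)
    also have "2 ^ n * \<dots> = norm (block_mean p f n) powr p"
      by (simp add: powr_minus powr_realpow)
    also have "\<dots> \<le> (\<Sum>k\<in>block n. norm (f k) powr p)" by (rule block_mean_powr_le[OF p])
    finally show ?thesis by simp
  qed
  note v = lpn_blockwise[OF p0 fL zero_le_one this]
  have eq: "osc f = (\<lambda>k. f k - v k)" by (auto simp: osc_def v_def)
  show "osc f \<in> lp_on p UNIV" unfolding eq using p by (intro lp_on_diff(1)[OF fL v(1)]) simp
  show "lpn p (osc f) \<le> 4 * lpn p f"
    unfolding eq using lp_on_diff(2)[OF fL v(1)] v(2) p by simp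
qed

lemma sum_block_split:
  "(\<Sum>k\<in>block n. f k) = f (2 ^ n - 1) + (\<Sum>k\<in>block n \<inter> nonfirst. (f k :: 'b::comm_monoid_add))"
proof -
  have "block n = insert (2 ^ n - 1) (block n \<inter> nonfirst)" "2 ^ n - 1 \<notin> block n \<inter> nonfirst"
    by (auto simp: nonfirst_def block_iff)
  then show ?thesis by (metis finite_block finite_Int sum.insert)
qed

lemma card_block_nonfirst: "card (block n \<inter> nonfirst) = 2 ^ n - 1"
  using sum_block_split[of "\<lambda>_. 1::nat" n] by simp

lemma block_sum_osc: "block_sum (osc f) n = (0 :: 'k::real_normed_field)"
proof -
  have "block_sum (osc f) n = block_sum f n - (\<Sum>k\<in>block n. block_sum f (blk k) / 2 ^ blk k)"
    by (simp add: block_sum_def osc_def sum_subtractf)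
  also have "(\<Sum>k\<in>block n. block_sum f (blk k) / 2 ^ blk k) = 2 ^ n * (block_sum f n / 2 ^ n)"
    by (rule sum_block_const)
  finally show ?thesis by simp
qed

lemma powr_neg_le_one: "0 \<le> x \<Longrightarrow> 2 powr (- x) \<le> (1::real)"
  using powr_mono[of "- x" 0 2] by simp

text \<open>Over the block, the p-th powers of the subtracted multiples of the first value sum to at
  most the p-th power of that value. Conversely, the vanishing block sum writes
  \<open>\<beta>\<close> times the first value as minus the sum of \<open>w\<close>, and
  \<open>\<beta>\<close> is at least 2^((1-1/p) n), exactly the growth that Holder's inequality
  produces. Without the subtraction \<open>\<beta>\<close> would be 1 and the inverse not uniformly
  bounded.\<close>

lemma reduced_osc_bounded:
  fixes f :: "nat \<Rightarrow> 'k::real_normed_field"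
  assumes p: "1 < p" and f: "fin_supp f"
  shows "reduced_osc p f \<in> lp_on p nonfirst" "lpn p (reduced_osc p f) \<le> 4 * lpn p (osc f)"
    "lpn p (osc f) \<le> 6 * lpn p (reduced_osc p f)"
proof -
  have p0: "0 < p" using p by simp
  define g where "g = osc f"
  have gL: "g \<in> lp_on p UNIV" unfolding g_def by (rule osc_bounded[OF p f])
  define w where "w = reduced_osc p f"
  define \<alpha> where "\<alpha> n = 2 powr (- real n / p)" for n :: nat
  have \<alpha>: "0 < \<alpha> n" "\<alpha> n \<le> 1" for n
    using p powr_neg_le_one[of "real n / p"] by (auto simp: \<alpha>_def)
  have \<alpha>p: "\<alpha> n powr p = 1 / 2 ^ n" for n
    using p by (simp add: \<alpha>_def powr_powr two_powr_minus)
  define v where "v k = (if k \<in> nonfirst then of_real (\<alpha> (blk k)) * g (2 ^ blk k - 1) else 0)" for k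
  have vs: "(\<Sum>k\<in>block n \<inter> nonfirst. norm (v k) powr p) \<le> norm (g (2 ^ n - 1)) powr p" for n
  proof -
    have "(\<Sum>k\<in>block n \<inter> nonfirst. norm (v k) powr p) = (\<Sum>k\<in>block n \<inter> nonfirst. (\<alpha> n * norm (g (2 ^ n - 1))) powr p)"
      using \<alpha>(1) by (intro sum.cong) (auto simp: v_def block_iff norm_mult less_imp_le)
    also have "\<dots> = real (2 ^ n - 1) * (1 / 2 ^ n * norm (g (2 ^ n - 1)) powr p)"
      using \<alpha>(1)[of n] by (simp add: card_block_nonfirst powr_mult \<alpha>p del: of_nat_diff)
    also have "\<dots> \<le> 2 ^ n * (1 / 2 ^ n * norm (g (2 ^ n - 1)) powr p)"
      by (intro mult_right_mono) (auto simp: of_nat_diff)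
    finally show ?thesis by simp
  qed
  have vle: "(\<Sum>k\<in>block n. norm (v k) powr p) \<le> 1 powr p * (\<Sum>k\<in>block n. norm (g k) powr p)" for n
  proof -
    have "(\<Sum>k\<in>block n. norm (v k) powr p) = (\<Sum>k\<in>block n \<inter> nonfirst. norm (v k) powr p)"
      unfolding sum_block_split[of "\<lambda>k. norm (v k) powr p"] using p by (simp add: v_def nonfirst_def)
    also have "\<dots> \<le> norm (g (2 ^ n - 1)) powr p" by (rule vs)
    also have "\<dots> \<le> (\<Sum>k\<in>block n. norm (g k) powr p)"
      unfolding sum_block_split[of "\<lambda>k. norm (g k) powr p"] by (simp add: sum_nonneg)
    finally show ?thesis by simp
  qed
  note vL = lpn_blockwise[OF p0 gL zero_le_one vle]
  define g' where "g' k = (if k \<in> nonfirst then g k else 0)" for k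
  have g'L: "g' \<in> lp_on p UNIV" "lpn p g' \<le> lpn p g"
    by (rule lp_on_dominated[OF gL p0]; simp add: g'_def)+
  have w: "w = (\<lambda>k. g' k - v k)"
    by (auto simp: w_def reduced_osc_def g'_def v_def g_def \<alpha>_def)
  have wL: "w \<in> lp_on p UNIV" unfolding w using p by (intro lp_on_diff(1)[OF g'L(1) vL(1)]) simp
  then show "reduced_osc p f \<in> lp_on p nonfirst"
    unfolding w_def by (rule lp_on_mono) (simp add: reduced_osc_def)
  show "lpn p (reduced_osc p f) \<le> 4 * lpn p (osc f)"
    unfolding w_def[symmetric] g_def[symmetric] w
    using lp_on_diff(2)[OF g'L(1) vL(1)] g'L(2) vL(2) p by simp
  have first: "norm (g (2 ^ n - 1)) powr p \<le> (\<Sum>k\<in>block n. norm (w k) powr p)" for n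
  proof -
    let ?g = "g (2 ^ n - 1)"
    define \<beta> where "\<beta> = 1 + real (2 ^ n - 1) * \<alpha> n"
    have b0: "0 \<le> \<beta>" using \<alpha>(1)[of n] by (simp add: \<beta>_def)
    have w0: "w (2 ^ n - 1) = 0" by (simp add: w_def reduced_osc_def nonfirst_def)
    have "0 = ?g + (\<Sum>k\<in>block n \<inter> nonfirst. g k)"
      using block_sum_osc[of f n] unfolding block_sum_def g_def[symmetric] sum_block_split by simp
    also have "(\<Sum>k\<in>block n \<inter> nonfirst. g k) = (\<Sum>k\<in>block n \<inter> nonfirst. w k + of_real (\<alpha> n) * ?g)"
      by (intro sum.cong) (auto simp: w g'_def v_def block_iff)
    also have "\<dots> = (\<Sum>k\<in>block n \<inter> nonfirst. w k) + of_real (real (2 ^ n - 1) * \<alpha> n) * ?g"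
      by (simp add: sum.distrib card_block_nonfirst)
    also have "(\<Sum>k\<in>block n \<inter> nonfirst. w k) = (\<Sum>k\<in>block n. w k)"
      unfolding sum_block_split[of w] w0 by simp
    finally have "of_real \<beta> * ?g = - (\<Sum>k\<in>block n. w k)"
      by (simp add: \<beta>_def algebra_simps eq_neg_iff_add_eq_0)
    then have "norm (of_real \<beta> * ?g) = norm (\<Sum>k\<in>block n. w k)" by simp
    also have "\<dots> \<le> (\<Sum>k\<in>block n. norm (w k))" by (rule norm_sum)
    finally have le: "\<beta> * norm ?g \<le> (\<Sum>k\<in>block n. norm (w k))"
      using b0 by (simp add: norm_mult)
    have "2 powr ((1 - 1/p) * real n) = 2 ^ n * \<alpha> n"
      by (simp add: \<alpha>_def powr_realpow[symmetric] powr_add[symmetric] algebra_simps)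
    also have "\<dots> = real (2 ^ n - 1) * \<alpha> n + \<alpha> n" by (simp add: of_nat_diff algebra_simps)
    also have "\<dots> \<le> \<beta>" using \<alpha>(2)[of n] by (simp add: \<beta>_def)
    finally have b: "2 powr ((1 - 1/p) * real n) \<le> \<beta>" .
    have "norm ?g = 2 powr (- (1 - 1/p) * real n) * (2 powr ((1 - 1/p) * real n) * norm ?g)"
      by (simp add: mult.assoc[symmetric] powr_add[symmetric] distrib_right[symmetric])
    also have "\<dots> \<le> 2 powr (- (1 - 1/p) * real n) * (\<beta> * norm ?g)"
      using b by (intro mult_left_mono mult_right_mono) auto
    also have "\<dots> \<le> 2 powr (- (1 - 1/p) * real n) * (\<Sum>k\<in>block n. norm (w k))"
      using le by (intro mult_left_mono) auto
    finally have "norm ?g powr p \<le> (2 powr (- (1 - 1/p) * real n) * (\<Sum>k\<in>block n. norm (w k))) powr p"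
      using p by (intro powr_mono2) auto
    also have "\<dots> \<le> (\<Sum>k\<in>block n. norm (w k) powr p)" by (rule block_l1_powr_le[OF p])
    finally show ?thesis .
  qed
  \<comment> \<open>What the reduction removed from the oscillation, first values included: g = w +
    v'.\<close>
  define v' where "v' k = (if k \<in> nonfirst then v k else g k)" for k
  have v'le: "(\<Sum>k\<in>block n. norm (v' k) powr p) \<le> 2 powr p * (\<Sum>k\<in>block n. norm (w k) powr p)" for n
  proof -
    have "(\<Sum>k\<in>block n. norm (v' k) powr p) = norm (g (2 ^ n - 1)) powr p + (\<Sum>k\<in>block n \<inter> nonfirst. norm (v k) powr p)"
      unfolding sum_block_split[of "\<lambda>k. norm (v' k) powr p"] by (simp add: v'_def nonfirst_def)
    also have "\<dots> \<le> 2 * norm (g (2 ^ n - 1)) powr p" using vs[of n] by simp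
    also have "\<dots> \<le> 2 * (\<Sum>k\<in>block n. norm (w k) powr p)" using first[of n] by simp
    also have "\<dots> \<le> 2 powr p * (\<Sum>k\<in>block n. norm (w k) powr p)"
      using p powr_mono[of 1 p 2] by (intro mult_right_mono) (auto simp: sum_nonneg)
    finally show ?thesis .
  qed
  note v'L = lpn_blockwise[OF p0 wL _ v'le]
  have "g = (\<lambda>k. w k + v' k)"
    unfolding w by (auto simp: g'_def v'_def v_def)
  then have "lpn p g \<le> 2 * (lpn p w + lpn p v')"
    using lp_on_add(2)[OF wL v'L(1)] p by simp
  then show "lpn p (osc f) \<le> 6 * lpn p (reduced_osc p f)"
    using v'L(2) by (simp add: g_def w_def)
qed

lemma fin_supp_mono: "fin_supp f \<Longrightarrow> (\<And>k. f k = 0 \<Longrightarrow> g k = 0) \<Longrightarrow> fin_supp g"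
  unfolding fin_supp_def by blast

lemma blk_less_imp: "blk k < blk m \<Longrightarrow> k < m"
  using less_blk_iff[of k "blk m"] less_blk_iff[of m "blk m"] by linarith

lemma block_mean_le_lpn:
  assumes "1 < p" "fin_supp f"
  shows "norm (block_mean p f n) \<le> lpn p f"
proof -
  have p0: "0 < p" using assms by simp
  have "norm (block_mean p f n) powr p \<le> lpn p f powr p"
    by (rule order_trans[OF block_mean_powr_le[OF assms(1)] sum_le_lpn[OF fin_supp_lp_on[OF assms(2) p0] p0]]) simp
  then show ?thesis by (rule powr_le_cancel[OF p0 lpn_nonneg]) simp
qed

text \<open>On a block f is its oscillation plus its average, and the constant function of that
  average has ell_p-norm equal to the modulus of the block mean.\<close>

lemma lpn_block_restrict:
  fixes f :: "nat \<Rightarrow> 'k::real_normed_field"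
  assumes p: "1 < p" and f: "fin_supp f"
  shows "lpn p (\<lambda>k. if blk k = n then f k else 0) \<le> 2 * (lpn p (osc f) + norm (block_mean p f n))"
proof -
  have p0: "0 < p" using p by simp
  let ?a = "block_sum f n / 2 ^ n"
  let ?u = "\<lambda>k. if blk k = n then osc f k else 0" and ?v = "\<lambda>k. if blk k = n then ?a else 0"
  have u: "?u \<in> lp_on p UNIV" "lpn p ?u \<le> lpn p (osc f)"
    by (rule lp_on_dominated[OF osc_bounded(1)[OF p f] p0]; simp)+
  have v: "?v \<in> lp_on p UNIV" "lpn p ?v = (\<Sum>k\<in>block n. norm (?v k) powr p) powr (1/p)"
    by (rule lp_on_finite[of "block n" _ UNIV]; use p0 in \<open>simp add: block_iff\<close>)+
  have "(\<Sum>k\<in>block n. norm (?v k) powr p) = (\<Sum>k\<in>block n. norm ?a powr p)"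
    by (intro sum.cong) (auto simp: block_iff)
  also have "\<dots> = 2 ^ n * (2 powr (- real n / p) * norm (block_mean p f n)) powr p"
    unfolding block_average_eq[OF p] norm_mult by simp
  also have "\<dots> = norm (block_mean p f n) powr p"
    using p by (simp add: powr_mult powr_powr two_powr_minus)
  finally have "lpn p ?v = norm (block_mean p f n)"
    unfolding v(2) using p by (simp add: powr_powr)
  moreover have "(\<lambda>k. if blk k = n then f k else 0) = (\<lambda>k. ?u k + ?v k)"
    by (auto simp: osc_def)
  ultimately show ?thesis using lp_on_add(2)[OF u(1) v(1)] u(2) p by simp
qed

lemma sum_geometric_le:
  fixes q :: real
  assumes "0 < q" "q < 1" "m \<le> n"
  shows "(\<Sum>l\<in>{m..<n}. q ^ l) \<le> q ^ m / (1 - q)"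
proof -
  have "(1 - q) * (\<Sum>l\<in>{m..<n}. q ^ l) = q ^ m - q ^ n"
    using assms(3)
  proof (induction n rule: dec_induct)
    case (step n)
    then have "(1 - q) * (\<Sum>l\<in>{m..<Suc n}. q ^ l) = (q ^ m - q ^ n) + (1 - q) * q ^ n"
      by (simp only: sum.atLeastLessThan_Suc distrib_left step.IH)
    then show ?case by (simp add: algebra_simps)
  qed simp
  also have "\<dots> \<le> q ^ m" using assms by simp
  finally show ?thesis using assms by (simp add: field_simps)
qed

lemma sum_geometric_gt_le:
  fixes q :: real
  assumes "1 < q"
  shows "(\<Sum>l<n. q ^ l) \<le> q ^ n / (q - 1)"
  using assms by (simp add: geometric_sum divide_right_mono)

section \<open>The Dilworth-Kalton-Kutzarova norm\<close>

locale dkk = banach_space_over smul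
  for smul :: "'k::{real_normed_field, banach} \<Rightarrow> 'a::banach \<Rightarrow> 'a" +
  fixes x :: "nat \<Rightarrow> 'a" and K A B p :: real
  assumes p: "1 < p" and basic_x: "basic_seq K x" and A_pos: "0 < A"
    and norm_x: "A \<le> norm (x n)" "norm (x n) \<le> B"
begin

lemma p0: "0 < p" using p by simp

lemma K_nonneg: "0 \<le> K"
proof (rule basic_seq_nonneg[OF basic_x])
  show "x 0 \<noteq> 0" using norm_x(1)[of 0] A_pos by auto
qed

lemma B_nonneg: "0 \<le> B"
  using norm_x[of 0] A_pos by linarith

text \<open>\<open>N\<close> only truncates the series in x: once f is supported in the first N
  blocks, larger values give the same number. Finite sums avoid questions of convergence.\<close>

definition dkk_norm :: "(nat \<Rightarrow> 'k) \<Rightarrow> nat \<Rightarrow> real" where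
  "dkk_norm f N = norm (lincomb (block_mean p f) x N) + lpn p (osc f)"

lemma dkk_norm_nonneg: "0 \<le> dkk_norm f N"
  by (simp add: dkk_norm_def lpn_nonneg)

lemma dkk_norm_add:
  assumes "fin_supp f" "fin_supp g"
  shows "dkk_norm (\<lambda>k. f k + g k) N \<le> 2 * (dkk_norm f N + dkk_norm g N)"
proof -
  have "lincomb (block_mean p (\<lambda>k. f k + g k)) x N = lincomb (block_mean p f) x N + lincomb (block_mean p g) x N"
    unfolding lincomb_add[symmetric] by (rule lincomb_cong) (simp add: block_mean_linear)
  then have 1: "norm (lincomb (block_mean p (\<lambda>k. f k + g k)) x N) \<le>
      norm (lincomb (block_mean p f) x N) + norm (lincomb (block_mean p g) x N)"
    by (simp add: norm_triangle_ineq)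
  have "osc (\<lambda>k. f k + g k) = (\<lambda>k. osc f k + osc g k)" by (rule ext) (simp add: osc_linear)
  then have 2: "lpn p (osc (\<lambda>k. f k + g k)) \<le> 2 * (lpn p (osc f) + lpn p (osc g))"
    using lp_on_add(2)[OF osc_bounded(1)[OF p assms(1)] osc_bounded(1)[OF p assms(2)]] p by simp
  show ?thesis unfolding dkk_norm_def by (rule order_trans[OF add_mono[OF 1 2]]) simp
qed

lemma dkk_norm_zero: "dkk_norm (\<lambda>k. 0) N = 0"
proof -
  have "block_mean p (\<lambda>k. 0 :: 'k) = (\<lambda>n. 0)" "osc (\<lambda>k. 0 :: 'k) = (\<lambda>k. 0)"
    by (rule ext, rule block_mean_zero, simp) (rule ext, rule osc_zero, simp)
  then show ?thesis by (simp add: dkk_norm_def lincomb_def lp_on_zero p0)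
qed

lemma block_mean_le_dkk_norm:
  assumes "n < N"
  shows "norm (block_mean p f n) \<le> 2 * K / A * norm (lincomb (block_mean p f) x N)"
proof -
  have "norm (block_mean p f n) * A \<le> norm (block_mean p f n) * norm (x n)"
    by (intro mult_left_mono norm_x) auto
  also have "\<dots> \<le> 2 * K * norm (lincomb (block_mean p f) x N)"
    by (rule basic_seq_coeff[OF basic_x assms])
  finally show ?thesis using A_pos by (simp add: field_simps)
qed

text \<open>This ignores all cancellation in x; it serves for pieces of f whose block means are
  dominated by a geometric sequence.\<close>

lemma dkk_norm_le:
  assumes "fin_supp f"
  shows "dkk_norm f N \<le> 4 * lpn p f + B * (\<Sum>n<N. norm (block_mean p f n))"
proof -
  have "norm (lincomb (block_mean p f) x N) \<le> (\<Sum>n<N. norm (block_mean p f n) * B)"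
    unfolding lincomb_def
    by (rule order_trans[OF norm_sum sum_mono]) (auto simp: norm_scale intro!: mult_left_mono norm_x)
  then show ?thesis
    using osc_bounded(2)[OF p assms] by (simp add: dkk_norm_def sum_distrib_left mult.commute)
qed

lemma lincomb_single:
  assumes "n < N"
  shows "lincomb (\<lambda>j. if j = n then a else 0) x N = smul a (x n)"
proof -
  have "lincomb (\<lambda>j. if j = n then a else 0) x N = (\<Sum>j<N. if j = n then smul a (x n) else 0)"
    unfolding lincomb_def by (intro sum.cong) auto
  then show ?thesis using assms by simp
qed

text \<open>The cut meets only the block n of m. Earlier blocks are kept whole, where
  \<open>basic_x\<close> and domination of the oscillation apply. The piece \<open>h\<close> in
  block n is bounded in ell_p, because f on that block is controlled by its oscillation and one
  coefficient of x.\<close>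

lemma dkk_norm_truncate:
  "\<exists>C\<ge>1. \<forall>f N m. (\<forall>k\<ge>2^N - 1. f k = 0) \<longrightarrow>
     dkk_norm (\<lambda>k. if k < m then f k else 0) N \<le> C * dkk_norm f N"
proof -
  define \<kappa> where "\<kappa> = 2 * K / A"
  have \<kappa>: "\<kappa> \<ge> 0" using K_nonneg A_pos by (simp add: \<kappa>_def)
  define C where "C = 3 + K + (2 * B + 16) * (1 + \<kappa>)"
  have C: "C \<ge> 1" using K_nonneg B_nonneg \<kappa> by (simp add: C_def add_increasing2)
  have "dkk_norm (\<lambda>k. if k < m then f k else 0) N \<le> C * dkk_norm f N"
    if f0: "\<forall>k\<ge>2^N - 1. f k = 0" for f N m
  proof (cases "N \<le> blk m")
    \<comment> \<open>All of f lies before m.\<close>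
    case True
    then have "\<not> m < 2^N - 1" unfolding less_blk_iff by simp
    then have "f k = 0" if "\<not> k < m" for k using that f0 by simp
    then have "(\<lambda>k. if k < m then f k else 0) = f" by (intro ext) simp
    then show ?thesis using C dkk_norm_nonneg[of f N] mult_right_mono[of 1 C "dkk_norm f N"] by simp
  next
    case False
    define n where "n = blk m"
    have n: "n < N" using False by (simp add: n_def)
    have ff: "fin_supp f" using f0 unfolding fin_supp_def by blast
    define f' where "f' k = (if k < m then f k else 0)" for k
    define h where "h k = (if blk k = n \<and> k < m then f k else 0)" for k
    have fh: "fin_supp h" by (rule fin_supp_mono[OF ff]) (simp add: h_def)
    have fn: "fin_supp (\<lambda>k. if blk k = n then f k else 0)" by (rule fin_supp_mono[OF ff]) simp
    define P where "P = norm (lincomb (block_mean p f) x N)"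
    define Q where "Q = lpn p (osc f)"
    have PQ: "0 \<le> P" "0 \<le> Q" by (simp_all add: P_def Q_def lpn_nonneg)
    have lt: "k < m" if "blk k < n" for k using that blk_less_imp by (simp add: n_def)
    have gt: "\<not> k < m" if "n < blk k" for k
      using that blk_less_imp[of m k] by (simp add: n_def)
    have bm: "block_mean p f' j = (if j < n then block_mean p f j else 0) + (if j = n then block_mean p h n else 0)" for j
    proof -
      consider "j < n" | "j = n" | "n < j" by linarith
      then show ?thesis
      proof cases
        case 1
        then show ?thesis using lt by (auto simp: f'_def intro!: block_mean_cong)
      next
        case 2
        then show ?thesis by (auto simp: f'_def h_def intro!: block_mean_cong)
      next
        case 3
        then show ?thesis using gt by (auto simp: f'_def intro!: block_mean_zero)
      qed
    qed
    have os: "osc f' = (\<lambda>k. (if blk k < n then osc f k else 0) + osc h k)"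
    proof (rule ext)
      fix k
      consider "blk k < n" | "blk k = n" | "n < blk k" by linarith
      then show "osc f' k = (if blk k < n then osc f k else 0) + osc h k"
      proof cases
        case 1
        have "osc f' k = osc f k" using lt 1 by (auto simp: f'_def intro!: osc_cong)
        moreover have "osc h k = 0" using 1 by (auto simp: h_def intro!: osc_zero)
        ultimately show ?thesis using 1 by simp
      next
        case 2
        then show ?thesis by (auto simp: f'_def h_def intro!: osc_cong)
      next
        case 3
        have "osc f' k = 0" using gt 3 by (auto simp: f'_def intro!: osc_zero)
        moreover have "osc h k = 0" using 3 by (auto simp: h_def intro!: osc_zero)
        ultimately show ?thesis using 3 by simp
      qed
    qed
    have "lpn p h \<le> lpn p (\<lambda>k. if blk k = n then f k else 0)"
      by (rule lp_on_dominated(2)[OF fin_supp_lp_on[OF fn p0] p0]) (simp add: h_def)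
    also have "\<dots> \<le> 2 * (Q + norm (block_mean p f n))"
      unfolding Q_def by (rule lpn_block_restrict[OF p ff])
    also have "\<dots> \<le> 2 * (Q + \<kappa> * P)"
      using block_mean_le_dkk_norm[OF n, of f] by (simp add: P_def \<kappa>_def)
    also have "\<dots> \<le> 2 * ((1 + \<kappa>) * (P + Q))"
      using \<kappa> PQ by (simp add: algebra_simps)
    finally have lh: "lpn p h \<le> 2 * ((1 + \<kappa>) * (P + Q))" .
    have "lincomb (block_mean p f') x N = lincomb (block_mean p f) x n + smul (block_mean p h n) (x n)"
      unfolding bm[abs_def] lincomb_add lincomb_single[OF n]
      using lincomb_truncate[of n N "block_mean p f" x] n by simp
    then have "norm (lincomb (block_mean p f') x N) \<le> norm (lincomb (block_mean p f) x n) + norm (block_mean p h n) * norm (x n)"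
      by (simp add: norm_triangle_ineq flip: norm_scale)
    also have "\<dots> \<le> K * P + lpn p h * B"
      unfolding P_def using n lpn_nonneg
      by (intro add_mono basic_seqD[OF basic_x] mult_mono block_mean_le_lpn[OF p fh] norm_x) auto
    finally have 1: "norm (lincomb (block_mean p f') x N) \<le> K * P + lpn p h * B" .
    have u: "(\<lambda>k. if blk k < n then osc f k else 0) \<in> lp_on p UNIV"
      "lpn p (\<lambda>k. if blk k < n then osc f k else 0) \<le> Q"
      unfolding Q_def by (rule lp_on_dominated[OF osc_bounded(1)[OF p ff] p0]; simp)+
    have "lpn p (osc f') \<le> 2 * (Q + 4 * lpn p h)"
      unfolding os using lp_on_add(2)[OF u(1) osc_bounded(1)[OF p fh]] u(2) osc_bounded(2)[OF p fh] p by simp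
    with 1 have "dkk_norm f' N \<le> K * P + 2 * Q + (B + 8) * lpn p h"
      by (simp add: dkk_norm_def algebra_simps)
    also have "\<dots> \<le> K * P + 2 * Q + (B + 8) * (2 * ((1 + \<kappa>) * (P + Q)))"
      using B_nonneg by (intro add_left_mono mult_left_mono lh) auto
    also have "\<dots> \<le> C * (P + Q)"
      using PQ K_nonneg by (simp add: C_def algebra_simps)
    finally show ?thesis by (simp add: f'_def[abs_def] dkk_norm_def P_def Q_def)
  qed
  then show ?thesis using C by blast
qed

text \<open>
  Let \<open>t\<close> be the threshold of a greedy set \<open>S\<close>, and let \<open>n0\<close> be the first block from which on the
  bound for the block averages is at most \<open>t / 2\<close>. On the blocks before \<open>n0\<close> the part of \<open>f\<close>
  outside \<open>S\<close> is small because there are few coordinates; on the other blocks the part inside \<open>S\<close> is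
  dominated by the oscillation.
\<close>
lemma dkk_greedy:
  "\<exists>C\<ge>1. \<forall>f N S. (\<forall>k\<ge>2^N - 1. f k = 0) \<longrightarrow>
     (\<forall>j k. j \<notin> S \<longrightarrow> k \<in> S \<longrightarrow> norm (f j) \<le> norm (f k)) \<longrightarrow>
     dkk_norm (\<lambda>k. if k \<in> S then f k else 0) N \<le> C * dkk_norm f N"
proof -
  obtain C1 where C1: "C1 \<ge> 1" "\<And>f N m. \<forall>k\<ge>2^N - 1. f k = 0 \<Longrightarrow>
     dkk_norm (\<lambda>k. if k < m then f k else 0) N \<le> C1 * dkk_norm f N"
    using dkk_norm_truncate by blast
  \<comment> \<open>\<open>2 * K / A\<close> bounds block means by the norm; the maximum with 1 is
    used where the threshold is compared with M itself.\<close>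
  define \<kappa> where "\<kappa> = max 1 (2 * K / A)"
  have \<kappa>: "\<kappa> \<ge> 1" by (simp add: \<kappa>_def)
  define r where "r = 1 / p"
  define s where "s = 1 - 1 / p"
  have r: "0 < r" "r < 1" and s: "0 < s" "s < 1" using p by (auto simp: r_def s_def)
  have rs: "r + s = 1" by (simp add: r_def s_def)
  \<comment> \<open>\<open>R ^ n\<close> is 2^(n/p), the ell_p-norm of the indicator of block n, and
    \<open>q ^ n\<close> is the normalising factor 2^(-(1-1/p) n) of the block mean.\<close>
  define R where "R = 2 powr r"
  define q where "q = 2 powr (- s)"
  have R: "1 < R" "R \<le> 2" using r powr_mono[of r 1 2] by (auto simp: R_def gr_one_powr)
  have q: "0 < q" "q < 1" using s by (auto simp: q_def powr_less_one)
  have Rn: "R ^ n = 2 powr (r * real n)" and qn: "q ^ n = 2 powr (- s * real n)" for n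
    by (simp_all add: R_def q_def powr_realpow[symmetric] powr_powr)
  have qR: "q ^ n * 2 ^ n = R ^ n" for n
  proof -
    have "- s * real n + real n = (1 - s) * real n" by (simp add: algebra_simps)
    also have "1 - s = r" using rs by simp
    finally have e: "- s * real n + real n = r * real n" .
    have "2 powr (- s * real n) * 2 ^ n = 2 powr (- s * real n + real n)"
      by (simp only: powr_add) (simp add: powr_realpow)
    then show ?thesis unfolding Rn qn e .
  qed
  define C where "C = C1 + 2 * (C1 + 2 * ((8 + B * (2 / (1 - q))) + (4 * (4 * \<kappa>) + B * (4 * \<kappa> / (R - 1)))))"
  have CC: "C \<ge> 2 * (C1 + 2 * ((8 + B * (2 / (1 - q))) + (4 * (4 * \<kappa>) + B * (4 * \<kappa> / (R - 1)))))"
    using C1(1) by (simp add: C_def)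
  have C: "C \<ge> 1"
    using C1(1) B_nonneg q R \<kappa> by (simp add: C_def add_increasing2)
  have "dkk_norm (\<lambda>k. if k \<in> S then f k else 0) N \<le> C * dkk_norm f N"
    if f0: "\<forall>k\<ge>2^N - 1. f k = 0" and gr: "\<forall>j k. j \<notin> S \<longrightarrow> k \<in> S \<longrightarrow> norm (f j) \<le> norm (f k)" for f N S
  proof -
    define M where "M = dkk_norm f N"
    have M0: "M \<ge> 0" by (simp add: M_def dkk_norm_nonneg)
    have ff: "fin_supp f" using f0 unfolding fin_supp_def by blast
    \<comment> \<open>S may be infinite; the threshold is a minimum over its part in the first N
      blocks, where f lives.\<close>
    define S' where "S' = {k\<in>S. k < 2^N - 1}"
    have fS': "finite S'" by (rule finite_subset[of _ "{..<2^N - 1}"]) (auto simp: S'_def)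
    define fS where "fS k = (if k \<in> S then f k else 0)" for k
    show ?thesis
    proof (cases "\<exists>k\<in>S. f k \<noteq> 0")
      case False
      then have "fS = (\<lambda>k. 0)" by (auto simp: fS_def)
      then show ?thesis using C M0 by (simp add: fS_def[abs_def] dkk_norm_zero M_def)
    next
      case True
      then obtain k1 where k1: "k1 \<in> S" "f k1 \<noteq> 0" by blast
      then have k1': "k1 \<in> S'" using f0 by (auto simp: S'_def not_less[symmetric])
      define t where "t = Min ((\<lambda>k. norm (f k)) ` S')"
      have "t \<in> (\<lambda>k. norm (f k)) ` S'" unfolding t_def using fS' k1' by (intro Min_in) auto
      then obtain k0 where k0: "k0 \<in> S" "norm (f k0) = t" by (auto simp: S'_def)
      have out: "norm (f j) \<le> t" if "j \<notin> S" for j using gr that k0 by blast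
      have inS: "t \<le> norm (f k)" if "k \<in> S" "f k \<noteq> 0" for k
      proof -
        have "k \<in> S'" using that f0 by (auto simp: S'_def not_less[symmetric])
        then show ?thesis unfolding t_def using fS' by (intro Min_le) auto
      qed
      show ?thesis
      \<comment> \<open>A zero threshold forces f to vanish off S.\<close>
      proof (cases "t = 0")
        case True
        then have "fS = f" using out by (auto simp: fS_def fun_eq_iff)
        then show ?thesis using C M0 mult_right_mono[of 1 C M] by (simp add: fS_def[abs_def] M_def)
      next
        case False
        then have t: "t > 0" using k0 by (metis norm_ge_zero less_eq_real_def)
        have \<theta>: "norm (block_mean p f n) \<le> \<kappa> * M" for n
        proof (cases "n < N")
          case True
          have "norm (block_mean p f n) \<le> 2 * K / A * norm (lincomb (block_mean p f) x N)"
            by (rule block_mean_le_dkk_norm[OF True])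
          also have "\<dots> \<le> \<kappa> * M"
            using K_nonneg A_pos lpn_nonneg[of p "osc f"]
            by (intro mult_mono) (auto simp: \<kappa>_def M_def dkk_norm_def)
          finally show ?thesis .
        next
          case False
          have "block_mean p f n = 0"
          proof (rule block_mean_zero)
            fix k assume "blk k = n"
            then have "\<not> k < 2^N - 1" unfolding less_blk_iff using False by simp
            then show "f k = 0" using f0 by simp
          qed
          then show ?thesis using \<kappa> M0 by simp
        qed
        have av: "norm (block_sum f n / 2 ^ n) \<le> \<kappa> * M / R ^ n" for n
        proof -
          have "norm (block_sum f n / 2 ^ n) = 2 powr (- real n / p) * norm (block_mean p f n)"
            unfolding block_average_eq[OF p] norm_mult by simp
          also have "\<dots> \<le> 2 powr (- real n / p) * (\<kappa> * M)" by (intro mult_left_mono \<theta>) auto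
          also have "2 powr (- real n / p) = 1 / R ^ n"
            by (simp add: Rn r_def powr_minus divide_inverse mult.commute)
          finally show ?thesis by simp
        qed
        have oM: "norm (osc f k) \<le> M" for k
          using norm_le_lpn[OF osc_bounded(1)[OF p ff] p0, of k] norm_ge_zero[of "lincomb (block_mean p f) x N"]
          unfolding M_def dkk_norm_def by linarith
        have M: "M > 0"
        proof (rule ccontr)
          assume "\<not> M > 0"
          then have "M = 0" using M0 by simp
          then have "osc f k1 = 0" "block_sum f (blk k1) / 2 ^ blk k1 = 0"
            using oM[of k1] av[of "blk k1"] by simp_all
          then show False using k1 by (simp add: osc_def)
        qed
        have ex: "\<exists>n. \<kappa> * M / R ^ n \<le> t / 2"
        proof -
          obtain n where "(1 / R) ^ n < t / (2 * (\<kappa> * M))"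
            using real_arch_pow_inv[of "t / (2 * (\<kappa> * M))" "1 / R"] t \<kappa> M R by auto
          then show ?thesis using \<kappa> M R by (intro exI[of _ n]) (simp add: power_divide field_simps)
        qed
        define n0 where "n0 = (LEAST n. \<kappa> * M / R ^ n \<le> t / 2)"
        have n0: "\<kappa> * M / R ^ n0 \<le> t / 2" unfolding n0_def by (rule LeastI_ex[OF ex])
        \<comment> \<open>Minimality of n0 read one block earlier; the step back costs a factor R
          \<le> 2.\<close>
        have n0': "t * R ^ n0 \<le> 4 * \<kappa> * M" if "n0 > 0"
        proof -
          have "\<not> \<kappa> * M / R ^ (n0 - 1) \<le> t / 2"
            using that not_less_Least[of "n0 - 1" "\<lambda>n. \<kappa> * M / R ^ n \<le> t / 2"] by (simp add: n0_def)
          then have le: "t * R ^ (n0 - 1) \<le> 2 * \<kappa> * M" using R by (simp add: field_simps)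
          have "t * R ^ (n0 - 1) * R \<le> 2 * \<kappa> * M * 2"
            by (rule mult_mono[OF le R(2)]) (use R \<kappa> M in auto)
          moreover have "R ^ n0 = R ^ (n0 - 1) * R" using that by (metis power_minus_mult)
          ultimately show ?thesis by (simp add: mult.assoc)
        qed
        have av': "norm (block_sum f n / 2 ^ n) \<le> t / 2" if "n0 \<le> n" for n
        proof -
          have "\<kappa> * M / R ^ n \<le> \<kappa> * M / R ^ n0"
            using that R \<kappa> M by (intro divide_left_mono power_increasing mult_pos_pos) auto
          then show ?thesis using av[of n] n0 by linarith
        qed
        \<comment> \<open>With m the start of block n0, the part of f on S is f cut at m, plus
          \<open>h2\<close>, the part on S from m on, plus \<open>h1\<close>, which removes the part
          off S before m.\<close>
        define m where "m = (2::nat) ^ n0 - 1"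
        define h1 where "h1 k = (if k < m \<and> k \<notin> S then - f k else 0)" for k
        define h2 where "h2 k = (if \<not> k < m \<and> k \<in> S then f k else 0)" for k
        define f' where "f' k = (if k < m then f k else 0)" for k
        have fin: "fin_supp h1" "fin_supp h2" "fin_supp f'"
          by (rule fin_supp_mono[OF ff]; simp add: h1_def h2_def f'_def)+
        have km: "k < m \<longleftrightarrow> blk k < n0" for k unfolding m_def by (rule less_blk_iff)

        have h1t: "norm (h1 k) \<le> t" for k using out t by (auto simp: h1_def)
        have lh1: "lpn p h1 \<le> 4 * \<kappa> * M"
        proof (cases "n0 = 0")
          case True
          then have "h1 = (\<lambda>k. 0)" by (auto simp: h1_def m_def)
          then show ?thesis using \<kappa> M p0 by (simp add: lp_on_zero)
        next
          case False
          have "lpn p h1 = (\<Sum>k<m. norm (h1 k) powr p) powr (1/p)"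
            by (rule lp_on_finite(2)[where I = UNIV]) (use p0 in \<open>auto simp: h1_def\<close>)
          also have "\<dots> \<le> (2 ^ n0 * t powr p) powr (1/p)"
          proof (rule powr_mono2)
            have "(\<Sum>k<m. norm (h1 k) powr p) \<le> (\<Sum>k<m. t powr p)"
              using h1t p0 by (intro sum_mono powr_mono2) auto
            also have "\<dots> \<le> 2 ^ n0 * t powr p"
              by (simp add: m_def of_nat_diff mult_right_mono)
            finally show "(\<Sum>k<m. norm (h1 k) powr p) \<le> 2 ^ n0 * t powr p" .
          qed (use p0 in \<open>auto intro: sum_nonneg\<close>)
          also have "\<dots> = R ^ n0 * t"
            using t p0 by (simp add: powr_mult powr_powr Rn r_def powr_realpow[symmetric])
          also have "\<dots> \<le> 4 * \<kappa> * M" using n0' False by (simp add: mult.commute)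
          finally show ?thesis .
        qed
        \<comment> \<open>A growing geometric sum is dominated by its end at n0, where
          \<open>n0'\<close> applies.\<close>
        have sh1: "(\<Sum>n<N. norm (block_mean p h1 n)) \<le> 4 * \<kappa> / (R - 1) * M"
        proof -
          have b: "norm (block_mean p h1 n) \<le> (if n < n0 then t * R ^ n else 0)" for n
          proof (cases "n < n0")
            case True
            have "norm (block_mean p h1 n) \<le> 2 powr (- (1 - 1/p) * real n) * (\<Sum>k\<in>block n. norm (h1 k))"
              by (rule norm_block_mean_le)
            also have "\<dots> \<le> 2 powr (- (1 - 1/p) * real n) * (\<Sum>k\<in>block n. t)"
              by (intro mult_left_mono sum_mono h1t) auto
            also have "\<dots> = (q ^ n * 2 ^ n) * t" by (simp add: qn s_def)
            also have "\<dots> = t * R ^ n" unfolding qR by simp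
            finally show ?thesis using True by simp
          next
            case False
            then have "block_mean p h1 n = 0" by (intro block_mean_zero) (auto simp: h1_def km)
            then show ?thesis using False by simp
          qed
          have "(\<Sum>n<N. norm (block_mean p h1 n)) \<le> (\<Sum>n<N. if n < n0 then t * R ^ n else 0)"
            by (intro sum_mono b)
          also have "\<dots> = (\<Sum>n\<in>{..<N} \<inter> {..<n0}. t * R ^ n)"
            by (subst sum.inter_restrict) (auto intro: sum.cong)
          also have "\<dots> \<le> (\<Sum>n<n0. t * R ^ n)"
            using t R by (intro sum_mono2) auto
          also have "\<dots> = t * (\<Sum>n<n0. R ^ n)" by (simp add: sum_distrib_left)
          also have "\<dots> \<le> 4 * \<kappa> / (R - 1) * M"
          proof (cases "n0 = 0")
            case True
            then show ?thesis using \<kappa> M R by simp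
          next
            case False
            have "t * (\<Sum>n<n0. R ^ n) \<le> t * (R ^ n0 / (R - 1))"
              using t R by (intro mult_left_mono sum_geometric_gt_le) auto
            also have "\<dots> = (t * R ^ n0) / (R - 1)" by simp
            also have "\<dots> \<le> (4 * \<kappa> * M) / (R - 1)" using n0' False R by (intro divide_right_mono) auto
            finally show ?thesis by simp
          qed
          finally show ?thesis .
        qed
        have nh1: "dkk_norm h1 N \<le> (4 * (4 * \<kappa>) + B * (4 * \<kappa> / (R - 1))) * M"
        proof -
          have "dkk_norm h1 N \<le> 4 * lpn p h1 + B * (\<Sum>n<N. norm (block_mean p h1 n))"
            by (rule dkk_norm_le[OF fin(1)])
          also have "\<dots> \<le> 4 * (4 * \<kappa> * M) + B * (4 * \<kappa> / (R - 1) * M)"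
            by (intro add_mono mult_left_mono lh1 sh1 B_nonneg) auto
          finally show ?thesis by (simp add: algebra_simps)
        qed

        \<comment> \<open>Where \<open>h2\<close> is nonzero, f has modulus at least t, so an
          average of at most t/2 leaves the oscillation at least half of f.\<close>
        have h2o: "norm (h2 k) \<le> norm (2 * osc f k)" for k
        proof (cases "h2 k = 0")
          case False
          then have k: "\<not> k < m" "k \<in> S" "f k \<noteq> 0" and h: "h2 k = f k" by (auto simp: h2_def split: if_splits)
          have "norm (block_sum f (blk k) / 2 ^ blk k) \<le> t / 2"
            using k(1) by (intro av') (simp add: km)
          moreover have "f k = osc f k + block_sum f (blk k) / 2 ^ blk k" by (simp add: osc_def)
          then have "norm (f k) \<le> norm (osc f k) + norm (block_sum f (blk k) / 2 ^ blk k)"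
            by (metis norm_triangle_ineq)
          ultimately show ?thesis using inS[OF k(2,3)] by (simp add: h norm_mult)
        qed simp
        have lh2: "lpn p h2 \<le> 2 * M"
        proof -
          have "lpn p h2 \<le> lpn p (\<lambda>k. 2 * osc f k)"
            by (rule lp_on_dominated(2)[OF lp_on_scale(1)[OF osc_bounded(1)[OF p ff] p0] p0 h2o])
          also have "\<dots> = 2 * lpn p (osc f)"
            by (subst lp_on_scale(2)[OF osc_bounded(1)[OF p ff] p0]) simp
          also have "\<dots> \<le> 2 * M" by (simp add: M_def dkk_norm_def)
          finally show ?thesis .
        qed
        \<comment> \<open>Nonzero values of \<open>h2\<close> are at least t, so first powers are
          bounded by p-th powers at the price t^(1-p); the ell_p-bound becomes an
          ell_1-bound.\<close>
        have h2p: "norm (h2 k) \<le> t powr (1 - p) * norm (h2 k) powr p" for k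
        proof (cases "h2 k = 0")
          case False
          then have "t \<le> norm (h2 k)" using inS[of k] by (auto simp: h2_def split: if_splits)
          then have "norm (h2 k) powr (1 - p) \<le> t powr (1 - p)" using t p by (intro powr_mono2') auto
          then have "norm (h2 k) powr (1 - p) * norm (h2 k) powr p \<le> t powr (1 - p) * norm (h2 k) powr p"
            by (intro mult_right_mono) auto
          then show ?thesis using False by (simp add: powr_add[symmetric])
        qed (use p0 in simp)
        have sh2: "(\<Sum>n<N. norm (block_mean p h2 n)) \<le> 2 / (1 - q) * M"
        proof -
          define T where "T = t powr (1 - p) * (2 * M) powr p"
          have T: "T \<ge> 0" by (simp add: T_def)
          have b: "norm (block_mean p h2 n) \<le> (if n0 \<le> n then T * q ^ n else 0)" for n
          proof (cases "n0 \<le> n")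
            case True
            have "norm (block_mean p h2 n) \<le> q ^ n * (\<Sum>k\<in>block n. norm (h2 k))"
              using norm_block_mean_le[of p h2 n] by (simp add: qn s_def)
            also have "(\<Sum>k\<in>block n. norm (h2 k)) \<le> (\<Sum>k\<in>block n. t powr (1 - p) * norm (h2 k) powr p)"
              by (intro sum_mono h2p)
            also have "\<dots> = t powr (1 - p) * (\<Sum>k\<in>block n. norm (h2 k) powr p)"
              by (simp add: sum_distrib_left)
            also have "\<dots> \<le> t powr (1 - p) * lpn p h2 powr p"
              by (intro mult_left_mono sum_le_lpn[OF fin_supp_lp_on[OF fin(2) p0] p0]) auto
            also have "\<dots> \<le> T" unfolding T_def
              using lh2 p0 lpn_nonneg by (intro mult_left_mono powr_mono2) auto
            finally show ?thesis using True q by (simp add: mult.commute mult_left_mono)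
          next
            case False
            then have "block_mean p h2 n = 0" by (intro block_mean_zero) (auto simp: h2_def km)
            then show ?thesis using False by simp
          qed
          have "(\<Sum>n<N. norm (block_mean p h2 n)) \<le> (\<Sum>n<N. if n0 \<le> n then T * q ^ n else 0)"
            by (intro sum_mono b)
          also have "\<dots> = (\<Sum>n\<in>{n0..<N}. T * q ^ n)"
            by (intro sum.mono_neutral_cong_right) auto
          also have "\<dots> = T * (\<Sum>n\<in>{n0..<N}. q ^ n)" by (simp add: sum_distrib_left)
          also have "\<dots> \<le> T * (q ^ n0 / (1 - q))"
          proof (cases "n0 \<le> N")
            case True
            then show ?thesis using T q by (intro mult_left_mono sum_geometric_le) auto
          qed (use T q in simp)
          also have "\<dots> = (T * q ^ n0) / (1 - q)" by simp
          also have "\<dots> \<le> (2 * M) / (1 - q)"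
          proof (rule divide_right_mono)
            \<comment> \<open>The threshold is at least 2M / R^n0, and (R^n0)^(1-p) = q^n0. Hence
              the price t^(1-p) is compensated by the factor q^n0 at which the decaying geometric
              sum starts.\<close>
            have "2 * M / R ^ n0 \<le> 2 * (\<kappa> * M / R ^ n0)" using \<kappa> M R by (simp add: divide_right_mono)
            also have "\<dots> \<le> t" using n0 by linarith
            finally have "t powr (1 - p) \<le> (2 * M / R ^ n0) powr (1 - p)"
              using p M R by (intro powr_mono2') auto
            also have "\<dots> = (2 * M) powr (1 - p) * 2 powr (s * real n0)"
            proof -
              have "(R ^ n0) powr (1 - p) = 2 powr (- (s * real n0))"
              proof -
                have "r * real n0 * (1 - p) = - (s * real n0)"
                  using p by (simp add: r_def s_def field_simps)
                then show ?thesis by (simp only: Rn powr_powr)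
              qed
              moreover have "(2 * M / R ^ n0) powr (1 - p) = (2 * M) powr (1 - p) / (R ^ n0) powr (1 - p)"
                using M R by (intro powr_divide)
              ultimately show ?thesis by (simp add: powr_minus_divide)
            qed
            finally have "T * q ^ n0 \<le> ((2 * M) powr (1 - p) * 2 powr (s * real n0)) * (2 * M) powr p * q ^ n0"
              unfolding T_def using q by (intro mult_right_mono) auto
            also have "\<dots> = ((2 * M) powr (1 - p) * (2 * M) powr p) * (2 powr (s * real n0) * 2 powr (- s * real n0))"
              by (simp add: qn mult_ac)
            also have "\<dots> = 2 * M" using M by (simp add: powr_add[symmetric])
            finally show "T * q ^ n0 \<le> 2 * M" .
          qed (use q in simp)
          finally show ?thesis by simp
        qed
        have nh2: "dkk_norm h2 N \<le> (8 + B * (2 / (1 - q))) * M"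
        proof -
          have "dkk_norm h2 N \<le> 4 * lpn p h2 + B * (\<Sum>n<N. norm (block_mean p h2 n))"
            by (rule dkk_norm_le[OF fin(2)])
          also have "\<dots> \<le> 4 * (2 * M) + B * (2 / (1 - q) * M)"
            by (intro add_mono mult_left_mono lh2 sh2 B_nonneg) auto
          finally show ?thesis by (simp add: algebra_simps)
        qed
        have "fS = (\<lambda>k. f' k + (h2 k + h1 k))"
          by (auto simp: fS_def f'_def h1_def h2_def fun_eq_iff)
        then have "dkk_norm fS N \<le> 2 * (dkk_norm f' N + dkk_norm (\<lambda>k. h2 k + h1 k) N)"
          using dkk_norm_add[OF fin(3) fin_supp_add[OF fin(2) fin(1)]] by simp
        also have "\<dots> \<le> 2 * (C1 * M + 2 * (dkk_norm h2 N + dkk_norm h1 N))"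
          using C1(2)[OF f0, of m] dkk_norm_add[OF fin(2) fin(1), of N]
          by (intro mult_left_mono add_mono) (auto simp: f'_def[abs_def] M_def)
        also have "\<dots> \<le> 2 * (C1 * M + 2 * ((8 + B * (2 / (1 - q))) * M + (4 * (4 * \<kappa>) + B * (4 * \<kappa> / (R - 1))) * M))"
          by (intro mult_left_mono add_left_mono add_mono nh1 nh2) auto
        also have "\<dots> = (2 * (C1 + 2 * ((8 + B * (2 / (1 - q))) + (4 * (4 * \<kappa>) + B * (4 * \<kappa> / (R - 1)))))) * M"
          by (simp only: distrib_right distrib_left mult.assoc)
        also have "\<dots> \<le> C * M" by (intro mult_right_mono CC M0)
        finally show ?thesis by (simp add: fS_def[abs_def] M_def)
      qed
    qed
  qed
  then show ?thesis using C by blast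
qed

end

section \<open>The quasi-greedy basis\<close>

lemma infinite_nonfirst: "infinite nonfirst"
  unfolding infinite_nat_iff_unbounded
proof (intro allI exI conjI)
  fix m :: nat
  define n where "n = Suc (Suc m)"
  define N where "N = (2::nat) ^ n"
  have N: "2 \<le> N" "2 ^ Suc n = 2 * N" by (simp_all add: N_def n_def)
  have "N \<in> block n"
    unfolding block_def atLeastLessThan_iff N(2) N_def[symmetric] using N(1) by linarith
  then have "blk N = n" by (simp only: block_iff)
  then show "N \<in> nonfirst" using N(1) by (simp add: nonfirst_def N_def[symmetric])
  show "m < N" using less_exp[of n] unfolding N_def n_def by linarith
qed

text \<open>A right inverse of \<open>block_mean\<close> with zero oscillation: normalised constants
  on the blocks with coefficients c. These functions carry the copy of x inside the new
  basis.\<close>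

definition block_ext :: "real \<Rightarrow> (nat \<Rightarrow> 'k::real_normed_field) \<Rightarrow> nat \<Rightarrow> 'k" where
  "block_ext p c k = of_real (2 powr (- real (blk k) / p)) * c (blk k)"

lemma block_ext:
  assumes p: "1 < p"
  shows "block_mean p (block_ext p c) = c" "osc (block_ext p c) = (\<lambda>k. 0)"
proof -
  have s: "block_sum (block_ext p c) n = 2 ^ n * (of_real (2 powr (- real n / p)) * c n)" for n
    unfolding block_sum_def block_ext_def
    by (rule sum_block_const[of "\<lambda>n. of_real (2 powr (- real n / p)) * c n"])
  show "block_mean p (block_ext p c) = c"
  proof (rule ext)
    fix n
    have "2 powr (- (1 - 1/p) * real n) * (2 ^ n * 2 powr (- real n / p)) = 1"
      by (simp add: powr_realpow[symmetric] powr_add[symmetric] algebra_simps)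
    then have "of_real (2 powr (- (1 - 1/p) * real n) * (2 ^ n * 2 powr (- real n / p))) = (1 :: 'a)"
      by (simp only: of_real_1)
    then show "block_mean p (block_ext p c) n = c n"
      by (simp add: block_mean_def s mult.assoc[symmetric])
  qed
  show "osc (block_ext p c) = (\<lambda>k. 0)"
    by (rule ext) (simp add: osc_def s block_ext_def)
qed

lemma block_ext_truncate:
  "(\<lambda>k. if k < 2 ^ m - 1 then block_ext p c k else 0) = block_ext p (\<lambda>n. if n < m then c n else 0)"
  unfolding less_blk_iff by (auto simp: block_ext_def)

context banach_space_over
begin

text \<open>\<open>b k\<close> is the image of the k-th unit vector under the map that sends f to
  \<open>\<Phi>\<close> of the combination of x with the block means of f, plus \<open>D\<close> of
  \<open>reduced_osc p f\<close>. By \<open>reduced_osc_bounded\<close> its norm is equivalent to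
  \<open>dkk_norm\<close>. Block-constant functions have no oscillation, so they are mapped exactly
  to \<open>\<Phi>\<close> of combinations of x.\<close>

lemma dkk_basis_exists:
  assumes p: "1 < p" and cs: "complemented_subspace smul Y" and iso: "lp_isomorphic_to p smul Y"
    and bs: "basic_seq K x" and fd: "fundamental x" and A: "0 < A"
    and nx: "\<And>n. A \<le> norm (x n)" "\<And>n. norm (x n) \<le> B"
  obtains b K' A' B' G L where "basic_seq K' b" "fundamental b" "A' > 0"
    "\<And>n. A' \<le> norm (b n)" "\<And>n. norm (b n) \<le> B'"
    "\<And>f n S. \<forall>k\<ge>n. f k = 0 \<Longrightarrow>
        \<forall>j k. j \<notin> S \<longrightarrow> k \<in> S \<longrightarrow> norm (f j) \<le> norm (f k) \<Longrightarrow>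
        norm (lincomb (\<lambda>k. if k \<in> S then f k else 0) b n) \<le> G * norm (lincomb f b n)"
    "L > 0" "\<And>c m. norm (lincomb (block_ext p c) b (2 ^ m - 1)) \<le> L * norm (lincomb c x m)"
    "\<And>c m. norm (lincomb c x m) \<le> L * norm (lincomb (block_ext p c) b (2 ^ m - 1))"
proof -
  have p1: "1 \<le> p" and p0: "0 < p" using p by auto
  interpret dkk smul x K A B p
    by unfold_locales (use p bs A nx in auto)
  obtain \<Phi> and D :: "(nat \<Rightarrow> 'k) \<Rightarrow> 'a" and C where sp: "lp_splitting p nonfirst \<Phi> D C"
    using lp_splitting_exists[OF p1 cs iso countableI_type infinite_nonfirst] by blast
  let ?L = "lp_on p nonfirst :: (nat \<Rightarrow> 'k) set"
  have C: "C > 0" and \<Phi>add: "\<And>f g. \<Phi> (f + g) = \<Phi> f + \<Phi> g" and \<Phi>scale: "\<And>c f. \<Phi> (smul c f) = smul c (\<Phi> f)"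
    and Dadd: "\<And>u v. u \<in> ?L \<Longrightarrow> v \<in> ?L \<Longrightarrow> D (\<lambda>i. u i + v i) = D u + D v"
    and Dscale: "\<And>c u. u \<in> ?L \<Longrightarrow> D (\<lambda>i. c * u i) = smul c (D u)"
    and up: "\<And>g u. u \<in> ?L \<Longrightarrow> norm (\<Phi> g + D u) \<le> C * (norm g + lpn p u)"
    and lo: "\<And>g u. u \<in> ?L \<Longrightarrow> norm g + lpn p u \<le> C * norm (\<Phi> g + D u)"
    using sp by (auto simp: lp_splitting_def)
  have zL: "(\<lambda>i. 0) \<in> ?L" using p0 by (rule lp_on_zero)
  have lz: "lpn p (\<lambda>i :: nat. 0 :: 'k) = 0" using p0 by (rule lp_on_zero)
  have D0: "D (\<lambda>i. 0) = 0" using Dscale[OF zL, of 0] by simp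
  have \<Phi>0: "\<Phi> 0 = 0" using \<Phi>scale[of 0 0] by simp
  define \<delta> where "\<delta> k i = (if i = k then 1 else 0 :: 'k)" for k i :: nat
  have f\<delta>: "fin_supp (\<delta> k)" for k unfolding \<delta>_def by (rule fin_supp_single)
  define w where "w = (reduced_osc p :: (nat \<Rightarrow> 'k) \<Rightarrow> nat \<Rightarrow> 'k)"
  have wL: "w f \<in> ?L" if "fin_supp f" for f unfolding w_def by (rule reduced_osc_bounded(1)[OF p that])
  have w_add: "w (\<lambda>k. f k + c * g k) = (\<lambda>k. w f k + c * w g k)" for f g c
    by (rule ext) (simp add: w_def reduced_osc_linear)
  define s where "s n = (of_real (2 powr (- (1 - 1/p) * real n)) :: 'k)" for n :: nat
  define b where "b k = smul (s (blk k)) (\<Phi> (x (blk k))) + D (w (\<delta> k))" for k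
  define tr where "tr M f k = (if k < M then f k else 0 :: 'k)" for M :: nat and f and k :: nat
  have ftr: "fin_supp (tr M f)" for M f unfolding tr_def by (rule fin_supp_less)
  have bm\<delta>: "block_mean p (\<delta> k) n = (if n = blk k then s (blk k) else 0)" for k n
  proof (cases "n = blk k")
    case True
    have "block_sum (\<delta> k) (blk k) = 1"
      unfolding block_sum_def \<delta>_def by (simp add: block_iff)
    then show ?thesis using True by (simp add: block_mean_def s_def)
  next
    case False
    then have "block_mean p (\<delta> k) n = 0" by (intro block_mean_zero) (auto simp: \<delta>_def)
    then show ?thesis using False by simp
  qed
  have rep: "lincomb f b M = \<Phi> (lincomb (block_mean p (tr M f)) x N) + D (w (tr M f))"
    if "M \<le> 2 ^ N - 1" for f M N
    using that
  proof (induction M)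
    case 0
    have 1: "tr 0 f = (\<lambda>k. 0)" by (auto simp: tr_def)
    have 2: "block_mean p (\<lambda>k. 0 :: 'k) = (\<lambda>n. 0)" by (rule ext, rule block_mean_zero) simp
    have 3: "w (\<lambda>k. 0) = (\<lambda>k. 0)"
      using w_add[of "\<lambda>k. 0" 1 "\<lambda>k. 0"] by (auto simp: fun_eq_iff)
    show ?case unfolding 1 2 3 by (simp add: lincomb_def D0 \<Phi>0)
  next
    case (Suc M)
    have n: "blk M < N" using Suc.prems less_blk_iff[of M N] by linarith
    have t: "tr (Suc M) f = (\<lambda>k. tr M f k + f M * \<delta> M k)"
      by (auto simp: tr_def \<delta>_def fun_eq_iff less_Suc_eq)
    have 1: "block_mean p (tr (Suc M) f) j = block_mean p (tr M f) j + f M * (if j = blk M then s (blk M) else 0)" for j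
      unfolding t block_mean_linear bm\<delta> ..
    have 2: "lincomb (block_mean p (tr (Suc M) f)) x N =
        lincomb (block_mean p (tr M f)) x N + smul (f M) (smul (s (blk M)) (x (blk M)))"
      unfolding 1[abs_def] lincomb_add lincomb_scale lincomb_single[OF n] ..
    have 3: "D (w (tr (Suc M) f)) = D (w (tr M f)) + smul (f M) (D (w (\<delta> M)))"
      unfolding t w_add
      using Dadd[OF wL[OF ftr] lp_on_scale(1)[OF wL[OF f\<delta>] p0]] Dscale[OF wL[OF f\<delta>]] by simp
    have "lincomb f b (Suc M) = lincomb f b M + smul (f M) (b M)" by (simp add: lincomb_def)
    then show ?case
      using Suc unfolding 2 3 b_def \<Phi>add \<Phi>scale by (simp add: scale_right_distrib)
  qed
  \<comment> \<open>6 is the larger constant of \<open>reduced_osc_bounded\<close>, C that of the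
    splitting.\<close>
  define E where "E = 6 * C"
  have E: "E > 0" using C by (simp add: E_def)
  have eqv: "norm (lincomb f b M) \<le> E * dkk_norm (tr M f) N" "dkk_norm (tr M f) N \<le> E * norm (lincomb f b M)"
    if M: "M \<le> 2 ^ N - 1" for f M N
  proof -
    let ?X = "lincomb (block_mean p (tr M f)) x N"
    have "norm (lincomb f b M) \<le> C * (norm ?X + lpn p (w (tr M f)))"
      unfolding rep[OF M] by (rule up[OF wL[OF ftr]])
    also have "\<dots> \<le> C * (6 * norm ?X + 6 * lpn p (osc (tr M f)))"
      using C reduced_osc_bounded(2)[OF p ftr, of M f] lpn_nonneg[of p "osc (tr M f)"]
      by (intro mult_left_mono add_mono) (auto simp: w_def)
    finally show "norm (lincomb f b M) \<le> E * dkk_norm (tr M f) N"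
      by (simp add: dkk_norm_def E_def algebra_simps)
    have "dkk_norm (tr M f) N \<le> 6 * (norm ?X + lpn p (w (tr M f)))"
      unfolding dkk_norm_def w_def distrib_left
      by (rule add_mono[OF _ reduced_osc_bounded(3)[OF p ftr]]) simp
    also have "\<dots> \<le> 6 * (C * norm (lincomb f b M))"
      unfolding rep[OF M] by (intro mult_left_mono lo[OF wL[OF ftr]]) auto
    finally show "dkk_norm (tr M f) N \<le> E * norm (lincomb f b M)" by (simp add: E_def)
  qed
  \<comment> \<open>The first n indices lie in the first n blocks, so N = n always serves as length
    of the combination of x.\<close>
  have le2: "n \<le> 2 ^ n - 1" for n :: nat using less_exp[of n] by linarith
  have tr0: "\<forall>k\<ge>2 ^ n - 1. tr n f k = 0" for n f using le2[of n] by (auto simp: tr_def)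
  obtain C1 where C1: "C1 \<ge> 1" "\<And>f N m. \<forall>k\<ge>2^N - 1. f k = 0 \<Longrightarrow>
     dkk_norm (\<lambda>k. if k < m then f k else 0) N \<le> C1 * dkk_norm f N"
    using dkk_norm_truncate by blast
  obtain C2 where C2: "C2 \<ge> 1" "\<And>f N S. \<forall>k\<ge>2^N - 1. f k = 0 \<Longrightarrow>
     \<forall>j k. j \<notin> S \<longrightarrow> k \<in> S \<longrightarrow> norm (f j) \<le> norm (f k) \<Longrightarrow>
     dkk_norm (\<lambda>k. if k \<in> S then f k else 0) N \<le> C2 * dkk_norm f N"
    using dkk_greedy by blast
  have basic: "basic_seq (E * C1 * E) b"
    unfolding basic_seq_def
  proof (intro allI impI)
    fix f and m n :: nat assume mn: "m \<le> n"
    have t: "tr m f = (\<lambda>k. if k < m then tr n f k else 0)" using mn by (auto simp: tr_def)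
    have "norm (lincomb f b m) \<le> E * dkk_norm (tr m f) n"
      by (rule eqv(1)[OF order_trans[OF mn le2]])
    also have "\<dots> \<le> E * (C1 * dkk_norm (tr n f) n)"
      unfolding t using E by (intro mult_left_mono C1(2) tr0) auto
    also have "\<dots> \<le> E * (C1 * (E * norm (lincomb f b n)))"
      using E C1(1) by (intro mult_left_mono eqv(2) le2) auto
    finally show "norm (lincomb f b m) \<le> E * C1 * E * norm (lincomb f b n)" by (simp add: mult.assoc)
  qed
  have greedy: "norm (lincomb (\<lambda>k. if k \<in> S then f k else 0) b n) \<le> E * C2 * E * norm (lincomb f b n)"
    if f0: "\<forall>k\<ge>n. f k = 0" and gr: "\<forall>j k. j \<notin> S \<longrightarrow> k \<in> S \<longrightarrow> norm (f j) \<le> norm (f k)" for f n S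
  proof -
    have t: "tr n f = f" "tr n (\<lambda>k. if k \<in> S then f k else 0) = (\<lambda>k. if k \<in> S then f k else 0)"
      using f0 by (auto simp: tr_def fun_eq_iff not_less)
    have "norm (lincomb (\<lambda>k. if k \<in> S then f k else 0) b n) \<le> E * dkk_norm (\<lambda>k. if k \<in> S then f k else 0) n"
      using eqv(1)[of n n "\<lambda>k. if k \<in> S then f k else 0", OF le2] unfolding t .
    also have "\<dots> \<le> E * (C2 * dkk_norm f n)"
      using E f0 le2[of n] by (intro mult_left_mono C2(2) gr) auto
    also have "\<dots> \<le> E * (C2 * (E * norm (lincomb f b n)))"
      using E C2(1) eqv(2)[of n n f, OF le2] unfolding t by (intro mult_left_mono) auto
    finally show ?thesis by (simp add: mult.assoc)
  qed
  have bext: "lincomb (block_ext p c) b (2 ^ m - 1) = \<Phi> (lincomb c x m)" for c m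
  proof -
    have t: "tr (2 ^ m - 1) (block_ext p c) = block_ext p (\<lambda>n. if n < m then c n else 0)"
      unfolding block_ext_truncate[symmetric] by (auto simp: tr_def fun_eq_iff)
    have "w (block_ext p (\<lambda>n. if n < m then c n else 0)) = (\<lambda>k. 0)"
      by (auto simp: w_def reduced_osc_def block_ext(2)[OF p])
    then show ?thesis
      unfolding rep[OF order_refl] t block_ext(1)[OF p] using lincomb_truncate[of m m c x] by (simp add: D0)
  qed
  have ext_le: "norm (lincomb (block_ext p c) b (2 ^ m - 1)) \<le> C * norm (lincomb c x m)"
    "norm (lincomb c x m) \<le> C * norm (lincomb (block_ext p c) b (2 ^ m - 1))" for c m
    unfolding bext using up[OF zL, of "lincomb c x m"] lo[OF zL, of "lincomb c x m"]
    by (simp_all add: D0 lz)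
  have fund: "fundamental b"
  proof (rule lp_splitting_fundamental[OF sp p1 fd])
    fix n
    have "lincomb (\<lambda>j. if j = n then 1 else 0) x (Suc n) = x n"
      by (subst lincomb_single) auto
    then have "\<Phi> (x n) = lincomb (block_ext p (\<lambda>j. if j = n then 1 else 0)) b (2 ^ Suc n - 1)"
      unfolding bext by simp
    then show "\<Phi> (x n) \<in> cspan b" using cspan_lincomb by metis
  next
    fix i :: nat assume i: "i \<in> nonfirst"
    define n where "n = blk i"
    define \<alpha> where "\<alpha> = 2 powr (- real n / p)"
    have \<alpha>: "\<alpha> > 0" by (simp add: \<alpha>_def)
    \<comment> \<open>A preimage of the unit vector at i under \<open>reduced_osc\<close> is sought
      among functions with vanishing block sums. Its value \<open>g0\<close> at the first point is
      then forced by \<beta> g0 = -1.\<close>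
    define \<beta> where "\<beta> = 1 + real (2 ^ n - 1) * \<alpha>"
    have \<beta>: "\<beta> > 0" using \<alpha> by (simp add: \<beta>_def add_pos_nonneg)
    define g0 where "g0 = (of_real (- 1 / \<beta>) :: 'k)"
    define g where "g k = (if blk k = n then (if k \<in> nonfirst then \<delta> i k + of_real \<alpha> * g0 else g0) else 0)" for k
    have first: "2 ^ m - 1 \<notin> nonfirst" for m by (simp add: nonfirst_def)
    have g00: "g (2 ^ n - 1) = g0" using first[of n] by (simp add: g_def)
    have in_blk: "i \<in> block n \<inter> nonfirst" using i by (simp add: n_def block_iff)
    have sumg: "block_sum g m = 0" for m
    proof (cases "m = n")
      case True
      have "(\<Sum>k\<in>block n \<inter> nonfirst. g k) = (\<Sum>k\<in>block n \<inter> nonfirst. \<delta> i k + of_real \<alpha> * g0)"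
        by (intro sum.cong) (auto simp: g_def block_iff)
      also have "\<dots> = 1 + of_real (real (2 ^ n - 1) * \<alpha>) * g0"
        using in_blk by (simp add: sum.distrib card_block_nonfirst \<delta>_def)
      finally have "block_sum g n = g0 + (1 + of_real (real (2 ^ n - 1) * \<alpha>) * g0)"
        unfolding block_sum_def sum_block_split[of g] g00 by simp
      also have "\<dots> = of_real \<beta> * g0 + 1" by (simp add: \<beta>_def algebra_simps)
      also have "of_real \<beta> * g0 = of_real (\<beta> * (- 1 / \<beta>))" by (simp only: g0_def of_real_mult)
      also have "\<beta> * (- 1 / \<beta>) = - 1" using \<beta> by simp
      finally show ?thesis using True by simp
    next
      case False
      then show ?thesis unfolding block_sum_def by (intro sum.neutral) (auto simp: g_def block_iff)
    qed
    have og: "osc g = g" by (rule ext) (simp add: osc_def sumg)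
    have wg: "w g = \<delta> i"
    proof (rule ext)
      fix k
      have "\<delta> i k = 0" if "\<not> (k \<in> nonfirst \<and> blk k = n)" using that i by (auto simp: \<delta>_def n_def)
      moreover have "g (2 ^ blk k - 1) = 0" if "blk k \<noteq> n" using that by (simp add: g_def)
      ultimately show "w g k = \<delta> i k"
        by (cases "blk k = n"; cases "k \<in> nonfirst")
          (simp_all add: w_def reduced_osc_def og g00[unfolded One_nat_def] \<alpha>_def, simp_all add: g_def \<alpha>_def)
    qed
    have bg: "block_mean p g = (\<lambda>n. 0)" by (rule ext) (simp add: block_mean_def sumg)
    have t: "tr (2 ^ Suc n - 1) g = g"
      unfolding tr_def fun_eq_iff less_blk_iff by (auto simp: g_def)
    have "lincomb g b (2 ^ Suc n - 1) = D (\<delta> i)"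
      unfolding rep[OF order_refl] t bg wg by (simp add: lincomb_def \<Phi>0)
    then show "D (\<lambda>j. if j = i then 1 else 0) \<in> cspan b"
      using cspan_lincomb[of g b] unfolding \<delta>_def by metis
  qed
  define F where "F = 2 * (1 + 2 * K / A)"
  have F: "F > 0" using K_nonneg A by (simp add: F_def add_pos_nonneg)
  have nb: "1 / (F * E) \<le> norm (b k) \<and> norm (b k) \<le> E * (4 + B)" for k
  proof -
    have t: "tr (Suc k) (\<delta> k) = \<delta> k" by (auto simp: tr_def \<delta>_def)
    have "b k = lincomb (\<delta> k) b (Suc k)" by (simp add: lincomb_def \<delta>_def)
    note e = eqv[of "Suc k" "Suc k" "\<delta> k", OF le2, folded this, unfolded t]
    let ?N = "Suc k"
    have n: "blk k < ?N" using less_blk_iff[of k ?N] le2[of ?N] by linarith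
    have l\<delta>: "lpn p (\<delta> k) = 1"
      using lp_on_finite(2)[of "{k}" "\<delta> k" UNIV p] p0 by (simp add: \<delta>_def)
    have sn: "norm (s m) \<le> 1" for m
      using p powr_neg_le_one[of "(1 - 1/p) * real m"] unfolding s_def minus_mult_left by simp
    have "(\<Sum>n<?N. norm (block_mean p (\<delta> k) n)) = norm (s (blk k))"
      using n by (simp add: bm\<delta> if_distrib[of norm] cong: if_cong)
    then have "dkk_norm (\<delta> k) ?N \<le> 4 * 1 + B * norm (s (blk k))"
      using dkk_norm_le[OF f\<delta>, of k ?N] by (simp add: l\<delta>)
    also have "\<dots> \<le> 4 * 1 + B * 1" by (intro add_left_mono mult_left_mono sn B_nonneg)
    finally have "E * dkk_norm (\<delta> k) ?N \<le> E * (4 + B)" using E by (intro mult_left_mono) auto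
    then have 1: "norm (b k) \<le> E * (4 + B)" using e(1) by linarith
    have e2: "(\<lambda>i. if blk i = blk k then \<delta> k i else 0) = \<delta> k" by (auto simp: \<delta>_def)
    \<comment> \<open>A unit vector has ell_p-norm 1 and lies in one block, so its oscillation and
      its block mean there cannot both be small.\<close>
    have "1 \<le> 2 * (lpn p (osc (\<delta> k)) + norm (block_mean p (\<delta> k) (blk k)))"
      using lpn_block_restrict[OF p f\<delta>[of k], of "blk k"] unfolding e2 l\<delta> .
    also have "\<dots> \<le> 2 * (lpn p (osc (\<delta> k)) + 2 * K / A * norm (lincomb (block_mean p (\<delta> k)) x ?N))"
      by (intro mult_left_mono add_left_mono block_mean_le_dkk_norm n) auto
    also have "\<dots> \<le> F * dkk_norm (\<delta> k) ?N"
      using K_nonneg A lpn_nonneg[of p "osc (\<delta> k)"] by (simp add: F_def dkk_norm_def algebra_simps)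
    also have "\<dots> \<le> F * (E * norm (b k))" using F e(2) by (intro mult_left_mono) auto
    finally show ?thesis using 1 F E by (simp add: field_simps)
  qed
  have "1 / (F * E) > 0" using F E by simp
  then show ?thesis
    by (rule that[OF basic fund _ conjunct1[OF nb] conjunct2[OF nb] greedy C ext_le])
qed

section \<open>From finite combinations to coordinate projections of arbitrary vectors\<close>

lemma coord_proj_lincomb:
  assumes sb: "schauder_basis smul b"
  shows "coord_proj smul b A (lincomb c b n) = lincomb (\<lambda>k. if k \<in> A then c k else 0) b n"
proof -
  have "(\<lambda>k. if k \<in> A then smul (coord smul b k (lincomb c b n)) (b k) else 0) =
      (\<lambda>k. if k \<in> {..<n} then smul (if k \<in> A then c k else 0) (b k) else 0)"
    by (auto simp: coord_lincomb[OF sb] fun_eq_iff)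
  then show ?thesis
    unfolding coord_proj_def lincomb_def
    using sums_unique[OF sums_If_finite_set[of "{..<n}" "\<lambda>k. smul (if k \<in> A then c k else 0) (b k)"]] by simp
qed

text \<open>A finite greedy set stays greedy for every truncation of f beyond it, since only
  coordinates off the set change, and they become 0; a limit then covers all f. For an infinite
  greedy set the coordinates off it vanish, because all coordinates tend to 0, and the projection
  fixes f.\<close>

lemma quasi_greedy_basisI:
  assumes sb: "schauder_basis smul b" and A: "0 < A" "\<And>n. A \<le> norm (b n)" and B: "\<And>n. norm (b n) \<le> B"
    and greedy: "\<And>f n S. \<forall>k\<ge>n. f k = 0 \<Longrightarrow>
        \<forall>j k. j \<notin> S \<longrightarrow> k \<in> S \<longrightarrow> norm (f j) \<le> norm (f k) \<Longrightarrow>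
        norm (lincomb (\<lambda>k. if k \<in> S then f k else 0) b n) \<le> G * norm (lincomb f b n)"
  shows "quasi_greedy_basis smul b"
  unfolding quasi_greedy_basis_def
proof (intro conjI sb)
  have "A \<le> (INF j. norm (b j))" using A(2) by (intro cINF_greatest) auto
  then show "0 < (INF j. norm (b j))" using A(1) by linarith
  show "bdd_above (range (\<lambda>j. norm (b j)))" using B by (intro bdd_aboveI[of _ B]) auto
  have "norm (f - coord_proj smul b S f) \<le> (1 + \<bar>G\<bar>) * norm f"
    if gr: "\<forall>j k. j \<notin> S \<longrightarrow> k \<in> S \<longrightarrow> norm (coord smul b j f) \<le> norm (coord smul b k f)" for f S
  proof -
    define c where "c n = coord smul b n f" for n
    have sums: "(\<lambda>n. smul (c n) (b n)) sums f" unfolding c_def by (rule sums_coord[OF sb])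
    have lim: "(\<lambda>n. lincomb c b n) \<longlonglongrightarrow> f" using sums by (simp add: sums_def lincomb_def)
    show ?thesis
    proof (cases "finite S")
      case True
      then obtain N where N: "S \<subseteq> {..<N}" using finite_nat_bounded by blast
      define g where "g = lincomb (\<lambda>k. if k \<in> S then c k else 0) b N"
      have "(\<lambda>k. if k \<in> S then smul (c k) (b k) else 0) = (\<lambda>k. if k \<in> {..<N} then smul (if k \<in> S then c k else 0) (b k) else 0)"
        using N by (auto simp: fun_eq_iff)
      then have cp: "coord_proj smul b S f = g"
        unfolding coord_proj_def g_def lincomb_def c_def[symmetric]
        using sums_unique[OF sums_If_finite_set[of "{..<N}" "\<lambda>k. smul (if k \<in> S then c k else 0) (b k)"]] by simp
      have "norm g \<le> \<bar>G\<bar> * norm f"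
      proof (rule tendsto_lowerbound)
        show "(\<lambda>n. \<bar>G\<bar> * norm (lincomb c b n)) \<longlonglongrightarrow> \<bar>G\<bar> * norm f" by (intro tendsto_intros lim)
        show "\<forall>\<^sub>F n in sequentially. norm g \<le> \<bar>G\<bar> * norm (lincomb c b n)"
          using eventually_ge_at_top[of N]
        proof eventually_elim
          case (elim n)
          define d where "d k = (if k < n then c k else 0)" for k
          have d: "lincomb d b n = lincomb c b n" unfolding d_def by (rule lincomb_truncate) simp
          have "(\<lambda>k. if k \<in> S then d k else 0) = (\<lambda>k. if k < N then (if k \<in> S then c k else 0) else 0)"
            using N elim by (auto simp: d_def fun_eq_iff)
          then have "g = lincomb (\<lambda>k. if k \<in> S then d k else 0) b n"
            unfolding g_def using lincomb_truncate[OF elim, of "\<lambda>k. if k \<in> S then c k else 0" b] by simp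
          also have "norm \<dots> \<le> G * norm (lincomb d b n)"
          proof (rule greedy)
            show "\<forall>k\<ge>n. d k = 0" by (simp add: d_def)
            show "\<forall>j k. j \<notin> S \<longrightarrow> k \<in> S \<longrightarrow> norm (d j) \<le> norm (d k)"
            proof (intro allI impI)
              fix j k assume jk: "j \<notin> S" "k \<in> S"
              then have "d k = c k" using N elim by (auto simp: d_def)
              moreover have "norm (d j) \<le> norm (c j)" by (simp add: d_def)
              ultimately show "norm (d j) \<le> norm (d k)" using gr jk unfolding c_def by fastforce
            qed
          qed
          also have "\<dots> \<le> \<bar>G\<bar> * norm (lincomb c b n)" unfolding d by (intro mult_right_mono) auto
          finally show ?case .
        qed
      qed simp
      then have "norm f + norm g \<le> (1 + \<bar>G\<bar>) * norm f" by (simp add: algebra_simps)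
      then show ?thesis unfolding cp using norm_triangle_ineq4[of f g] by linarith
    next
      case False
      have c0: "c j = 0" if j: "j \<notin> S" for j
      proof (rule ccontr)
        assume "c j \<noteq> 0"
        then have "norm (c j) * A > 0" using A by simp
        from LIMSEQ_D[OF summable_LIMSEQ_zero[OF sums_summable[OF sums]] this] obtain N where
          N: "\<And>n. n \<ge> N \<Longrightarrow> norm (smul (c n) (b n)) < norm (c j) * A" by auto
        obtain k where k: "k \<in> S" "k \<ge> N" using False by (meson infinite_nat_iff_unbounded_le)
        have "norm (c j) * A \<le> norm (c k) * norm (b k)"
          using gr j k(1) A by (intro mult_mono) (auto simp: c_def)
        then show False using N[OF k(2)] by (simp add: norm_scale)
      qed
      then have "(\<lambda>k. if k \<in> S then smul (c k) (b k) else 0) = (\<lambda>k. smul (c k) (b k))"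
        by (auto simp: fun_eq_iff)
      then have "coord_proj smul b S f = f"
        unfolding coord_proj_def c_def[symmetric] using sums_unique[OF sums] by simp
      then show ?thesis by simp
    qed
  qed
  then show "\<exists>C. \<forall>f A. (\<forall>j k. j \<notin> A \<longrightarrow> k \<in> A \<longrightarrow> norm (coord smul b j f) \<le> norm (coord smul b k f)) \<longrightarrow>
      norm (f - coord_proj smul b A f) \<le> C * norm f" by blast
qed

end

theorem theorem3p15:
  fixes smul :: "'k::{real_normed_field, euclidean_space} \<Rightarrow> 'a::banach \<Rightarrow> 'a"
    and p a :: real
  assumes "normed_space_over smul"
    and "\<exists>x. schauder_basis smul x"
    and "1 < p"
    and "\<exists>Y. complemented_subspace smul Y \<and> lp_isomorphic_to p smul Y"
    and "0 < a" and "a < 1"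
  shows "\<exists>x. quasi_greedy_basis smul x \<and>
           (\<exists>C. \<forall>m\<ge>1. ennreal (ln (real m) powr a) \<le> ennreal C * w_cond_const smul x m)"
proof -
  interpret banach_space_over smul by (rule banach_space_over.intro[OF assms(1)])
  obtain Y where Y: "complemented_subspace smul Y" "lp_isomorphic_to p smul Y" using assms(4) by blast
  obtain x0 where "schauder_basis smul x0" using assms(2) by blast
  then obtain K0 x where x: "basic_seq K0 x" "fundamental x" "\<And>k. norm (x k) = 1"
    using schauder_normalize by blast
  have p1: "1 \<le> p" using assms(3) by simp
  obtain y K A B \<gamma> where y: "basic_seq K y" "fundamental y" "A > 0" "\<And>n. A \<le> norm (y n)" "\<And>n. norm (y n) \<le> B"
    and \<gamma>: "\<gamma> > 0" and cond: "\<And>m. m \<ge> 1 \<Longrightarrow> \<exists>c S. lincomb c y m \<noteq> 0 \<and>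
       \<gamma> * real m powr a * norm (lincomb c y m) \<le> norm (lincomb (\<lambda>k. if k \<in> S then c k else 0) y m)"
  proof (rule conditional_basis_exists[OF p1 Y x assms(5,6)], goal_cases)
    case (1 y K A B \<gamma>)
    show ?case by (rule 1(1)[OF 1(2-8)])
  qed
  obtain b K' A' B' G L where b: "basic_seq K' b" "fundamental b" "A' > 0" "\<And>n. A' \<le> norm (b n)" "\<And>n. norm (b n) \<le> B'"
    and greedy: "\<And>f n S. \<forall>k\<ge>n. f k = 0 \<Longrightarrow> \<forall>j k. j \<notin> S \<longrightarrow> k \<in> S \<longrightarrow> norm (f j) \<le> norm (f k) \<Longrightarrow>
        norm (lincomb (\<lambda>k. if k \<in> S then f k else 0) b n) \<le> G * norm (lincomb f b n)"
    and L: "L > 0" "\<And>c m. norm (lincomb (block_ext p c) b (2 ^ m - 1)) \<le> L * norm (lincomb c y m)"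
      "\<And>c m. norm (lincomb c y m) \<le> L * norm (lincomb (block_ext p c) b (2 ^ m - 1))"
  proof (rule dkk_basis_exists[OF assms(3) Y y], goal_cases)
    case (1 b K' A' B' G L)
    show ?case by (rule 1(1)[OF 1(2-10)])
  qed
  have "b n \<noteq> 0" for n using b(3) b(4)[of n] by auto
  then have sb: "schauder_basis smul b" by (rule schauder_basisI[OF b(1,2)])
  have qg: "quasi_greedy_basis smul b" by (rule quasi_greedy_basisI[OF sb b(3,4,5) greedy])
  \<comment> \<open>One factor L for each of the two passages between y and b, and 2 from ln m \<le>
    2n together with a < 1.\<close>
  define C where "C = 2 * L * L / \<gamma>"
  have C: "C \<ge> 0" using L(1) \<gamma> by (simp add: C_def)
  have "ennreal (ln (real m) powr a) \<le> ennreal C * w_cond_const smul b m" if m: "m \<ge> 1" for m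
  proof -
    \<comment> \<open>The number of whole blocks that fit into the first m coordinates; it is
      positive since m \<ge> 1.\<close>
    define n where "n = blk m"
    have mb: "2 ^ n - 1 \<le> m" "Suc m < 2 * 2 ^ n"
      using block_iff[of m n] by (auto simp: n_def block_def)
    have n1: "n \<ge> 1"
    proof (rule ccontr)
      assume "\<not> n \<ge> 1"
      then have "n = 0" by simp
      then show False using mb(2) m by simp
    qed
    obtain c S where cS: "lincomb c y n \<noteq> 0"
      "\<gamma> * real n powr a * norm (lincomb c y n) \<le> norm (lincomb (\<lambda>k. if k \<in> S then c k else 0) y n)"
      using cond[OF n1] by blast
    define f where "f = lincomb (block_ext p c) b (2 ^ n - 1)"
    \<comment> \<open>On block-constant functions the projection to these blocks acts as the
      projection to S does on combinations of y.\<close>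
    define T where "T = {k. blk k \<in> S}"
    have f0: "f \<noteq> 0" using L(3)[of c n] cS(1) by (auto simp: f_def)
    have sf: "supp smul b f \<subseteq> {..<m}"
      using mb(1) by (auto simp: supp_def f_def coord_lincomb[OF sb] split: if_splits)
    have "coord_proj smul b T f = lincomb (block_ext p (\<lambda>k. if k \<in> S then c k else 0)) b (2 ^ n - 1)"
      unfolding f_def coord_proj_lincomb[OF sb] by (rule lincomb_cong) (auto simp: block_ext_def T_def)
    then have "norm (lincomb (\<lambda>k. if k \<in> S then c k else 0) y n) \<le> L * norm (coord_proj smul b T f)"
      using L(3) by simp
    then have 1: "\<gamma> * real n powr a * norm (lincomb c y n) \<le> L * norm (coord_proj smul b T f)"
      using cS(2) by linarith
    have "\<gamma> * real n powr a * norm f \<le> \<gamma> * real n powr a * (L * norm (lincomb c y n))"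
      using L(2)[of c n] \<gamma> by (intro mult_left_mono) (auto simp: f_def)
    also have "\<dots> = L * (\<gamma> * real n powr a * norm (lincomb c y n))" by simp
    also have "\<dots> \<le> L * (L * norm (coord_proj smul b T f))"
      using 1 L(1) by (intro mult_left_mono) auto
    finally have "\<gamma> * real n powr a * norm f \<le> L * (L * norm (coord_proj smul b T f))" .
    then have ratio: "real n powr a \<le> (L * L / \<gamma>) * (norm (coord_proj smul b T f) / norm f)"
      using \<gamma> f0 by (simp add: field_simps)
    have "ln (real m) \<le> ln (2 ^ Suc n)"
    proof -
      have "real m \<le> real (2 ^ Suc n)" using mb(2) unfolding of_nat_le_iff by simp
      then show ?thesis using m by simp
    qed
    also have "\<dots> = real (Suc n) * ln 2" by (simp only: ln_realpow)
    also have "\<dots> \<le> real (2 * n) * 1"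
      using n1 ln_le_minus_one[of "2::real"] by (intro mult_mono) auto
    finally have "ln (real m) powr a \<le> (2 * real n) powr a"
      using m assms(5) by (intro powr_mono2) auto
    also have "\<dots> = 2 powr a * real n powr a" by (simp add: powr_mult)
    also have "\<dots> \<le> 2 * ((L * L / \<gamma>) * (norm (coord_proj smul b T f) / norm f))"
      using assms(5,6) powr_mono[of a 1 2] ratio by (intro mult_mono) auto
    also have "\<dots> = C * (norm (coord_proj smul b T f) / norm f)" by (simp add: C_def)
    finally have "ennreal (ln (real m) powr a) \<le> ennreal (C * (norm (coord_proj smul b T f) / norm f))"
      by (rule ennreal_leI)
    also have "\<dots> = ennreal C * ennreal (norm (coord_proj smul b T f) / norm f)"
      using C by (intro ennreal_mult) auto
    also have "\<dots> \<le> ennreal C * w_cond_const smul b m"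
      unfolding w_cond_const_def using f0 sf by (intro mult_left_mono Sup_upper) auto
    finally show ?thesis .
  qed
  then show ?thesis using qg by blast
qed

end
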